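(* Let $R$ be a commutative Noetherian ring, $\mathfrak a$ a proper ideal of $R$, $M$ a finitely generated $R$-module with $c=\operatorname{cd}(\mathfrak a,M)$, and let $\mathcal M=\{M_i\}_{i=0}^c$ be an (increasing) filtration $M_0\subseteq M_1\subseteq\cdots\subseteq M_c=M$ of $M$ by submodules with $\operatorname{cd}(\mathfrak a,M_0)=0$. The following conditions are equivalent: (i) $\operatorname{Ass}_R(M_i/M_{i-1})=\operatorname{Ass}^i_R(M)$ for all $1\le i\le c$; (ii) $\mathcal M$ is the cohomological dimension filtration of $M$ with respect to $\mathfrak a$.
   Context: $H^i_{\mathfrak a}(-)$ denotes local cohomology with respect to $\mathfrak a$ and $\operatorname{cd}(\mathfrak a,N)=\sup\{i\in\mathbb Z\mid H^i_{\mathfrak a}(N)\neq0\}$. For each $i$, $\operatorname{Ass}^i_R(M)=\{\mathfrak p\in\operatorname{Ass}_R(M)\mid\operatorname{cd}(\mathfrak a,R/\mathfrak p)=i\}$. The cohomological dimension filtration (cd-filtration) of a finitely generated $R$-module $M$ with $c=\operatorname{cd}(\mathfrak a,M)$ is the increasing filtration $\{M_i\}_{i=0}^c$ of submodules of $M$ in which $M_i$ is the largest submodule of $M$ with $\operatorname{cd}(\mathfrak a,M_i)\le i$. *)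

theory Defs
  imports
    "HOL-Algebra.Module"
    "HOL-Algebra.Ideal_Product"
    "HOL-Algebra.Ring_Divisibility"
    "HOL-Library.Extended_Real"
begin

text \<open>
  Modules are the module records of HOL-Algebra. A submodule \<open>N\<close> of \<open>M\<close>, regarded as a module in
  its own right, is \<open>M\<lparr>carrier := N\<rparr>\<close>. The inherited fields \<open>mult\<close> and \<open>one\<close> of a module record
  carry no meaning and are left unspecified below.
\<close>

section \<open>Modules\<close>

definition regular_module :: "('a, 'm) ring_scheme \<Rightarrow> ('a, 'a) module" where
  "regular_module R =
     \<lparr>carrier = carrier R, monoid.mult = monoid.mult R, one = one R, zero = zero R, add = add R, smult = monoid.mult R\<rparr>"

definition quot_module :: "('a, 'b, 'm) module_scheme \<Rightarrow> 'b set \<Rightarrow> ('a, 'b set) module" where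
  "quot_module M N =
     \<lparr>carrier = a_rcosets\<^bsub>M\<^esub> N, monoid.mult = undefined, one = undefined,
      zero = N, add = set_add M,
      smult = (\<lambda>r X. \<Union>x\<in>X. N +>\<^bsub>M\<^esub> (r \<odot>\<^bsub>M\<^esub> x))\<rparr>"

definition fin_gen_module ::
    "('a, 'n) ring_scheme \<Rightarrow> ('a, 'b, 'm) module_scheme \<Rightarrow> bool" where
  "fin_gen_module R M \<longleftrightarrow>
     (\<exists>S. finite S \<and> S \<subseteq> carrier M \<and> \<Inter>{N. submodule N R M \<and> S \<subseteq> N} = carrier M)"

text \<open>Linear maps are extensional functions, so that equality of maps is equality on the carrier.\<close>

definition module_homs ::
    "('a, 'n) ring_scheme \<Rightarrow> ('a, 'b, 'm) module_scheme \<Rightarrow> ('a, 'c, 'k) module_scheme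
      \<Rightarrow> ('b \<Rightarrow> 'c) set" where
  "module_homs R A B =
     {f \<in> carrier A \<rightarrow>\<^sub>E carrier B.
        (\<forall>x\<in>carrier A. \<forall>y\<in>carrier A. f (x \<oplus>\<^bsub>A\<^esub> y) = f x \<oplus>\<^bsub>B\<^esub> f y) \<and>
        (\<forall>r\<in>carrier R. \<forall>x\<in>carrier A. f (r \<odot>\<^bsub>A\<^esub> x) = r \<odot>\<^bsub>B\<^esub> f x)}"

definition hom_module ::
    "('a, 'n) ring_scheme \<Rightarrow> ('a, 'b, 'm) module_scheme \<Rightarrow> ('a, 'c, 'k) module_scheme
      \<Rightarrow> ('a, 'b \<Rightarrow> 'c) module" where
  "hom_module R A B =
     \<lparr>carrier = module_homs R A B, monoid.mult = undefined, one = undefined,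
      zero = (\<lambda>x\<in>carrier A. \<zero>\<^bsub>B\<^esub>),
      add = (\<lambda>f g. \<lambda>x\<in>carrier A. f x \<oplus>\<^bsub>B\<^esub> g x),
      smult = (\<lambda>r f. \<lambda>x\<in>carrier A. r \<odot>\<^bsub>B\<^esub> f x)\<rparr>"

definition free_module :: "('a, 'n) ring_scheme \<Rightarrow> nat \<Rightarrow> ('a, nat \<Rightarrow> 'a) module" where
  "free_module R k =
     \<lparr>carrier = {..<k} \<rightarrow>\<^sub>E carrier R, monoid.mult = undefined, one = undefined,
      zero = (\<lambda>j\<in>{..<k}. \<zero>\<^bsub>R\<^esub>),
      add = (\<lambda>v w. \<lambda>j\<in>{..<k}. v j \<oplus>\<^bsub>R\<^esub> w j),
      smult = (\<lambda>r v. \<lambda>j\<in>{..<k}. r \<otimes>\<^bsub>R\<^esub> v j)\<rparr>"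

definition Ass :: "('a, 'n) ring_scheme \<Rightarrow> ('a, 'b, 'm) module_scheme \<Rightarrow> 'a set set" where
  "Ass R M =
     {p. primeideal p R \<and>
         (\<exists>x\<in>carrier M. p = {r \<in> carrier R. r \<odot>\<^bsub>M\<^esub> x = \<zero>\<^bsub>M\<^esub>})}"

section \<open>Ext\<close>

text \<open>
  A resolution \<open>\<cdots> \<rightarrow> F\<^sub>2 \<rightarrow> F\<^sub>1 \<rightarrow> F\<^sub>0 \<rightarrow> A \<rightarrow> 0\<close> with \<open>F\<^sub>n\<close> free of finite rank \<open>res_rank n\<close>, differential
  \<open>res_diff n : F\<^sub>n\<^sub>+\<^sub>1 \<rightarrow> F\<^sub>n\<close> and augmentation \<open>res_aug : F\<^sub>0 \<rightarrow> A\<close>. Over a Noetherian ring every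
  finitely generated module has such a resolution; \<open>Ext\<close> below is meant for such first arguments.
\<close>

record ('a, 'b) resolution =
  res_rank :: "nat \<Rightarrow> nat"
  res_diff :: "nat \<Rightarrow> (nat \<Rightarrow> 'a) \<Rightarrow> (nat \<Rightarrow> 'a)"
  res_aug :: "(nat \<Rightarrow> 'a) \<Rightarrow> 'b"

definition res_module ::
    "('a, 'n) ring_scheme \<Rightarrow> ('a, 'b) resolution \<Rightarrow> nat \<Rightarrow> ('a, nat \<Rightarrow> 'a) module" where
  "res_module R F n = free_module R (res_rank F n)"

definition is_free_resolution ::
    "('a, 'n) ring_scheme \<Rightarrow> ('a, 'b, 'm) module_scheme \<Rightarrow> ('a, 'b) resolution \<Rightarrow> bool" where
  "is_free_resolution R A F \<longleftrightarrow>
     res_aug F \<in> module_homs R (res_module R F 0) A \<and>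
     (\<forall>n. res_diff F n \<in> module_homs R (res_module R F (Suc n)) (res_module R F n)) \<and>
     res_aug F ` carrier (res_module R F 0) = carrier A \<and>
     res_diff F 0 ` carrier (res_module R F 1) = a_kernel (res_module R F 0) A (res_aug F) \<and>
     (\<forall>n. res_diff F (Suc n) ` carrier (res_module R F (Suc (Suc n))) =
          a_kernel (res_module R F (Suc n)) (res_module R F n) (res_diff F n))"

definition free_resolution ::
    "('a, 'n) ring_scheme \<Rightarrow> ('a, 'b, 'm) module_scheme \<Rightarrow> ('a, 'b) resolution" where
  "free_resolution R A = (SOME F. is_free_resolution R A F)"

definition hom_diff ::
    "('a, 'n) ring_scheme \<Rightarrow> ('a, 'b) resolution \<Rightarrow> nat
      \<Rightarrow> ((nat \<Rightarrow> 'a) \<Rightarrow> 'c) \<Rightarrow> ((nat \<Rightarrow> 'a) \<Rightarrow> 'c)" where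
  "hom_diff R F i f = compose (carrier (res_module R F (Suc i))) f (res_diff F i)"

definition cocycles ::
    "('a, 'n) ring_scheme \<Rightarrow> ('a, 'b) resolution \<Rightarrow> ('a, 'c, 'm) module_scheme \<Rightarrow> nat
      \<Rightarrow> ((nat \<Rightarrow> 'a) \<Rightarrow> 'c) set" where
  "cocycles R F M i =
     a_kernel (hom_module R (res_module R F i) M) (hom_module R (res_module R F (Suc i)) M)
       (hom_diff R F i)"

definition coboundaries ::
    "('a, 'n) ring_scheme \<Rightarrow> ('a, 'b) resolution \<Rightarrow> ('a, 'c, 'm) module_scheme \<Rightarrow> nat
      \<Rightarrow> ((nat \<Rightarrow> 'a) \<Rightarrow> 'c) set" where
  "coboundaries R F M i =
     (case i of
        0 \<Rightarrow> {\<zero>\<^bsub>hom_module R (res_module R F 0) M\<^esub>}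
      | Suc j \<Rightarrow> hom_diff R F j ` module_homs R (res_module R F j) M)"

definition Ext ::
    "('a, 'n) ring_scheme \<Rightarrow> nat \<Rightarrow> ('a, 'b, 'm) module_scheme \<Rightarrow> ('a, 'c, 'k) module_scheme
      \<Rightarrow> ('a, ((nat \<Rightarrow> 'a) \<Rightarrow> 'c) set) module" where
  "Ext R i A M =
     (let F = free_resolution R A in
        quot_module
          ((hom_module R (res_module R F i) M)\<lparr>carrier := cocycles R F M i\<rparr>)
          (coboundaries R F M i))"

definition is_chain_lift ::
    "('a, 'n) ring_scheme \<Rightarrow> ('a, 'b) resolution \<Rightarrow> ('a, 'c) resolution \<Rightarrow> ('b \<Rightarrow> 'c)
      \<Rightarrow> (nat \<Rightarrow> (nat \<Rightarrow> 'a) \<Rightarrow> (nat \<Rightarrow> 'a)) \<Rightarrow> bool" where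
  "is_chain_lift R F G f \<theta> \<longleftrightarrow>
     (\<forall>n. \<theta> n \<in> module_homs R (res_module R F n) (res_module R G n)) \<and>
     (\<forall>v\<in>carrier (res_module R F 0). res_aug G (\<theta> 0 v) = f (res_aug F v)) \<and>
     (\<forall>n. \<forall>v\<in>carrier (res_module R F (Suc n)).
        res_diff G n (\<theta> (Suc n) v) = \<theta> n (res_diff F n v))"

text \<open>
  The map \<open>Ext\<^sup>i(B, M) \<rightarrow> Ext\<^sup>i(A, M)\<close> induced by \<open>f : A \<rightarrow> B\<close>: a class \<open>X\<close> is sent to the common class
  of the pullbacks of its representatives along a lift of \<open>f\<close> to the resolutions.
\<close>

definition Ext_map ::
    "('a, 'n) ring_scheme \<Rightarrow> nat \<Rightarrow> ('a, 'b, 'm) module_scheme \<Rightarrow> ('a, 'c, 'k) module_scheme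
      \<Rightarrow> ('a, 'd, 'l) module_scheme \<Rightarrow> ('b \<Rightarrow> 'c)
      \<Rightarrow> ((nat \<Rightarrow> 'a) \<Rightarrow> 'd) set \<Rightarrow> ((nat \<Rightarrow> 'a) \<Rightarrow> 'd) set" where
  "Ext_map R i A B M f X =
     (let F = free_resolution R A;
          G = free_resolution R B;
          \<theta> = (SOME \<theta>. is_chain_lift R F G f \<theta>)
      in \<Union>\<phi>\<in>X. coboundaries R F M i +>\<^bsub>hom_module R (res_module R F i) M\<^esub>
                   compose (carrier (res_module R F i)) \<phi> (\<theta> i))"

section \<open>Local cohomology\<close>

text \<open>The direct limit of a system \<open>t n m : E n \<rightarrow> E m\<close> (\<open>n \<le> m\<close>) of modules.\<close>

definition dirlim_rel ::
    "(nat \<Rightarrow> ('a, 'b, 'm) module_scheme) \<Rightarrow> (nat \<Rightarrow> nat \<Rightarrow> 'b \<Rightarrow> 'b) \<Rightarrow> ((nat \<times> 'b) \<times> (nat \<times> 'b)) set"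
  where
  "dirlim_rel E t =
     {((n, x), (m, y)). x \<in> carrier (E n) \<and> y \<in> carrier (E m) \<and>
        (\<exists>k. n \<le> k \<and> m \<le> k \<and> t n k x = t m k y)}"

definition dirlim ::
    "(nat \<Rightarrow> ('a, 'b, 'm) module_scheme) \<Rightarrow> (nat \<Rightarrow> nat \<Rightarrow> 'b \<Rightarrow> 'b)
      \<Rightarrow> ('a, (nat \<times> 'b) set) module" where
  "dirlim E t =
     \<lparr>carrier = (SIGMA n:UNIV. carrier (E n)) // dirlim_rel E t,
      monoid.mult = undefined, one = undefined,
      zero = dirlim_rel E t `` {(0, \<zero>\<^bsub>E 0\<^esub>)},
      add = (\<lambda>X Y. \<Union>(n, x)\<in>X. \<Union>(m, y)\<in>Y.
               dirlim_rel E t ``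
                 {(max n m, t n (max n m) x \<oplus>\<^bsub>E (max n m)\<^esub> t m (max n m) y)}),
      smult = (\<lambda>r X. \<Union>(n, x)\<in>X. dirlim_rel E t `` {(n, r \<odot>\<^bsub>E n\<^esub> x)})\<rparr>"

definition ideal_power_quot ::
    "('a, 'n) ring_scheme \<Rightarrow> 'a set \<Rightarrow> nat \<Rightarrow> ('a, 'a set) module" where
  "ideal_power_quot R I n = quot_module (regular_module R) (I [^]\<^bsub>ideals_set R\<^esub> n)"

definition ideal_power_proj ::
    "('a, 'n) ring_scheme \<Rightarrow> 'a set \<Rightarrow> nat \<Rightarrow> nat \<Rightarrow> 'a set \<Rightarrow> 'a set" where
  "ideal_power_proj R I m n =
     (\<lambda>X\<in>carrier (ideal_power_quot R I m). \<Union>x\<in>X. (I [^]\<^bsub>ideals_set R\<^esub> n) +>\<^bsub>R\<^esub> x)"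

text \<open>
  \<open>H\<^sup>i\<^sub>I(M)\<close> as the direct limit of the modules \<open>Ext\<^sup>i(R/I\<^sup>n, M)\<close> along the maps induced by the
  projections \<open>R/I\<^sup>m \<rightarrow> R/I\<^sup>n\<close> for \<open>n \<le> m\<close>.
\<close>

definition local_cohomology ::
    "('a, 'n) ring_scheme \<Rightarrow> 'a set \<Rightarrow> nat \<Rightarrow> ('a, 'b, 'm) module_scheme
      \<Rightarrow> ('a, (nat \<times> ((nat \<Rightarrow> 'a) \<Rightarrow> 'b) set) set) module" where
  "local_cohomology R I i M =
     dirlim
       (\<lambda>n. Ext R i (ideal_power_quot R I n) M)
       (\<lambda>n m. Ext_map R i (ideal_power_quot R I m) (ideal_power_quot R I n) M
                 (ideal_power_proj R I m n))"

text \<open>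
  The supremum is taken in the extended reals, so that the supremum of the empty set is \<open>- \<infinity>\<close>.
  Local cohomology vanishes in negative degrees, which are therefore omitted.
\<close>

definition cd :: "('a, 'n) ring_scheme \<Rightarrow> 'a set \<Rightarrow> ('a, 'b, 'm) module_scheme \<Rightarrow> ereal" where
  "cd R I M =
     Sup {ereal (real i) | i.
            carrier (local_cohomology R I i M) \<noteq> {\<zero>\<^bsub>local_cohomology R I i M\<^esub>}}"

definition Ass_cd ::
    "('a, 'n) ring_scheme \<Rightarrow> 'a set \<Rightarrow> nat \<Rightarrow> ('a, 'b, 'm) module_scheme \<Rightarrow> 'a set set" where
  "Ass_cd R I i M =
     {p \<in> Ass R M. cd R I (quot_module (regular_module R) p) = ereal (real i)}"

definition is_cd_filtration ::
    "('a, 'n) ring_scheme \<Rightarrow> 'a set \<Rightarrow> ('a, 'b, 'm) module_scheme \<Rightarrow> nat \<Rightarrow> (nat \<Rightarrow> 'b set) \<Rightarrow> bool"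
  where
  "is_cd_filtration R I M c Mf \<longleftrightarrow>
     cd R I M = ereal (real c) \<and>
     (\<forall>i\<le>c. submodule (Mf i) R M \<and>
             cd R I (M\<lparr>carrier := Mf i\<rparr>) \<le> ereal (real i) \<and>
             (\<forall>N. submodule N R M \<and> cd R I (M\<lparr>carrier := N\<rparr>) \<le> ereal (real i) \<longrightarrow> N \<subseteq> Mf i))"

end

theory Submission
  imports Defs
begin

text \<open>
  Write \<open>H\<^sup>i(M)\<close> for local cohomology. The theorem is formal once one knows that, for finitely
  generated \<open>M\<close>, the vanishing of \<open>H\<^sup>j(M)\<close> for all \<open>j > c\<close> depends only on the primes containing the
  annihilator of \<open>M\<close>: then the largest submodule with \<open>cd \<le> i\<close> is the torsion submodule for the
  specialization closed set of primes \<open>p\<close> with \<open>cd(R/p) \<le> i\<close>, and passing to the quotient by it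
  removes exactly these primes from \<open>Ass M\<close>.

  The support theorem follows by descending induction on \<open>j\<close> from the long exact sequence: if \<open>p\<close>
  contains the annihilator of \<open>M\<close>, then some quotient of \<open>M\<close> is isomorphic to a nonzero ideal of
  \<open>R/p\<close>. The induction starts because \<open>H\<^sup>j\<close> vanishes for \<open>j\<close> larger than the number of generators of
  \<open>I\<close>. For this, an element \<open>x\<close> of \<open>I\<close> that is regular on \<open>R/p\<close>
  reduces the claim to \<open>R/(p + xR)\<close>, since every class is killed by a power of \<open>x\<close>; and if \<open>p\<close>
  contains \<open>I\<close>, the Artin--Rees lemma makes the transition maps between the resolutions of the
  \<open>R/I\<^sup>n\<close> homotopic to maps divisible by \<open>I\<close>.
\<close>

section \<open>Linear maps and submodules\<close>

text \<open>Resolutions and comparison maps are arbitrary choices, so pulling cochains back through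
  two levels agrees with the direct pullback only up to coboundaries. Vanishing of
  \<open>H^i\<close> is therefore restated as: every cocycle becomes a coboundary at some higher
  level. The two exactness statements that matter are proved in this form, by lifting cochains out
  of free modules; no long exact sequence is constructed. Localization is avoided as well: a prime
  is in the support of a finitely generated module exactly when it contains the annihilator, and
  elements outside the prime are multiplied in by hand. Filtrations with prime quotients are
  replaced by submodules that are maximal for a property, so that a single associated prime of a
  quotient is enough each time. Modules annihilated by I need an argument of their own: with
  injective resolutions they are acyclic because their injective hulls are torsion, whereas with
  free resolutions of the \<open>R/I^n\<close> the vanishing has to be extracted from the transition
  maps.\<close>

locale noetherian_cring = cring R + noetherian_ring R for R (structure)

text \<open>Linearity on the carrier without the extensionality of \<open>module_homs\<close>, so
  that composites and pointwise sums qualify as they stand; \<open>restrict\<close> enters only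
  where an element of \<open>module_homs\<close> is demanded.\<close>

definition linear_map ::
    "('a, 'n) ring_scheme \<Rightarrow> ('a, 'b, 'm) module_scheme \<Rightarrow> ('a, 'c, 'k) module_scheme
      \<Rightarrow> ('b \<Rightarrow> 'c) \<Rightarrow> bool" where
  "linear_map R A B f \<longleftrightarrow>
     (\<forall>x\<in>carrier A. f x \<in> carrier B) \<and>
     (\<forall>x\<in>carrier A. \<forall>y\<in>carrier A. f (x \<oplus>\<^bsub>A\<^esub> y) = f x \<oplus>\<^bsub>B\<^esub> f y) \<and>
     (\<forall>r\<in>carrier R. \<forall>x\<in>carrier A. f (r \<odot>\<^bsub>A\<^esub> x) = r \<odot>\<^bsub>B\<^esub> f x)"

lemma linear_mapI:
  assumes "\<And>x. x \<in> carrier A \<Longrightarrow> f x \<in> carrier B"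
    and "\<And>x y. x \<in> carrier A \<Longrightarrow> y \<in> carrier A \<Longrightarrow> f (x \<oplus>\<^bsub>A\<^esub> y) = f x \<oplus>\<^bsub>B\<^esub> f y"
    and "\<And>r x. r \<in> carrier R \<Longrightarrow> x \<in> carrier A \<Longrightarrow> f (r \<odot>\<^bsub>A\<^esub> x) = r \<odot>\<^bsub>B\<^esub> f x"
  shows "linear_map R A B f"
  using assms unfolding linear_map_def by blast

lemma linear_mapD:
  assumes "linear_map R A B f"
  shows "x \<in> carrier A \<Longrightarrow> f x \<in> carrier B"
    and "x \<in> carrier A \<Longrightarrow> y \<in> carrier A \<Longrightarrow> f (x \<oplus>\<^bsub>A\<^esub> y) = f x \<oplus>\<^bsub>B\<^esub> f y"
    and "r \<in> carrier R \<Longrightarrow> x \<in> carrier A \<Longrightarrow> f (r \<odot>\<^bsub>A\<^esub> x) = r \<odot>\<^bsub>B\<^esub> f x"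
  using assms unfolding linear_map_def by blast+

lemma linear_map_cong:
  assumes "linear_map R A B f" "module R A" "\<And>x. x \<in> carrier A \<Longrightarrow> g x = f x"
  shows "linear_map R A B g"
proof -
  interpret A: module R A by fact
  show ?thesis using assms(1,3) unfolding linear_map_def by auto
qed

lemma module_homs_iff_linear_map:
  "f \<in> module_homs R A B \<longleftrightarrow> linear_map R A B f \<and> f \<in> extensional (carrier A)"
  unfolding module_homs_def linear_map_def PiE_def Pi_def by auto

lemma linear_map_comp:
  assumes "linear_map R A B f" "linear_map R B C g"
  shows "linear_map R A C (\<lambda>x. g (f x))"
  using assms unfolding linear_map_def by auto

context
  fixes R :: "('a, 'n) ring_scheme" and A :: "('a, 'b, 'm) module_scheme"
    and B :: "('a, 'c, 'k) module_scheme"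
  assumes A: "module R A" and B: "module R B"
begin

interpretation A: module R A by (rule A)
interpretation B: module R B by (rule B)

lemma linear_map_zero:
  assumes "linear_map R A B f"
  shows "f \<zero>\<^bsub>A\<^esub> = \<zero>\<^bsub>B\<^esub>"
proof -
  have "f (\<zero>\<^bsub>R\<^esub> \<odot>\<^bsub>A\<^esub> \<zero>\<^bsub>A\<^esub>) = \<zero>\<^bsub>R\<^esub> \<odot>\<^bsub>B\<^esub> f \<zero>\<^bsub>A\<^esub>"
    using linear_mapD(3)[OF assms A.R.zero_closed A.M.zero_closed] .
  thus ?thesis using linear_mapD(1)[OF assms A.M.zero_closed] by simp
qed

lemma linear_map_uminus:
  assumes "linear_map R A B f" "x \<in> carrier A"
  shows "f (\<ominus>\<^bsub>A\<^esub> x) = \<ominus>\<^bsub>B\<^esub> f x"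
proof -
  have "f x \<oplus>\<^bsub>B\<^esub> f (\<ominus>\<^bsub>A\<^esub> x) = \<zero>\<^bsub>B\<^esub>"
    using linear_mapD(2)[OF assms(1), of x "\<ominus>\<^bsub>A\<^esub> x"] assms linear_map_zero[OF assms(1)]
    by (simp add: A.r_neg)
  thus ?thesis
    using linear_mapD(1)[OF assms(1)] assms(2) B.minus_equality B.a_comm A.a_inv_closed by metis
qed

lemma linear_map_minus:
  assumes "linear_map R A B f" "x \<in> carrier A" "y \<in> carrier A"
  shows "f (x \<ominus>\<^bsub>A\<^esub> y) = f x \<ominus>\<^bsub>B\<^esub> f y"
  using assms linear_mapD(2)[OF assms(1), of x "\<ominus>\<^bsub>A\<^esub> y"] linear_map_uminus
  by (simp add: a_minus_def)

lemma linear_map_const_zero: "linear_map R A B (\<lambda>x. \<zero>\<^bsub>B\<^esub>)"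
  by (rule linear_mapI) auto

lemma linear_map_plus:
  assumes "linear_map R A B f" "linear_map R A B g"
  shows "linear_map R A B (\<lambda>x. f x \<oplus>\<^bsub>B\<^esub> g x)"
  using assms
  by (intro linear_mapI) (auto simp: linear_mapD B.a_ac B.smult_r_distr)

lemma linear_map_diff:
  assumes "linear_map R A B f" "linear_map R A B g"
  shows "linear_map R A B (\<lambda>x. f x \<ominus>\<^bsub>B\<^esub> g x)"
  using assms
  by (intro linear_mapI)
     (auto simp: linear_mapD a_minus_def B.a_ac B.minus_add B.smult_r_distr B.smult_r_minus)

lemma linear_map_scale:
  assumes "linear_map R A B f" "r \<in> carrier R"
  shows "linear_map R A B (\<lambda>x. r \<odot>\<^bsub>B\<^esub> f x)"
proof (rule linear_mapI)
  fix s x assume "s \<in> carrier R" "x \<in> carrier A"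
  thus "r \<odot>\<^bsub>B\<^esub> f (s \<odot>\<^bsub>A\<^esub> x) = s \<odot>\<^bsub>B\<^esub> (r \<odot>\<^bsub>B\<^esub> f x)"
    using assms by (simp add: linear_mapD B.smult_assoc1[symmetric] A.m_comm)
qed (use assms in \<open>auto simp: linear_mapD B.smult_r_distr\<close>)

lemma submodule_image:
  assumes "linear_map R A B f" "submodule N R A"
  shows "submodule (f ` N) R B"
proof (rule B.submoduleI)
  note N = A.submoduleE[OF assms(2)]
  show "f ` N \<subseteq> carrier B" using N(1) linear_mapD(1)[OF assms(1)] by auto
  have "\<zero>\<^bsub>A\<^esub> \<in> N" using subgroup.one_closed[OF submodule.axioms(1)[OF assms(2)]] by simp
  thus "\<zero>\<^bsub>B\<^esub> \<in> f ` N" using linear_map_zero[OF assms(1)] by force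
  show "\<ominus>\<^bsub>B\<^esub> y \<in> f ` N" if "y \<in> f ` N" for y
    using that N(1,3) linear_map_uminus[OF assms(1)] by force
  show "y \<oplus>\<^bsub>B\<^esub> z \<in> f ` N" if "y \<in> f ` N" "z \<in> f ` N" for y z
  proof -
    obtain y' z' where "y' \<in> N" "y = f y'" "z' \<in> N" "z = f z'" using \<open>y \<in> f ` N\<close> \<open>z \<in> f ` N\<close> by auto
    thus ?thesis using N(1,5) linear_mapD(2)[OF assms(1), of y' z'] by (metis image_eqI subsetD)
  qed
  show "r \<odot>\<^bsub>B\<^esub> y \<in> f ` N" if "r \<in> carrier R" "y \<in> f ` N" for r y
  proof -
    obtain y' where "y' \<in> N" "y = f y'" using \<open>y \<in> f ` N\<close> by auto
    thus ?thesis using N(1,4) linear_mapD(3)[OF assms(1), of r y'] \<open>r \<in> carrier R\<close>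
      by (metis image_eqI subsetD)
  qed
qed

end

lemma submoduleD:
  assumes "submodule N R M"
  shows "N \<subseteq> carrier M" "\<zero>\<^bsub>M\<^esub> \<in> N"
    "\<And>x y. x \<in> N \<Longrightarrow> y \<in> N \<Longrightarrow> x \<oplus>\<^bsub>M\<^esub> y \<in> N"
    "\<And>r x. r \<in> carrier R \<Longrightarrow> x \<in> N \<Longrightarrow> r \<odot>\<^bsub>M\<^esub> x \<in> N"
    "\<And>x. x \<in> N \<Longrightarrow> \<ominus>\<^bsub>M\<^esub> x \<in> N"
    "\<And>x y. x \<in> N \<Longrightarrow> y \<in> N \<Longrightarrow> x \<ominus>\<^bsub>M\<^esub> y \<in> N"
proof -
  note s = submodule.axioms(1)[OF assms]
  show "N \<subseteq> carrier M" using subgroup.subset[OF s] by simp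
  show "\<zero>\<^bsub>M\<^esub> \<in> N" using subgroup.one_closed[OF s] by simp
  show a: "x \<oplus>\<^bsub>M\<^esub> y \<in> N" if "x \<in> N" "y \<in> N" for x y
    using subgroup.m_closed[OF s that] by simp
  show "r \<odot>\<^bsub>M\<^esub> x \<in> N" if "r \<in> carrier R" "x \<in> N" for r x
    using submodule.smult_closed[OF assms that] .
  show i: "\<ominus>\<^bsub>M\<^esub> x \<in> N" if "x \<in> N" for x
    using subgroup.m_inv_closed[OF s that] by (simp add: a_inv_def)
  show "x \<ominus>\<^bsub>M\<^esub> y \<in> N" if "x \<in> N" "y \<in> N" for x y
    using a i that by (simp add: a_minus_def)
qed

section \<open>Adjoining an element, generated submodules and colon ideals\<close>

definition adjoin ::
    "('a, 'n) ring_scheme \<Rightarrow> ('a, 'b, 'm) module_scheme \<Rightarrow> 'b set \<Rightarrow> 'b \<Rightarrow> 'b set" where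
  "adjoin R M N x = {s \<oplus>\<^bsub>M\<^esub> r \<odot>\<^bsub>M\<^esub> x | s r. s \<in> N \<and> r \<in> carrier R}"

definition generated ::
    "('a, 'n) ring_scheme \<Rightarrow> ('a, 'b, 'm) module_scheme \<Rightarrow> 'b set \<Rightarrow> 'b set" where
  "generated R M S = \<Inter>{N. submodule N R M \<and> S \<subseteq> N}"

text \<open>The ideal (N : S). With S = {x} it is the annihilator of the class of x in M/N, with N =
  0 and S the whole carrier it is the annihilator of M; associated primes and supports are both
  expressed through it.\<close>

definition colon ::
    "('a, 'n) ring_scheme \<Rightarrow> ('a, 'b, 'm) module_scheme \<Rightarrow> 'b set \<Rightarrow> 'b set \<Rightarrow> 'a set" where
  "colon R M N S = {r \<in> carrier R. \<forall>x\<in>S. r \<odot>\<^bsub>M\<^esub> x \<in> N}"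

context module
begin

lemma submodule_module: "submodule N R M \<Longrightarrow> module R (M\<lparr>carrier := N\<rparr>)"
  by (rule submodule.submodule_is_module) (auto intro: module_axioms)

lemma submoduleI':
  assumes "N \<subseteq> carrier M" "\<zero>\<^bsub>M\<^esub> \<in> N" "\<And>x y. x \<in> N \<Longrightarrow> y \<in> N \<Longrightarrow> x \<oplus>\<^bsub>M\<^esub> y \<in> N"
    and "\<And>r x. r \<in> carrier R \<Longrightarrow> x \<in> N \<Longrightarrow> r \<odot>\<^bsub>M\<^esub> x \<in> N"
  shows "submodule N R M"
proof (rule submoduleI)
  fix x assume x: "x \<in> N"
  hence "(\<ominus> \<one>) \<odot>\<^bsub>M\<^esub> x \<in> N" using assms(4) by auto
  thus "\<ominus>\<^bsub>M\<^esub> x \<in> N" using x assms(1) by (auto simp: smult_l_minus)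
qed (use assms in auto)

lemma zero_submodule: "submodule {\<zero>\<^bsub>M\<^esub>} R M"
  by (rule submoduleI') auto

lemma submodule_Int: "submodule N R M \<Longrightarrow> submodule N' R M \<Longrightarrow> submodule (N \<inter> N') R M"
  by (rule submoduleI') (auto dest: submoduleD)

lemma submodule_submodule_iff:
  assumes "submodule N R M"
  shows "submodule K R (M\<lparr>carrier := N\<rparr>) \<longleftrightarrow> submodule K R M \<and> K \<subseteq> N"
proof -
  interpret N: module R "M\<lparr>carrier := N\<rparr>" by (rule submodule_module[OF assms])
  show ?thesis
  proof
    assume K: "submodule K R (M\<lparr>carrier := N\<rparr>)"
    show "submodule K R M \<and> K \<subseteq> N"
      using submoduleD(1-4)[OF K] submoduleD(1)[OF assms]
      by (auto intro!: submoduleI')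
  next
    assume K: "submodule K R M \<and> K \<subseteq> N"
    thus "submodule K R (M\<lparr>carrier := N\<rparr>)"
      using submoduleD(2-4)[of K R M] by (intro N.submoduleI') auto
  qed
qed

lemma submodule_adjoin:
  assumes "submodule N R M" "x \<in> carrier M"
  shows "submodule (adjoin R M N x) R M"
proof (rule submoduleI')
  note N = submoduleD[OF assms(1)]
  show "adjoin R M N x \<subseteq> carrier M" using N(1) assms(2) by (auto simp: adjoin_def)
  have "\<zero>\<^bsub>M\<^esub> = \<zero>\<^bsub>M\<^esub> \<oplus>\<^bsub>M\<^esub> \<zero> \<odot>\<^bsub>M\<^esub> x" using assms by simp
  thus "\<zero>\<^bsub>M\<^esub> \<in> adjoin R M N x" using N(2) unfolding adjoin_def by blast
  show "y \<oplus>\<^bsub>M\<^esub> z \<in> adjoin R M N x" if yz: "y \<in> adjoin R M N x" "z \<in> adjoin R M N x" for y z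
  proof -
    obtain s r s' r' where *: "y = s \<oplus>\<^bsub>M\<^esub> r \<odot>\<^bsub>M\<^esub> x" "s \<in> N" "r \<in> carrier R"
      "z = s' \<oplus>\<^bsub>M\<^esub> r' \<odot>\<^bsub>M\<^esub> x" "s' \<in> N" "r' \<in> carrier R"
      using yz unfolding adjoin_def by blast
    hence "s \<in> carrier M" "s' \<in> carrier M" using N(1) by auto
    hence "y \<oplus>\<^bsub>M\<^esub> z = (s \<oplus>\<^bsub>M\<^esub> s') \<oplus>\<^bsub>M\<^esub> (r \<oplus> r') \<odot>\<^bsub>M\<^esub> x"
      using * assms by (simp add: smult_l_distr M.a_ac)
    thus ?thesis using * N(3) unfolding adjoin_def by blast
  qed
  show "t \<odot>\<^bsub>M\<^esub> y \<in> adjoin R M N x" if t: "t \<in> carrier R" and y: "y \<in> adjoin R M N x" for t y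
  proof -
    obtain s r where *: "y = s \<oplus>\<^bsub>M\<^esub> r \<odot>\<^bsub>M\<^esub> x" "s \<in> N" "r \<in> carrier R"
      using y unfolding adjoin_def by blast
    hence "t \<odot>\<^bsub>M\<^esub> y = t \<odot>\<^bsub>M\<^esub> s \<oplus>\<^bsub>M\<^esub> (t \<otimes> r) \<odot>\<^bsub>M\<^esub> x"
      using t N(1) assms(2) by (auto simp: smult_r_distr smult_assoc1)
    thus ?thesis using * t N(4) unfolding adjoin_def by blast
  qed
qed

lemma adjoin_incl:
  assumes "submodule N R M" "x \<in> carrier M"
  shows "N \<subseteq> adjoin R M N x" "x \<in> adjoin R M N x"
proof -
  have "s = s \<oplus>\<^bsub>M\<^esub> \<zero> \<odot>\<^bsub>M\<^esub> x" if "s \<in> N" for s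
    using assms submoduleD(1)[OF assms(1)] that by auto
  thus "N \<subseteq> adjoin R M N x" unfolding adjoin_def by blast
  have "x = \<zero>\<^bsub>M\<^esub> \<oplus>\<^bsub>M\<^esub> \<one> \<odot>\<^bsub>M\<^esub> x" using assms by simp
  thus "x \<in> adjoin R M N x" using submoduleD(2)[OF assms(1)] unfolding adjoin_def by blast
qed

lemma adjoin_least:
  assumes "submodule K R M" "N \<subseteq> K" "x \<in> K"
  shows "adjoin R M N x \<subseteq> K"
  using assms submoduleD[OF assms(1)] unfolding adjoin_def by blast

lemma generated_submodule:
  assumes "S \<subseteq> carrier M"
  shows "submodule (generated R M S) R M"
proof (rule submoduleI')
  show "generated R M S \<subseteq> carrier M"
    using carrier_is_submodule assms unfolding generated_def by blast
qed (auto simp: generated_def dest: submoduleD)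

lemma generated_incl: "S \<subseteq> generated R M S"
  unfolding generated_def by blast

lemma generated_least: "submodule N R M \<Longrightarrow> S \<subseteq> N \<Longrightarrow> generated R M S \<subseteq> N"
  unfolding generated_def by blast

lemma generated_empty: "generated R M {} = {\<zero>\<^bsub>M\<^esub>}"
  using generated_least[OF zero_submodule, of "{}"] submoduleD(2)[OF generated_submodule[of "{}"]]
  by auto

lemma generated_insert:
  assumes "S \<subseteq> carrier M" "x \<in> carrier M"
  shows "generated R M (insert x S) = adjoin R M (generated R M S) x"
proof
  note G = generated_submodule[OF assms(1)]
  show "generated R M (insert x S) \<subseteq> adjoin R M (generated R M S) x"
    using generated_least submodule_adjoin[OF G assms(2)] adjoin_incl[OF G assms(2)]
      generated_incl[of S] by (metis insert_subset subset_trans)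
  show "adjoin R M (generated R M S) x \<subseteq> generated R M (insert x S)"
  proof (rule adjoin_least)
    show s: "submodule (generated R M (insert x S)) R M"
      using generated_submodule assms by simp
    show "generated R M S \<subseteq> generated R M (insert x S)"
      using generated_least[OF s] generated_incl[of "insert x S"] by simp
    show "x \<in> generated R M (insert x S)" using generated_incl[of "insert x S"] by simp
  qed
qed

lemma idealI':
  assumes "I \<subseteq> carrier R" "\<zero> \<in> I" "\<And>x y. x \<in> I \<Longrightarrow> y \<in> I \<Longrightarrow> x \<oplus> y \<in> I"
    and "\<And>r x. r \<in> carrier R \<Longrightarrow> x \<in> I \<Longrightarrow> r \<otimes> x \<in> I"
  shows "ideal I R"
proof (rule idealI)
  show "subgroup I (add_monoid R)"
  proof (rule R.add.subgroupI)
    fix x assume x: "x \<in> I"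
    hence "(\<ominus> \<one>) \<otimes> x \<in> I" using assms(4) by auto
    moreover have "x \<in> carrier R" using x assms(1) by auto
    ultimately show "\<ominus> x \<in> I" by (simp add: R.l_minus)
  qed (use assms in auto)
  show "x \<otimes> y \<in> I" if "y \<in> carrier R" "x \<in> I" for y x
    using assms(1,4) that R.m_comm by (metis subsetD)
qed (use assms in \<open>auto intro: R.ring_axioms\<close>)

text \<open>These are the coefficients that x can have in elements of N, modulo G. They play the
  role of the leading coefficients in Hilbert's basis theorem when x is added to the generators of
  G.\<close>

lemma ideal_transporter:
  assumes "submodule G R M" "submodule N R M" "x \<in> carrier M"
  shows "ideal {r \<in> carrier R. \<exists>s\<in>G. s \<oplus>\<^bsub>M\<^esub> r \<odot>\<^bsub>M\<^esub> x \<in> N} R"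
proof (rule idealI')
  note G = submoduleD[OF assms(1)] and N = submoduleD[OF assms(2)]
  let ?I = "{r \<in> carrier R. \<exists>s\<in>G. s \<oplus>\<^bsub>M\<^esub> r \<odot>\<^bsub>M\<^esub> x \<in> N}"
  show "\<zero> \<in> ?I" using G(2) N(2) assms(3) by (auto intro!: bexI[of _ "\<zero>\<^bsub>M\<^esub>"])
  show "r \<oplus> r' \<in> ?I" if rr': "r \<in> ?I" "r' \<in> ?I" for r r'
  proof -
    obtain s s' where *: "s \<in> G" "s \<oplus>\<^bsub>M\<^esub> r \<odot>\<^bsub>M\<^esub> x \<in> N" "s' \<in> G" "s' \<oplus>\<^bsub>M\<^esub> r' \<odot>\<^bsub>M\<^esub> x \<in> N"
      using rr' by blast
    have "(s \<oplus>\<^bsub>M\<^esub> r \<odot>\<^bsub>M\<^esub> x) \<oplus>\<^bsub>M\<^esub> (s' \<oplus>\<^bsub>M\<^esub> r' \<odot>\<^bsub>M\<^esub> x) = (s \<oplus>\<^bsub>M\<^esub> s') \<oplus>\<^bsub>M\<^esub> (r \<oplus> r') \<odot>\<^bsub>M\<^esub> x"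
      using * rr' assms(3) subsetD[OF G(1)] by (simp add: smult_l_distr M.a_ac)
    thus ?thesis using N(3)[OF *(2,4)] G(3)[OF *(1,3)] rr' by auto
  qed
  show "t \<otimes> r \<in> ?I" if t: "t \<in> carrier R" and r: "r \<in> ?I" for t r
  proof -
    obtain s where *: "s \<in> G" "s \<oplus>\<^bsub>M\<^esub> r \<odot>\<^bsub>M\<^esub> x \<in> N" using r by blast
    have "t \<odot>\<^bsub>M\<^esub> (s \<oplus>\<^bsub>M\<^esub> r \<odot>\<^bsub>M\<^esub> x) = t \<odot>\<^bsub>M\<^esub> s \<oplus>\<^bsub>M\<^esub> (t \<otimes> r) \<odot>\<^bsub>M\<^esub> x"
      using * r t assms(3) subsetD[OF G(1)] by (simp add: smult_r_distr smult_assoc1)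
    thus ?thesis using N(4)[OF t *(2)] G(4)[OF t *(1)] r t by auto
  qed
qed auto

lemma colon_ideal:
  assumes "submodule N R M" "S \<subseteq> carrier M"
  shows "ideal (colon R M N S) R"
proof (rule idealI')
  note N = submoduleD[OF assms(1)]
  show "\<zero> \<in> colon R M N S" using N(2) assms(2) by (auto simp: colon_def subset_iff)
  show "r \<oplus> r' \<in> colon R M N S" if "r \<in> colon R M N S" "r' \<in> colon R M N S" for r r'
    using that N(3) assms(2) by (auto simp: colon_def subset_iff smult_l_distr)
  show "t \<otimes> r \<in> colon R M N S" if "t \<in> carrier R" "r \<in> colon R M N S" for t r
    using that N(4) assms(2) by (auto simp: colon_def subset_iff smult_assoc1)
qed (auto simp: colon_def)

end

lemma fin_gen_module_iff:
  "fin_gen_module R M \<longleftrightarrow> (\<exists>S. finite S \<and> S \<subseteq> carrier M \<and> generated R M S = carrier M)"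
  unfolding fin_gen_module_def generated_def ..

section \<open>Noetherian modules\<close>

context noetherian_cring
begin

text \<open>Induction on the generators: after adding x, the coefficients of x in elements of N form
  a finitely generated ideal. Elements of N realizing the generators of this ideal, together with
  generators of the part of N inside the old span, generate N.\<close>

lemma finitely_generated_submodule_aux:
  fixes M :: "('a, 'c, 'd) module_scheme"
  assumes "module R M" "finite S" "S \<subseteq> carrier M" "submodule N R M" "N \<subseteq> generated R M S"
  shows "\<exists>T. finite T \<and> T \<subseteq> N \<and> generated R M T = N"
  using assms(2-)
proof (induction S arbitrary: N rule: finite_induct)
  interpret M: module R M by fact
  case empty
  hence "N = {\<zero>\<^bsub>M\<^esub>}" using M.generated_empty submoduleD(2)[of N] by auto
  thus ?case using M.generated_empty by (intro exI[of _ "{}"]) auto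
next
  interpret M: module R M by fact
  case (insert x S)
  let ?G = "generated R M S"
  have x: "x \<in> carrier M" and S: "S \<subseteq> carrier M" using insert by auto
  note G = M.generated_submodule[OF S]
  let ?I = "\<lambda>N. {r \<in> carrier R. \<exists>s\<in>?G. s \<oplus>\<^bsub>M\<^esub> r \<odot>\<^bsub>M\<^esub> x \<in> N}"
  obtain A where A: "finite A" "?I N = Idl A" "A \<subseteq> carrier R"
    using finetely_gen[OF M.ideal_transporter[OF G insert.prems(2) x]] by blast
  have "\<forall>r\<in>A. \<exists>y\<in>N. \<exists>s\<in>?G. y = s \<oplus>\<^bsub>M\<^esub> r \<odot>\<^bsub>M\<^esub> x"
  proof
    fix r assume "r \<in> A"
    hence "r \<in> ?I N" using genideal_self[OF A(3)] A(2) by blast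
    thus "\<exists>y\<in>N. \<exists>s\<in>?G. y = s \<oplus>\<^bsub>M\<^esub> r \<odot>\<^bsub>M\<^esub> x" by blast
  qed
  then obtain f where f: "\<forall>r\<in>A. f r \<in> N \<and> (\<exists>s\<in>?G. f r = s \<oplus>\<^bsub>M\<^esub> r \<odot>\<^bsub>M\<^esub> x)"
    by metis
  obtain T where T: "finite T" "T \<subseteq> N \<inter> ?G" "generated R M T = N \<inter> ?G"
    using insert.IH[OF S M.submodule_Int[OF insert.prems(2) G]] by auto
  let ?T = "f ` A \<union> T"
  have TN: "?T \<subseteq> N" using f T by auto
  have TM: "?T \<subseteq> carrier M" using TN submoduleD(1)[OF insert.prems(2)] by blast
  note GT = M.generated_submodule[OF TM]
  have GTN: "generated R M ?T \<subseteq> N" using M.generated_least[OF insert.prems(2) TN] .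
  \<comment> \<open>The chosen elements realize the generators A as coefficients, so the whole
    coefficient ideal of N is realized inside the span of \<open>?T\<close>.\<close>
  have "A \<subseteq> ?I (generated R M ?T)"
    using f A(3) M.generated_incl[of ?T] by fastforce
  hence I: "?I N \<subseteq> ?I (generated R M ?T)"
    using A(2) genideal_minimal[OF M.ideal_transporter[OF G GT x]] by simp
  have "N \<subseteq> generated R M ?T"
  proof
    fix y assume y: "y \<in> N"
    hence "y \<in> adjoin R M ?G x"
      using insert.prems(3) M.generated_insert[OF S x] by auto
    then obtain s r where sr: "y = s \<oplus>\<^bsub>M\<^esub> r \<odot>\<^bsub>M\<^esub> x" "s \<in> ?G" "r \<in> carrier R"
      unfolding adjoin_def by blast
    hence "r \<in> ?I N" using y by auto
    then obtain s' where s': "s' \<in> ?G" "s' \<oplus>\<^bsub>M\<^esub> r \<odot>\<^bsub>M\<^esub> x \<in> generated R M ?T" using I by blast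
    have car: "s \<in> carrier M" "s' \<in> carrier M" "r \<odot>\<^bsub>M\<^esub> x \<in> carrier M"
      using sr s' submoduleD(1)[OF G] x by auto
    \<comment> \<open>Subtracting an element of the span of \<open>?T\<close> with the same
      coefficient of x leaves an element of N in the old span, and such elements are generated by
      T.\<close>
    have "y \<ominus>\<^bsub>M\<^esub> (s' \<oplus>\<^bsub>M\<^esub> r \<odot>\<^bsub>M\<^esub> x) \<in> N"
      using y s' GTN submoduleD(6)[OF insert.prems(2)] by blast
    moreover have eq: "y \<ominus>\<^bsub>M\<^esub> (s' \<oplus>\<^bsub>M\<^esub> r \<odot>\<^bsub>M\<^esub> x) = s \<ominus>\<^bsub>M\<^esub> s'"
      using car sr(1) by (simp add: a_minus_def M.minus_add M.a_ac M.r_neg M.r_neg1)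
    moreover have "s \<ominus>\<^bsub>M\<^esub> s' \<in> ?G" using sr s' submoduleD(6)[OF G] by blast
    ultimately have "s \<ominus>\<^bsub>M\<^esub> s' \<in> generated R M T" using T by auto
    also have "\<dots> \<subseteq> generated R M ?T"
      using M.generated_least[OF GT] M.generated_incl[of ?T] by blast
    finally have "(s \<ominus>\<^bsub>M\<^esub> s') \<oplus>\<^bsub>M\<^esub> (s' \<oplus>\<^bsub>M\<^esub> r \<odot>\<^bsub>M\<^esub> x) \<in> generated R M ?T"
      using s' submoduleD(3)[OF GT] by blast
    moreover have "(s \<ominus>\<^bsub>M\<^esub> s') \<oplus>\<^bsub>M\<^esub> (s' \<oplus>\<^bsub>M\<^esub> r \<odot>\<^bsub>M\<^esub> x) = y"
      using car sr(1) by (simp add: a_minus_def M.a_assoc M.r_neg1)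
    ultimately show "y \<in> generated R M ?T" by simp
  qed
  thus ?case using A(1) T(1) TN GTN by (intro exI[of _ ?T]) auto
qed

lemma finitely_generated_submodule:
  assumes "module R M" "fin_gen_module R M" "submodule N R M"
  shows "\<exists>T. finite T \<and> T \<subseteq> N \<and> generated R M T = N"
proof -
  interpret M: module R M by fact
  obtain S where "finite S" "S \<subseteq> carrier M" "generated R M S = carrier M"
    using assms(2) unfolding fin_gen_module_iff by blast
  thus ?thesis
    using finitely_generated_submodule_aux[OF assms(1)] assms(3) submoduleD(1)[OF assms(3)] by metis
qed

lemma fin_gen_submodule:
  assumes "module R M" "fin_gen_module R M" "submodule N R M"
  shows "fin_gen_module R (M\<lparr>carrier := N\<rparr>)"
proof -
  interpret M: module R M by fact
  obtain T where T: "finite T" "T \<subseteq> N" "generated R M T = N"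
    using finitely_generated_submodule[OF assms] by blast
  have "generated R (M\<lparr>carrier := N\<rparr>) T = N"
    using T(2) assms(3) M.generated_least[of _ T] T(3)
    unfolding generated_def M.submodule_submodule_iff[OF assms(3)] by auto
  thus ?thesis using T unfolding fin_gen_module_iff by (intro exI[of _ T]) simp
qed

text \<open>The form in which the Noetherian property is used: the union of a chain is finitely
  generated, so it equals a member of the chain and inherits any property \<open>P\<close>
  whatsoever; Zorn's lemma does the rest.\<close>

lemma maximal_submodule:
  assumes "module R M" "fin_gen_module R M" "submodule N0 R M" "P N0"
  obtains N where "submodule N R M" "P N" "\<And>N'. submodule N' R M \<Longrightarrow> P N' \<Longrightarrow> N \<subseteq> N' \<Longrightarrow> N' = N"
proof -
  interpret M: module R M by fact
  let ?A = "{N. submodule N R M \<and> P N}"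
  have "\<exists>N\<in>?A. \<forall>X\<in>?A. N \<subseteq> X \<longrightarrow> X = N"
  proof (rule subset_Zorn_nonempty)
    show "?A \<noteq> {}" using assms by auto
    fix C assume C: "C \<noteq> {}" "subset.chain ?A C"
    have CA: "C \<subseteq> ?A" using C(2) by (simp add: subset_chain_def)
    have lin: "X \<subseteq> Y \<or> Y \<subseteq> X" if "X \<in> C" "Y \<in> C" for X Y
      using C(2) that by (auto simp: subset_chain_def)
    have sub: "submodule (\<Union>C) R M"
    proof (rule M.submoduleI')
      show "\<Union>C \<subseteq> carrier M" using CA submoduleD(1) by blast
      show "\<zero>\<^bsub>M\<^esub> \<in> \<Union>C" using CA C(1) submoduleD(2) by blast
      show "x \<oplus>\<^bsub>M\<^esub> y \<in> \<Union>C" if xy: "x \<in> \<Union>C" "y \<in> \<Union>C" for x y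
      proof -
        obtain X Y where XY: "x \<in> X" "X \<in> C" "y \<in> Y" "Y \<in> C" using xy by blast
        hence sX: "submodule X R M" and sY: "submodule Y R M" using CA by auto
        from XY lin have "x \<in> Y \<or> y \<in> X" by blast
        thus ?thesis using XY submoduleD(3)[OF sX] submoduleD(3)[OF sY] by blast
      qed
      show "r \<odot>\<^bsub>M\<^esub> x \<in> \<Union>C" if r: "r \<in> carrier R" and "x \<in> \<Union>C" for r x
      proof -
        obtain X where X: "x \<in> X" "X \<in> C" using \<open>x \<in> \<Union>C\<close> by blast
        hence "submodule X R M" using CA by auto
        thus ?thesis using submoduleD(4)[OF _ r X(1)] X(2) by blast
      qed
    qed
    obtain T where T: "finite T" "T \<subseteq> \<Union>C" "generated R M T = \<Union>C"
      using finitely_generated_submodule[OF assms(1,2) sub] by blast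
    obtain N where N: "N \<in> C" "T \<subseteq> N"
      using finite_subset_Union_chain[OF T(1,2) C] by blast
    hence "\<Union>C \<subseteq> N" using T(3) M.generated_least[of N T] CA by auto
    hence "\<Union>C = N" using N by blast
    thus "\<Union>C \<in> ?A" using N CA by auto
  qed
  thus thesis using that by blast
qed

lemma maximal_ideal_with:
  assumes "ideal I0 R" "P I0"
  obtains I where "ideal I R" "P I" "\<And>J. ideal J R \<Longrightarrow> P J \<Longrightarrow> I \<subseteq> J \<Longrightarrow> J = I"
proof -
  let ?A = "{N. ideal N R \<and> P N}"
  have "\<exists>N\<in>?A. \<forall>X\<in>?A. N \<subseteq> X \<longrightarrow> X = N"
  proof (rule subset_Zorn_nonempty)
    show "?A \<noteq> {}" using assms by auto
    fix C assume C: "C \<noteq> {}" "subset.chain ?A C"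
    hence "\<Union>C \<in> C"
      by (intro ideal_chain_is_trivial) (auto simp: subset_chain_def)
    thus "\<Union>C \<in> ?A" using C by (auto simp: subset_chain_def)
  qed
  thus thesis using that by blast
qed

lemma ascending_submodules_stabilize:
  assumes "module R M" "fin_gen_module R M" "\<And>n. submodule (N n) R M" "\<And>n. N n \<subseteq> N (Suc n)"
  shows "\<exists>k. \<forall>n\<ge>k. N n = N k"
proof -
  obtain K where K: "submodule K R M" "\<exists>k. K = N k"
    "\<And>N'. submodule N' R M \<Longrightarrow> (\<exists>k. N' = N k) \<Longrightarrow> K \<subseteq> N' \<Longrightarrow> N' = K"
    using maximal_submodule[OF assms(1,2,3), of "\<lambda>X. \<exists>k. X = N k" 0] by blast
  then obtain k where k: "K = N k" by blast
  have "N n = N k" if "n \<ge> k" for n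
    using K(3)[of "N n"] assms(3) k lift_Suc_mono_le[of N, OF assms(4) that] by blast
  thus ?thesis by blast
qed

end

section \<open>Quotient modules\<close>

text \<open>The module laws are transported along a surjection, so quotients need no computation
  with cosets beyond the compatibility of the operations.\<close>

lemma module_of_surjection:
  assumes "module R M" "carrier Q = f ` carrier M" "\<zero>\<^bsub>Q\<^esub> = f \<zero>\<^bsub>M\<^esub>"
    and add: "\<And>x y. x \<in> carrier M \<Longrightarrow> y \<in> carrier M \<Longrightarrow> f (x \<oplus>\<^bsub>M\<^esub> y) = f x \<oplus>\<^bsub>Q\<^esub> f y"
    and smult: "\<And>r x. r \<in> carrier R \<Longrightarrow> x \<in> carrier M \<Longrightarrow> f (r \<odot>\<^bsub>M\<^esub> x) = r \<odot>\<^bsub>Q\<^esub> f x"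
  shows "module R Q"
proof -
  interpret M: module R M by fact
  have add': "f x \<oplus>\<^bsub>Q\<^esub> f y = f (x \<oplus>\<^bsub>M\<^esub> y)" if "x \<in> carrier M" "y \<in> carrier M" for x y
    using add that by simp
  have smult': "r \<odot>\<^bsub>Q\<^esub> f x = f (r \<odot>\<^bsub>M\<^esub> x)" if "r \<in> carrier R" "x \<in> carrier M" for r x
    using smult that by simp
  show ?thesis
  proof (intro moduleI abelian_groupI)
    show "cring R" by (rule M.R.cring_axioms)
    show "\<exists>y\<in>carrier Q. y \<oplus>\<^bsub>Q\<^esub> x = \<zero>\<^bsub>Q\<^esub>" if "x \<in> carrier Q" for x
    proof -
      obtain x' where x': "x' \<in> carrier M" "x = f x'" using \<open>x \<in> carrier Q\<close> assms(2) by auto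
      thus ?thesis using assms(2,3)
        by (intro bexI[of _ "f (\<ominus>\<^bsub>M\<^esub> x')"]) (auto simp: add' M.l_neg)
    qed
  qed (auto simp: assms(2,3) add' smult' M.a_ac M.smult_l_distr M.smult_r_distr M.smult_assoc1
      intro!: imageI)
qed

lemma (in module) abelian_subgroup_submodule:
  assumes "submodule N R M"
  shows "abelian_subgroup N M"
  by (rule abelian_subgroupI3)
     (auto intro: additive_subgroupI submodule.axioms(1)[OF assms] M.abelian_group_axioms)

lemma (in module) mem_coset_iff:
  assumes "submodule N R M" "x \<in> carrier M"
  shows "y \<in> N +>\<^bsub>M\<^esub> x \<longleftrightarrow> y \<in> carrier M \<and> y \<ominus>\<^bsub>M\<^esub> x \<in> N"
proof -
  note N = submoduleD[OF assms(1)]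
  have "y = (y \<ominus>\<^bsub>M\<^esub> x) \<oplus>\<^bsub>M\<^esub> x" if "y \<in> carrier M"
    using that assms(2) by (simp add: a_minus_def M.a_assoc M.l_neg)
  moreover have "(s \<oplus>\<^bsub>M\<^esub> x) \<ominus>\<^bsub>M\<^esub> x = s" if "s \<in> carrier M" for s
    using that assms(2) by (simp add: a_minus_def M.a_assoc M.r_neg)
  ultimately show ?thesis using N(1) assms(2) unfolding a_r_coset_def' by fastforce
qed

lemma (in module) coset_eq_iff:
  assumes "submodule N R M" "x \<in> carrier M" "y \<in> carrier M"
  shows "N +>\<^bsub>M\<^esub> x = N +>\<^bsub>M\<^esub> y \<longleftrightarrow> x \<ominus>\<^bsub>M\<^esub> y \<in> N"
proof -
  interpret N: abelian_subgroup N M by (rule abelian_subgroup_submodule[OF assms(1)])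
  have "x \<in> N +>\<^bsub>M\<^esub> x" using N.a_rcos_self assms by simp
  thus ?thesis
    using mem_coset_iff[OF assms(1,3), of x] assms M.a_repr_independence[of x N y] N.a_subgroup by auto
qed

lemma (in module) quot_module_simps:
  assumes "submodule N R M"
  shows "carrier (quot_module M N) = (\<lambda>x. N +>\<^bsub>M\<^esub> x) ` carrier M"
    and "\<zero>\<^bsub>quot_module M N\<^esub> = N +>\<^bsub>M\<^esub> \<zero>\<^bsub>M\<^esub>"
    and "\<And>x y. x \<in> carrier M \<Longrightarrow> y \<in> carrier M \<Longrightarrow>
          N +>\<^bsub>M\<^esub> (x \<oplus>\<^bsub>M\<^esub> y) = (N +>\<^bsub>M\<^esub> x) \<oplus>\<^bsub>quot_module M N\<^esub> (N +>\<^bsub>M\<^esub> y)"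
    and "\<And>r x. r \<in> carrier R \<Longrightarrow> x \<in> carrier M \<Longrightarrow>
          N +>\<^bsub>M\<^esub> (r \<odot>\<^bsub>M\<^esub> x) = r \<odot>\<^bsub>quot_module M N\<^esub> (N +>\<^bsub>M\<^esub> x)"
proof -
  interpret N: abelian_subgroup N M by (rule abelian_subgroup_submodule[OF assms(1)])
  show "carrier (quot_module M N) = (\<lambda>x. N +>\<^bsub>M\<^esub> x) ` carrier M"
    by (auto simp: quot_module_def A_RCOSETS_def')
  show "\<zero>\<^bsub>quot_module M N\<^esub> = N +>\<^bsub>M\<^esub> \<zero>\<^bsub>M\<^esub>"
    using submoduleD(1)[OF assms] by (simp add: quot_module_def M.a_coset_add_zero)
  show "N +>\<^bsub>M\<^esub> (x \<oplus>\<^bsub>M\<^esub> y) = (N +>\<^bsub>M\<^esub> x) \<oplus>\<^bsub>quot_module M N\<^esub> (N +>\<^bsub>M\<^esub> y)"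
    if "x \<in> carrier M" "y \<in> carrier M" for x y
    using N.a_rcos_sum[OF that] by (simp add: quot_module_def)
  show "N +>\<^bsub>M\<^esub> (r \<odot>\<^bsub>M\<^esub> x) = r \<odot>\<^bsub>quot_module M N\<^esub> (N +>\<^bsub>M\<^esub> x)"
    if r: "r \<in> carrier R" and x: "x \<in> carrier M" for r x
  proof -
    \<comment> \<open>Scalar multiplication on the quotient is a union over representatives; all of
      them give the same coset, and the union collapses.\<close>
    have *: "N +>\<^bsub>M\<^esub> (r \<odot>\<^bsub>M\<^esub> y) = N +>\<^bsub>M\<^esub> (r \<odot>\<^bsub>M\<^esub> x)" if "y \<in> N +>\<^bsub>M\<^esub> x" for y
    proof -
      have y: "y \<in> carrier M" "y \<ominus>\<^bsub>M\<^esub> x \<in> N" using that mem_coset_iff[OF assms x] by auto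
      have "r \<odot>\<^bsub>M\<^esub> y \<ominus>\<^bsub>M\<^esub> r \<odot>\<^bsub>M\<^esub> x = r \<odot>\<^bsub>M\<^esub> (y \<ominus>\<^bsub>M\<^esub> x)"
        using r x y(1) by (simp add: a_minus_def smult_r_distr smult_r_minus)
      thus ?thesis using coset_eq_iff[OF assms, of "r \<odot>\<^bsub>M\<^esub> y" "r \<odot>\<^bsub>M\<^esub> x"] r x y submoduleD(4)[OF assms r y(2)] by simp
    qed
    have "(\<Union>y\<in>N +>\<^bsub>M\<^esub> x. N +>\<^bsub>M\<^esub> (r \<odot>\<^bsub>M\<^esub> y)) = N +>\<^bsub>M\<^esub> (r \<odot>\<^bsub>M\<^esub> x)"
      by (rule UN_constant_eq[OF N.a_rcos_self[OF x]]) (intro ballI *)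
    thus ?thesis by (simp add: quot_module_def)
  qed
qed

lemma (in module) module_quot_module:
  assumes "submodule N R M"
  shows "module R (quot_module M N)"
  by (rule module_of_surjection[OF module_axioms])
     (use quot_module_simps[OF assms] in auto)

lemma (in module) linear_map_proj:
  assumes "submodule N R M"
  shows "linear_map R M (quot_module M N) (\<lambda>x. N +>\<^bsub>M\<^esub> x)"
  by (rule linear_mapI) (use quot_module_simps[OF assms] in auto)

lemma (in module) proj_eq_zero_iff:
  assumes "submodule N R M" "x \<in> carrier M"
  shows "N +>\<^bsub>M\<^esub> x = \<zero>\<^bsub>quot_module M N\<^esub> \<longleftrightarrow> x \<in> N"
  using coset_eq_iff[OF assms(1,2) M.zero_closed] assms(2) M.minus_equality[of "\<zero>\<^bsub>M\<^esub>" "\<zero>\<^bsub>M\<^esub>"]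
  unfolding quot_module_simps(2)[OF assms(1)] by (simp add: a_minus_def)

lemma fin_gen_linear_image:
  assumes "module R M" "module R N" "linear_map R M N f" "fin_gen_module R M"
    and "f ` carrier M = carrier N"
  shows "fin_gen_module R N"
proof -
  interpret M: module R M by fact
  interpret N: module R N by fact
  obtain S where S: "finite S" "S \<subseteq> carrier M" "generated R M S = carrier M"
    using assms(4) unfolding fin_gen_module_iff by blast
  have fS: "f ` S \<subseteq> carrier N" using S(2) linear_mapD(1)[OF assms(3)] by auto
  note G = N.generated_submodule[OF fS]
  \<comment> \<open>The preimage of the span of the images is a submodule containing S, hence all of
    M.\<close>
  have "submodule {x \<in> carrier M. f x \<in> generated R N (f ` S)} R M"
    using submoduleD[OF G] linear_map_zero[OF assms(1-3)] linear_mapD[OF assms(3)]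
    by (intro M.submoduleI') auto
  hence "generated R M S \<subseteq> {x \<in> carrier M. f x \<in> generated R N (f ` S)}"
    by (rule M.generated_least) (use S(2) N.generated_incl[of "f ` S"] in auto)
  hence "f ` carrier M \<subseteq> generated R N (f ` S)" unfolding S(3) by blast
  hence "carrier N \<subseteq> generated R N (f ` S)" unfolding assms(5) .
  thus ?thesis using S(1) fS submoduleD(1)[OF G] unfolding fin_gen_module_iff by blast
qed

lemma submodule_kernel:
  assumes "module R M" "module R N" "linear_map R M N f"
  shows "submodule {x \<in> carrier M. f x = \<zero>\<^bsub>N\<^esub>} R M"
proof -
  interpret M: module R M by fact
  interpret N: module R N by fact
  show ?thesis
    using linear_map_zero[OF assms] linear_mapD[OF assms(3)] by (intro M.submoduleI') auto
qed

context cring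
begin

lemma regular_module_simps [simp]:
  "carrier (regular_module R) = carrier R" "zero (regular_module R) = \<zero>"
  "add (regular_module R) = add R" "smult (regular_module R) = monoid.mult R"
  by (simp_all add: regular_module_def)

lemma module_regular_module: "module R (regular_module R)"
proof (intro moduleI abelian_groupI)
  show "\<exists>y\<in>carrier (regular_module R). y \<oplus>\<^bsub>regular_module R\<^esub> x = \<zero>\<^bsub>regular_module R\<^esub>"
    if "x \<in> carrier (regular_module R)" for x
    using that by (intro bexI[of _ "\<ominus> x"]) (auto simp: l_neg)
qed (auto simp: a_ac m_ac l_distr r_distr cring_axioms)

lemma regular_module_coset [simp]: "a_r_coset (regular_module R) = a_r_coset R"
  by (intro ext) (simp add: a_r_coset_def')

lemma submodule_ideal: "ideal I R \<Longrightarrow> submodule I R (regular_module R)"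
proof -
  interpret r: module R "regular_module R" by (rule module_regular_module)
  assume I: "ideal I R"
  interpret I: ideal I R by fact
  show ?thesis using I.I_l_closed I.a_subset by (intro r.submoduleI') auto
qed

lemma fin_gen_regular_module: "fin_gen_module R (regular_module R)"
proof -
  interpret r: module R "regular_module R" by (rule module_regular_module)
  have "x \<in> generated R (regular_module R) {\<one>}" if "x \<in> carrier R" for x
    using submoduleD(4)[OF r.generated_submodule[of "{\<one>}"], of x \<one>] that
      r.generated_incl[of "{\<one>}"] by auto
  hence "generated R (regular_module R) {\<one>} = carrier (regular_module R)"
    using submoduleD(1)[OF r.generated_submodule[of "{\<one>}"]] by auto
  thus ?thesis unfolding fin_gen_module_iff by (intro exI[of _ "{\<one>}"]) auto
qed

lemma ideal_quot:
  assumes "ideal I R"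
  shows "module R (quot_module (regular_module R) I)"
    and "fin_gen_module R (quot_module (regular_module R) I)"
    and "carrier (quot_module (regular_module R) I) = (\<lambda>x. I +> x) ` carrier R"
    and "\<zero>\<^bsub>quot_module (regular_module R) I\<^esub> = I +> \<zero>"
    and "\<And>x. x \<in> carrier R \<Longrightarrow> I +> x = \<zero>\<^bsub>quot_module (regular_module R) I\<^esub> \<longleftrightarrow> x \<in> I"
    and "linear_map R (regular_module R) (quot_module (regular_module R) I) (\<lambda>x. I +> x)"
proof -
  interpret r: module R "regular_module R" by (rule module_regular_module)
  note I = submodule_ideal[OF assms]
  show m: "module R (quot_module (regular_module R) I)" by (rule r.module_quot_module[OF I])
  show c: "carrier (quot_module (regular_module R) I) = (\<lambda>x. I +> x) ` carrier R"
    using r.quot_module_simps(1)[OF I] by simp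
  show "\<zero>\<^bsub>quot_module (regular_module R) I\<^esub> = I +> \<zero>"
    using r.quot_module_simps(2)[OF I] by simp
  show "I +> x = \<zero>\<^bsub>quot_module (regular_module R) I\<^esub> \<longleftrightarrow> x \<in> I" if "x \<in> carrier R" for x
    using r.proj_eq_zero_iff[OF I, of x] that by simp
  show l: "linear_map R (regular_module R) (quot_module (regular_module R) I) (\<lambda>x. I +> x)"
    using r.linear_map_proj[OF I] by simp
  show "fin_gen_module R (quot_module (regular_module R) I)"
    by (rule fin_gen_linear_image[OF module_regular_module m l fin_gen_regular_module])
       (simp add: c)
qed

end

section \<open>Free modules\<close>

lemma free_module_simps [simp]:
  "carrier (free_module R k) = {..<k} \<rightarrow>\<^sub>E carrier R"
  "\<zero>\<^bsub>free_module R k\<^esub> = (\<lambda>j\<in>{..<k}. \<zero>\<^bsub>R\<^esub>)"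
  "v \<oplus>\<^bsub>free_module R k\<^esub> w = (\<lambda>j\<in>{..<k}. v j \<oplus>\<^bsub>R\<^esub> w j)"
  "r \<odot>\<^bsub>free_module R k\<^esub> v = (\<lambda>j\<in>{..<k}. r \<otimes>\<^bsub>R\<^esub> v j)"
  by (simp_all add: free_module_def)

definition unit_vector :: "('a, 'n) ring_scheme \<Rightarrow> nat \<Rightarrow> nat \<Rightarrow> (nat \<Rightarrow> 'a)" where
  "unit_vector R k i = (\<lambda>j\<in>{..<k}. if j = i then \<one>\<^bsub>R\<^esub> else \<zero>\<^bsub>R\<^esub>)"

text \<open>Recursion on the length replaces a \<open>finsum\<close> over an index set, so
  linearity, closure and the values at unit vectors are plain inductions.\<close>

primrec lin_comb ::
    "('a, 'b, 'm) module_scheme \<Rightarrow> (nat \<Rightarrow> 'b) \<Rightarrow> (nat \<Rightarrow> 'a) \<Rightarrow> nat \<Rightarrow> 'b" where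
  "lin_comb M m v 0 = \<zero>\<^bsub>M\<^esub>"
| "lin_comb M m v (Suc i) = lin_comb M m v i \<oplus>\<^bsub>M\<^esub> v i \<odot>\<^bsub>M\<^esub> m i"

lemma lin_comb_submodule:
  assumes "submodule N R M" "\<And>i. i < k \<Longrightarrow> m i \<in> N" "\<And>i. i < k \<Longrightarrow> v i \<in> carrier R"
  shows "lin_comb M m v k \<in> N"
  using assms(2,3)
  by (induction k) (auto intro: submoduleD(2)[OF assms(1)] submoduleD(3,4)[OF assms(1)])

context cring
begin

lemma module_free_module: "module R (free_module R k)"
proof (intro moduleI abelian_groupI)
  have mem: "x j \<in> carrier R" if "x \<in> carrier (free_module R k)" "j < k" for x j
    using that by auto
  show "\<exists>y\<in>carrier (free_module R k). y \<oplus>\<^bsub>free_module R k\<^esub> x = \<zero>\<^bsub>free_module R k\<^esub>"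
    if x: "x \<in> carrier (free_module R k)" for x
  proof
    show "(\<lambda>j\<in>{..<k}. \<ominus> x j) \<in> carrier (free_module R k)" using mem[OF x] by auto
    show "(\<lambda>j\<in>{..<k}. \<ominus> x j) \<oplus>\<^bsub>free_module R k\<^esub> x = \<zero>\<^bsub>free_module R k\<^esub>"
      using mem[OF x] by (auto intro!: restrict_ext simp: l_neg)
  qed
  have res: "(\<lambda>j\<in>{..<k}. y j) = x" if "x \<in> carrier (free_module R k)" "\<And>j. j < k \<Longrightarrow> y j = x j"
    for x y :: "nat \<Rightarrow> 'a"
    using that by (intro extensionalityI[of _ "{..<k}"]) (auto simp: PiE_iff)
  show "\<zero>\<^bsub>free_module R k\<^esub> \<oplus>\<^bsub>free_module R k\<^esub> x = x" if x: "x \<in> carrier (free_module R k)" for x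
    unfolding free_module_simps(3) by (rule res[OF x]) (use mem[OF x] in auto)
  show "\<one> \<odot>\<^bsub>free_module R k\<^esub> x = x" if x: "x \<in> carrier (free_module R k)" for x
    unfolding free_module_simps(4) by (rule res[OF x]) (use mem[OF x] in auto)
  fix x y assume xy: "x \<in> carrier (free_module R k)" "y \<in> carrier (free_module R k)"
  show "x \<oplus>\<^bsub>free_module R k\<^esub> y \<in> carrier (free_module R k)" using xy by auto
  show "x \<oplus>\<^bsub>free_module R k\<^esub> y = y \<oplus>\<^bsub>free_module R k\<^esub> x"
    using mem[OF xy(1)] mem[OF xy(2)] by (auto intro!: restrict_ext simp: a_comm)
  show "x \<oplus>\<^bsub>free_module R k\<^esub> y \<oplus>\<^bsub>free_module R k\<^esub> z = x \<oplus>\<^bsub>free_module R k\<^esub> (y \<oplus>\<^bsub>free_module R k\<^esub> z)"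
    if "z \<in> carrier (free_module R k)" for z
    using mem[OF xy(1)] mem[OF xy(2)] mem[OF that] by (auto intro!: restrict_ext simp: a_assoc)
  fix r assume r: "r \<in> carrier R"
  show "r \<odot>\<^bsub>free_module R k\<^esub> (x \<oplus>\<^bsub>free_module R k\<^esub> y)
      = r \<odot>\<^bsub>free_module R k\<^esub> x \<oplus>\<^bsub>free_module R k\<^esub> r \<odot>\<^bsub>free_module R k\<^esub> y"
    using mem[OF xy(1)] mem[OF xy(2)] r by (auto intro!: restrict_ext simp: r_distr)
next
  have mem: "x j \<in> carrier R" if "x \<in> carrier (free_module R k)" "j < k" for x j
    using that by auto
  fix r s x assume rs: "r \<in> carrier R" "s \<in> carrier R" and x: "x \<in> carrier (free_module R k)"
  show "(r \<oplus> s) \<odot>\<^bsub>free_module R k\<^esub> x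
      = r \<odot>\<^bsub>free_module R k\<^esub> x \<oplus>\<^bsub>free_module R k\<^esub> s \<odot>\<^bsub>free_module R k\<^esub> x"
    using mem[OF x] rs by (auto intro!: restrict_ext simp: l_distr)
  show "(r \<otimes> s) \<odot>\<^bsub>free_module R k\<^esub> x = r \<odot>\<^bsub>free_module R k\<^esub> (s \<odot>\<^bsub>free_module R k\<^esub> x)"
    using mem[OF x] rs by (auto intro!: restrict_ext simp: m_assoc)
qed (auto simp: cring_axioms)

lemma unit_vector_closed: "unit_vector R k i \<in> carrier (free_module R k)"
  by (auto simp: unit_vector_def)

lemma linear_map_lin_comb:
  assumes "module R M" "\<And>i. i < k \<Longrightarrow> m i \<in> carrier M"
  shows "linear_map R (free_module R k) M (\<lambda>v. lin_comb M m v k)"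
proof -
  interpret M: module R M by fact
  have cl: "lin_comb M m v j \<in> carrier M" if "v \<in> {..<k} \<rightarrow>\<^sub>E carrier R" "j \<le> k" for v j
    using that assms(2) by (intro lin_comb_submodule[OF M.carrier_is_submodule]) auto
  have "lin_comb M m (v \<oplus>\<^bsub>free_module R k\<^esub> w) j = lin_comb M m v j \<oplus>\<^bsub>M\<^esub> lin_comb M m w j"
    if vw: "v \<in> {..<k} \<rightarrow>\<^sub>E carrier R" "w \<in> {..<k} \<rightarrow>\<^sub>E carrier R" and "j \<le> k" for v w j
    using \<open>j \<le> k\<close>
  proof (induction j)
    case (Suc j)
    have "v j \<in> carrier R" "w j \<in> carrier R" "m j \<in> carrier M" "j < k"
      using vw Suc.prems assms(2) by auto
    thus ?case using Suc cl[OF vw(1), of j] cl[OF vw(2), of j]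
      by (simp add: M.smult_l_distr M.a_ac)
  qed auto
  moreover have "lin_comb M m (r \<odot>\<^bsub>free_module R k\<^esub> v) j = r \<odot>\<^bsub>M\<^esub> lin_comb M m v j"
    if v: "v \<in> {..<k} \<rightarrow>\<^sub>E carrier R" "r \<in> carrier R" and "j \<le> k" for v r j
    using \<open>j \<le> k\<close>
  proof (induction j)
    case (Suc j)
    have "v j \<in> carrier R" "m j \<in> carrier M" "j < k"
      using v Suc.prems assms(2) by auto
    thus ?case using Suc cl[OF v(1), of j] v(2)
      by (simp add: M.smult_assoc1 M.smult_r_distr)
  qed (use v in auto)
  ultimately show ?thesis using cl by (intro linear_mapI) auto
qed

lemma linear_map_free_eq:
  assumes "module R N" "linear_map R (free_module R k) N f" "v \<in> carrier (free_module R k)"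
  shows "f v = lin_comb N (\<lambda>i. f (unit_vector R k i)) v k"
proof -
  interpret F: module R "free_module R k" by (rule module_free_module)
  interpret N: module R N by fact
  \<comment> \<open>The truncation of v to its first i coordinates. Passing from i to i + 1 adds
    \<open>v i\<close> times the i-th unit vector, which is the recursion of
    \<open>lin_comb\<close>.\<close>
  let ?v = "\<lambda>i. (\<lambda>j\<in>{..<k}. if j < i then v j else \<zero>)"
  have v: "v j \<in> carrier R" if "j < k" for j using assms(3) that by auto
  have vi: "?v i \<in> carrier (free_module R k)" for i using v by auto
  have "f (?v i) = lin_comb N (\<lambda>i. f (unit_vector R k i)) v i" if "i \<le> k" for i
    using that
  proof (induction i)
    case 0
    have "?v 0 = \<zero>\<^bsub>free_module R k\<^esub>" by auto
    hence "f (?v 0) = f \<zero>\<^bsub>free_module R k\<^esub>" by (rule arg_cong)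
    thus ?case unfolding linear_map_zero[OF module_free_module assms(1,2)] by (simp only: lin_comb.simps)
  next
    case (Suc i)
    have eq: "?v (Suc i) = ?v i \<oplus>\<^bsub>free_module R k\<^esub> (v i \<odot>\<^bsub>free_module R k\<^esub> unit_vector R k i)"
      using v Suc.prems by (auto simp: unit_vector_def fun_eq_iff less_Suc_eq)
    have c: "v i \<odot>\<^bsub>free_module R k\<^esub> unit_vector R k i \<in> carrier (free_module R k)"
      using v[of i] Suc.prems F.smult_closed[OF _ unit_vector_closed] by simp
    have "f (?v (Suc i)) = f (?v i) \<oplus>\<^bsub>N\<^esub> (v i \<odot>\<^bsub>N\<^esub> f (unit_vector R k i))"
      unfolding eq linear_mapD(2)[OF assms(2) vi c]
      using linear_mapD(3)[OF assms(2) v unit_vector_closed] Suc.prems by simp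
    also have "f (?v i) = lin_comb N (\<lambda>i. f (unit_vector R k i)) v i" by (rule Suc.IH) (use Suc.prems in simp)
    finally show ?case by (simp only: lin_comb.simps)
  qed
  moreover have "?v k = v" using assms(3) by (auto simp: fun_eq_iff PiE_iff extensional_def)
  ultimately show ?thesis using order_refl by metis
qed

lemma lin_comb_unit_vector:
  assumes "module R M" "\<And>i. i < k \<Longrightarrow> m i \<in> carrier M" "i < k"
  shows "lin_comb M m (unit_vector R k i) k = m i"
proof -
  interpret M: module R M by fact
  have "lin_comb M m (unit_vector R k i) j = (if i < j then m i else \<zero>\<^bsub>M\<^esub>)" if "j \<le> k" for j
    using that
  proof (induction j)
    case (Suc j)
    thus ?case using assms(2)[of j] assms(2,3) by (auto simp: unit_vector_def less_Suc_eq)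
  qed auto
  thus ?thesis using assms(3) by simp
qed

lemma fin_gen_free_module: "fin_gen_module R (free_module R k)"
proof -
  interpret F: module R "free_module R k" by (rule module_free_module)
  let ?S = "unit_vector R k ` {..<k}"
  have S: "?S \<subseteq> carrier (free_module R k)" using unit_vector_closed by auto
  note G = F.generated_submodule[OF S]
  have id: "linear_map R (free_module R k) (free_module R k) (\<lambda>v. v)"
    by (rule linear_mapI) auto
  have "v \<in> generated R (free_module R k) ?S" if v: "v \<in> carrier (free_module R k)" for v
  proof -
    have "lin_comb (free_module R k) (unit_vector R k) v k \<in> generated R (free_module R k) ?S"
      using v F.generated_incl[of ?S] by (intro lin_comb_submodule[OF G]) auto
    thus ?thesis using linear_map_free_eq[OF module_free_module id v] by simp
  qed
  hence "generated R (free_module R k) ?S = carrier (free_module R k)"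
    using submoduleD(1)[OF G] by blast
  thus ?thesis using S unfolding fin_gen_module_iff by (intro exI[of _ ?S]) simp
qed

text \<open>Projectivity of free modules with control of the target: choosing the preimages of the
  basis in the submodule \<open>M'\<close> keeps the whole lift there. The Artin--Rees argument
  takes \<open>I^k P\<close> for \<open>M'\<close>; elsewhere it is the full module.\<close>

lemma free_module_lift:
  assumes "module R M" "module R N" "linear_map R M N h" "submodule M' R M"
    and "linear_map R (free_module R k) N f"
    and "\<And>v. v \<in> carrier (free_module R k) \<Longrightarrow> f v \<in> h ` M'"
  obtains g where "linear_map R (free_module R k) M g"
    "\<And>v. v \<in> carrier (free_module R k) \<Longrightarrow> g v \<in> M'"
    "\<And>v. v \<in> carrier (free_module R k) \<Longrightarrow> h (g v) = f v"
proof -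
  interpret M: module R M by fact
  have "\<forall>i. \<exists>x\<in>M'. h x = f (unit_vector R k i)"
  proof
    fix i show "\<exists>x\<in>M'. h x = f (unit_vector R k i)"
      using assms(6)[OF unit_vector_closed[of k i]] by (metis imageE)
  qed
  then obtain m where m: "\<And>i. m i \<in> M'" "\<And>i. h (m i) = f (unit_vector R k i)" by metis
  have mM: "m i \<in> carrier M" for i using m(1) submoduleD(1)[OF assms(4)] by auto
  let ?g = "\<lambda>v. lin_comb M m v k"
  have g: "linear_map R (free_module R k) M ?g" by (rule linear_map_lin_comb[OF assms(1) mM])
  have "?g v \<in> M'" if "v \<in> carrier (free_module R k)" for v
    using that m(1) by (intro lin_comb_submodule[OF assms(4)]) auto
  moreover have "h (?g v) = f v" if v: "v \<in> carrier (free_module R k)" for v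
  proof -
    have "h (?g v) = lin_comb N (\<lambda>i. h (?g (unit_vector R k i))) v k"
      by (rule linear_map_free_eq[OF assms(2) linear_map_comp[OF g assms(3)] v])
    also have "\<dots> = lin_comb N (\<lambda>i. f (unit_vector R k i)) v k"
    proof -
      have "lin_comb N (\<lambda>i. h (?g (unit_vector R k i))) v j = lin_comb N (\<lambda>i. f (unit_vector R k i)) v j"
        if "j \<le> k" for j
        using that by (induction j) (auto simp: lin_comb_unit_vector[OF assms(1) mM] m(2))
      thus ?thesis by simp
    qed
    also have "\<dots> = f v" using linear_map_free_eq[OF assms(2,5) v] by simp
    finally show ?thesis .
  qed
  ultimately show thesis using that g by blast
qed

end

text \<open>Stated for a submodule N so that it covers both the module at the start of a resolution
  and the kernel at each later stage.\<close>

lemma (in noetherian_cring) free_cover: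
  assumes "module R M" "fin_gen_module R M" "submodule N R M"
  shows "\<exists>k f. linear_map R (free_module R k) M f \<and> f ` carrier (free_module R k) = N"
proof -
  interpret M: module R M by fact
  obtain T where T: "finite T" "T \<subseteq> N" "generated R M T = N"
    using finitely_generated_submodule[OF assms] by blast
  obtain k :: nat and m where km: "T = m ` {..<k}"
    using finite_imp_nat_seg_image_inj_on[OF T(1)] by (metis lessThan_def)
  have m: "m i \<in> N" if "i < k" for i using km T(2) that by auto
  hence mM: "m i \<in> carrier M" if "i < k" for i using submoduleD(1)[OF assms(3)] that by auto
  let ?f = "\<lambda>v. lin_comb M m v k"
  have f: "linear_map R (free_module R k) M ?f" by (rule linear_map_lin_comb[OF assms(1) mM])
  have "?f v \<in> N" if "v \<in> carrier (free_module R k)" for v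
    using that m by (intro lin_comb_submodule[OF assms(3)]) auto
  moreover have "N \<subseteq> ?f ` carrier (free_module R k)"
  proof -
    interpret F: module R "free_module R k" by (rule module_free_module)
    have "submodule (?f ` carrier (free_module R k)) R M"
      by (rule submodule_image[OF module_free_module assms(1) f F.carrier_is_submodule])
    moreover have "T \<subseteq> ?f ` carrier (free_module R k)"
      unfolding km
    proof (rule image_subsetI)
      fix i assume "i \<in> {..<k}"
      hence "m i = ?f (unit_vector R k i)" using lin_comb_unit_vector[OF assms(1) mM] by simp
      thus "m i \<in> ?f ` carrier (free_module R k)" using unit_vector_closed by (rule image_eqI)
    qed
    ultimately show ?thesis using M.generated_least T(3) by metis
  qed
  ultimately show ?thesis using f by blast
qed

section \<open>Free resolutions and chain maps\<close>

lemma resolutionD: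
  assumes "is_free_resolution R A F"
  shows "linear_map R (res_module R F 0) A (res_aug F)"
    and "linear_map R (res_module R F (Suc n)) (res_module R F n) (res_diff F n)"
    and "res_aug F ` carrier (res_module R F 0) = carrier A"
    and "v \<in> carrier (res_module R F 0) \<Longrightarrow>
          res_aug F v = \<zero>\<^bsub>A\<^esub> \<longleftrightarrow> v \<in> res_diff F 0 ` carrier (res_module R F (Suc 0))"
    and "w \<in> carrier (res_module R F (Suc n)) \<Longrightarrow>
          res_diff F n w = \<zero>\<^bsub>res_module R F n\<^esub> \<longleftrightarrow>
          w \<in> res_diff F (Suc n) ` carrier (res_module R F (Suc (Suc n)))"
  using assms unfolding is_free_resolution_def module_homs_iff_linear_map a_kernel_def' by auto

lemma res_diff_diff:
  assumes "is_free_resolution R A F" "v \<in> carrier (res_module R F (Suc (Suc n)))"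
  shows "res_diff F n (res_diff F (Suc n) v) = \<zero>\<^bsub>res_module R F n\<^esub>"
  using resolutionD(5)[OF assms(1), of "res_diff F (Suc n) v" n] assms(2)
    linear_mapD(1)[OF resolutionD(2)[OF assms(1)] assms(2)] by blast

lemma res_aug_diff:
  assumes "is_free_resolution R A F" "v \<in> carrier (res_module R F (Suc 0))"
  shows "res_aug F (res_diff F 0 v) = \<zero>\<^bsub>A\<^esub>"
  using resolutionD(4)[OF assms(1), of "res_diff F 0 v"] assms(2)
    linear_mapD(1)[OF resolutionD(2)[OF assms(1)] assms(2)] by blast

lemma (in cring) module_res_module: "module R (res_module R F n)"
  unfolding res_module_def by (rule module_free_module)

lemma (in cring) res_module_lift:
  assumes "module R M" "module R N" "linear_map R M N h" "submodule M' R M"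
    and "linear_map R (res_module R F n) N f"
    and "\<And>v. v \<in> carrier (res_module R F n) \<Longrightarrow> f v \<in> h ` M'"
  obtains g where "linear_map R (res_module R F n) M g"
    "\<And>v. v \<in> carrier (res_module R F n) \<Longrightarrow> g v \<in> M'"
    "\<And>v. v \<in> carrier (res_module R F n) \<Longrightarrow> h (g v) = f v"
  using free_module_lift[OF assms(1-4)] assms(5,6) unfolding res_module_def by metis

lemma (in noetherian_cring) free_resolution_exists:
  assumes "module R A" "fin_gen_module R A"
  shows "\<exists>F. is_free_resolution R A F"
proof -
  interpret A: module R A by fact
  obtain k0 aug where aug: "linear_map R (free_module R k0) A aug"
    "aug ` carrier (free_module R k0) = carrier A"
    using free_cover[OF assms A.carrier_is_submodule] by blast
  obtain k1 g0 where g0: "linear_map R (free_module R k1) (free_module R k0) g0"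
    "g0 ` carrier (free_module R k1) = {x \<in> carrier (free_module R k0). aug x = \<zero>\<^bsub>A\<^esub>}"
    using free_cover[OF module_free_module fin_gen_free_module
        submodule_kernel[OF module_free_module assms(1) aug(1)]] by blast
  \<comment> \<open>A triple is a map \<open>g\<close> from rank l to rank k; the next triple starts
    at rank l and maps onto the kernel of \<open>g\<close>. Fixing the triple for n = 0 ties the
    sequence to the augmentation.\<close>
  let ?P = "\<lambda>n (k, l, g). linear_map R (free_module R l) (free_module R k) g \<and>
     (n = (0::nat) \<longrightarrow> (k, l, g) = (k0, k1, g0))"
  let ?Q = "\<lambda>n (k, l, g) (k', l', g'). k' = l \<and>
     g' ` carrier (free_module R l') = {x \<in> carrier (free_module R l). g x = \<zero>\<^bsub>free_module R k\<^esub>}"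
  have "\<exists>S. \<forall>n. ?P n (S n) \<and> ?Q n (S n) (S (Suc n))"
  proof (rule dependent_nat_choice)
    show "\<exists>x. ?P 0 x" using g0(1) by auto
    fix x n assume "?P n x"
    moreover obtain k l g where x: "x = (k, l, g)" by (cases x)
    ultimately have g: "linear_map R (free_module R l) (free_module R k) g" by auto
    obtain l' g' where "linear_map R (free_module R l') (free_module R l) g'"
      "g' ` carrier (free_module R l') = {x \<in> carrier (free_module R l). g x = \<zero>\<^bsub>free_module R k\<^esub>}"
      using free_cover[OF module_free_module fin_gen_free_module
        submodule_kernel[OF module_free_module module_free_module g]] by blast
    thus "\<exists>y. ?P (Suc n) y \<and> ?Q n x y" unfolding x by (intro exI[of _ "(l, l', g')"]) simp
  qed
  then obtain S where *: "\<forall>n. ?P n (S n) \<and> ?Q n (S n) (S (Suc n))" by (rule exE)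
  have S: "?P n (S n)" "?Q n (S n) (S (Suc n))" for n
    by (rule conjunct1[OF spec[OF *]], rule conjunct2[OF spec[OF *]])
  define k where "k n = fst (S n)" for n
  define g where "g n = snd (snd (S n))" for n
  have l: "fst (snd (S n)) = k (Suc n)" for n
    using S(2)[of n] by (auto simp: k_def split: prod.splits)
  have S_eq: "S n = (k n, k (Suc n), g n)" for n
    using l[of n] by (metis k_def g_def prod.collapse)
  have glin: "linear_map R (free_module R (k (Suc n))) (free_module R (k n)) (g n)" for n
    using S(1)[of n] unfolding S_eq by simp
  have gex: "g (Suc n) ` carrier (free_module R (k (Suc (Suc n)))) =
      {x \<in> carrier (free_module R (k (Suc n))). g n x = \<zero>\<^bsub>free_module R (k n)\<^esub>}" for n
    using S(2)[of n] unfolding S_eq by simp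
  have S0: "k 0 = k0" "k (Suc 0) = k1" "g 0 = g0" using S(1)[of 0] unfolding S_eq by auto
  define F where "F = \<lparr>res_rank = k,
     res_diff = (\<lambda>n. restrict (g n) (carrier (free_module R (k (Suc n))))),
     res_aug = restrict aug (carrier (free_module R k0))\<rparr>"
  have mods: "res_module R F n = free_module R (k n)" for n
    by (simp add: res_module_def F_def)
  have im: "restrict f X ` X = f ` X" for f :: "'u \<Rightarrow> 'v" and X by auto
  have "is_free_resolution R A F"
    unfolding is_free_resolution_def mods module_homs_iff_linear_map a_kernel_def'
  proof (intro conjI allI)
    show "linear_map R (free_module R (k 0)) A (res_aug F)"
      unfolding F_def S0 resolution.simps
      by (rule linear_map_cong[OF aug(1) module_free_module]) (rule restrict_apply')
    show "linear_map R (free_module R (k (Suc n))) (free_module R (k n)) (res_diff F n)" for n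
      unfolding F_def resolution.simps
      by (rule linear_map_cong[OF glin module_free_module]) (rule restrict_apply')
    show "res_aug F ` carrier (free_module R (k 0)) = carrier A"
      unfolding F_def S0 resolution.simps im by (rule aug(2))
    show "res_diff F 0 ` carrier (free_module R (k 1)) =
        {x \<in> carrier (free_module R (k 0)). res_aug F x = \<zero>\<^bsub>A\<^esub>}"
      unfolding F_def S0 resolution.simps One_nat_def im using g0(2) by auto
    show "res_diff F (Suc n) ` carrier (free_module R (k (Suc (Suc n)))) =
        {x \<in> carrier (free_module R (k (Suc n))). res_diff F n x = \<zero>\<^bsub>free_module R (k n)\<^esub>}" for n
      unfolding F_def resolution.simps im using gex[of n] by auto
    show "res_aug F \<in> extensional (carrier (free_module R (k 0)))"
      unfolding F_def S0 resolution.simps by (rule restrict_extensional)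
    show "res_diff F n \<in> extensional (carrier (free_module R (k (Suc n))))" for n
      unfolding F_def resolution.simps by (rule restrict_extensional)
  qed
  thus ?thesis ..
qed

lemma (in cring) chain_lift_exists:
  assumes "module R A" "module R B" "is_free_resolution R A F" "is_free_resolution R B G"
    and "linear_map R A B f"
  shows "\<exists>\<theta>. is_chain_lift R F G f \<theta>"
proof -
  note F = resolutionD[OF assms(3)] and G = resolutionD[OF assms(4)]
  \<comment> \<open>The last clause, that boundaries go to boundaries, is what allows the next
    component to be lifted through the differential; exactness of the target re-establishes it in
    the next degree.\<close>
  let ?P = "\<lambda>n \<theta>. \<theta> \<in> extensional (carrier (res_module R F n)) \<and>
     linear_map R (res_module R F n) (res_module R G n) \<theta> \<and>
     (n = 0 \<longrightarrow> (\<forall>v\<in>carrier (res_module R F 0). res_aug G (\<theta> v) = f (res_aug F v))) \<and>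
     (\<forall>v\<in>carrier (res_module R F (Suc n)).
        \<theta> (res_diff F n v) \<in> res_diff G n ` carrier (res_module R G (Suc n)))"
  let ?Q = "\<lambda>n \<theta> \<theta>'. \<forall>v\<in>carrier (res_module R F (Suc n)). res_diff G n (\<theta>' v) = \<theta> (res_diff F n v)"
  have "\<exists>\<theta>. \<forall>n. ?P n (\<theta> n) \<and> ?Q n (\<theta> n) (\<theta> (Suc n))"
  proof (rule dependent_nat_choice)
    interpret G0: module R "res_module R G 0" by (rule module_res_module)
    obtain g where g: "linear_map R (res_module R F 0) (res_module R G 0) g"
      "\<And>v. v \<in> carrier (res_module R F 0) \<Longrightarrow> res_aug G (g v) = f (res_aug F v)"
      using res_module_lift[OF module_res_module assms(2) G(1) G0.carrier_is_submodule
          linear_map_comp[OF F(1) assms(5)]] G(3) linear_mapD(1)[OF F(1)] linear_mapD(1)[OF assms(5)]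
      by metis
    let ?g = "restrict g (carrier (res_module R F 0))"
    have g': "linear_map R (res_module R F 0) (res_module R G 0) ?g"
      by (rule linear_map_cong[OF g(1) module_res_module]) (rule restrict_apply')
    have "?g (res_diff F 0 v) \<in> res_diff G 0 ` carrier (res_module R G (Suc 0))"
      if v: "v \<in> carrier (res_module R F (Suc 0))" for v
    proof -
      have dv: "res_diff F 0 v \<in> carrier (res_module R F 0)" using linear_mapD(1)[OF F(2) v] .
      have "res_aug G (g (res_diff F 0 v)) = \<zero>\<^bsub>B\<^esub>"
        unfolding g(2)[OF dv] res_aug_diff[OF assms(3) v]
        by (rule linear_map_zero[OF assms(1,2,5)])
      thus ?thesis using G(4)[OF linear_mapD(1)[OF g(1) dv]] dv by simp
    qed
    thus "\<exists>\<theta>. ?P 0 \<theta>" using g(2) g' by (intro exI[of _ ?g]) auto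
  next
    fix \<theta> n assume \<theta>: "?P n \<theta>"
    interpret G1: module R "res_module R G (Suc n)" by (rule module_res_module)
    have \<theta>lin: "linear_map R (res_module R F n) (res_module R G n) \<theta>" using \<theta> by blast
    obtain g where g: "linear_map R (res_module R F (Suc n)) (res_module R G (Suc n)) g"
      "\<And>v. v \<in> carrier (res_module R F (Suc n)) \<Longrightarrow> res_diff G n (g v) = \<theta> (res_diff F n v)"
      using res_module_lift[OF module_res_module module_res_module G(2) G1.carrier_is_submodule
          linear_map_comp[OF F(2) \<theta>lin]] \<theta> by metis
    let ?g = "restrict g (carrier (res_module R F (Suc n)))"
    have g': "linear_map R (res_module R F (Suc n)) (res_module R G (Suc n)) ?g"
      by (rule linear_map_cong[OF g(1) module_res_module]) (rule restrict_apply')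
    have "?g (res_diff F (Suc n) v) \<in> res_diff G (Suc n) ` carrier (res_module R G (Suc (Suc n)))"
      if v: "v \<in> carrier (res_module R F (Suc (Suc n)))" for v
    proof -
      have dv: "res_diff F (Suc n) v \<in> carrier (res_module R F (Suc n))"
        using linear_mapD(1)[OF F(2) v] .
      have "res_diff G n (g (res_diff F (Suc n) v)) = \<zero>\<^bsub>res_module R G n\<^esub>"
        unfolding g(2)[OF dv] res_diff_diff[OF assms(3) v]
        by (rule linear_map_zero[OF module_res_module module_res_module \<theta>lin])
      thus ?thesis using G(5)[OF linear_mapD(1)[OF g(1) dv]] dv by simp
    qed
    thus "\<exists>\<theta>'. ?P (Suc n) \<theta>' \<and> ?Q n \<theta> \<theta>'" using g(2) g' by (intro exI[of _ ?g]) auto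
  qed
  then obtain \<theta> where *: "\<forall>n. ?P n (\<theta> n) \<and> ?Q n (\<theta> n) (\<theta> (Suc n))" by (rule exE)
  have \<theta>: "?P n (\<theta> n)" "?Q n (\<theta> n) (\<theta> (Suc n))" for n
    by (rule conjunct1[OF spec[OF *]], rule conjunct2[OF spec[OF *]])
  have "\<forall>v\<in>carrier (res_module R F 0). res_aug G (\<theta> 0 v) = f (res_aug F v)"
    using \<theta>(1)[of 0] by blast
  thus ?thesis
    using \<theta> unfolding is_chain_lift_def module_homs_iff_linear_map by (intro exI[of _ \<theta>]) auto
qed

text \<open>Serves two comparisons: two lifts of one map differ by a chain map covering zero, and
  multiplication by an element that kills the resolved module is another.\<close>

lemma (in cring) chain_map_null_homotopic:
  assumes "module R A" "module R B" "is_free_resolution R A F" "is_free_resolution R B G"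
    and lin: "\<And>n. linear_map R (res_module R F n) (res_module R G n) (\<alpha> n)"
    and com: "\<And>n v. v \<in> carrier (res_module R F (Suc n)) \<Longrightarrow>
                res_diff G n (\<alpha> (Suc n) v) = \<alpha> n (res_diff F n v)"
    and aug: "\<And>v. v \<in> carrier (res_module R F 0) \<Longrightarrow> res_aug G (\<alpha> 0 v) = \<zero>\<^bsub>B\<^esub>"
  obtains s where "\<And>n. linear_map R (res_module R F n) (res_module R G (Suc n)) (s n)"
    and "\<And>v. v \<in> carrier (res_module R F 0) \<Longrightarrow> \<alpha> 0 v = res_diff G 0 (s 0 v)"
    and "\<And>n v. v \<in> carrier (res_module R F (Suc n)) \<Longrightarrow>
           \<alpha> (Suc n) v = res_diff G (Suc n) (s (Suc n) v) \<oplus>\<^bsub>res_module R G (Suc n)\<^esub> s n (res_diff F n v)"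
proof -
  note F = resolutionD[OF assms(3)] and G = resolutionD[OF assms(4)]
  \<comment> \<open>The last clause makes \<open>\<alpha> (Suc n) - s d\<close> take cycles as
    values, so exactness of the target provides the next component.\<close>
  let ?P = "\<lambda>n s. linear_map R (res_module R F n) (res_module R G (Suc n)) s \<and>
     (n = 0 \<longrightarrow> (\<forall>v\<in>carrier (res_module R F 0). \<alpha> 0 v = res_diff G 0 (s v))) \<and>
     (\<forall>v\<in>carrier (res_module R F (Suc n)). res_diff G n (s (res_diff F n v)) = \<alpha> n (res_diff F n v))"
  let ?Q = "\<lambda>n s s'. \<forall>v\<in>carrier (res_module R F (Suc n)).
     \<alpha> (Suc n) v = res_diff G (Suc n) (s' v) \<oplus>\<^bsub>res_module R G (Suc n)\<^esub> s (res_diff F n v)"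
  have "\<exists>s. \<forall>n. ?P n (s n) \<and> ?Q n (s n) (s (Suc n))"
  proof (rule dependent_nat_choice)
    interpret G1: module R "res_module R G (Suc 0)" by (rule module_res_module)
    have "\<alpha> 0 v \<in> res_diff G 0 ` carrier (res_module R G (Suc 0))"
      if v: "v \<in> carrier (res_module R F 0)" for v
      using G(4)[OF linear_mapD(1)[OF lin v]] aug[OF v] by blast
    then obtain g where g: "linear_map R (res_module R F 0) (res_module R G (Suc 0)) g"
      "\<And>v. v \<in> carrier (res_module R F 0) \<Longrightarrow> res_diff G 0 (g v) = \<alpha> 0 v"
      using res_module_lift[OF module_res_module module_res_module G(2) G1.carrier_is_submodule lin]
      by metis
    thus "\<exists>s. ?P 0 s" using linear_mapD(1)[OF F(2)] by (intro exI[of _ g]) auto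
  next
    fix s n assume s: "?P n s"
    interpret G1: module R "res_module R G (Suc n)" by (rule module_res_module)
    interpret G2: module R "res_module R G (Suc (Suc n))" by (rule module_res_module)
    interpret G0: module R "res_module R G n" by (rule module_res_module)
    have slin: "linear_map R (res_module R F n) (res_module R G (Suc n)) s" using s by blast
    let ?b = "\<lambda>v. \<alpha> (Suc n) v \<ominus>\<^bsub>res_module R G (Suc n)\<^esub> s (res_diff F n v)"
    have blin: "linear_map R (res_module R F (Suc n)) (res_module R G (Suc n)) ?b"
      by (rule linear_map_diff[OF module_res_module module_res_module lin linear_map_comp[OF F(2) slin]])
    have "?b v \<in> res_diff G (Suc n) ` carrier (res_module R G (Suc (Suc n)))"
      if v: "v \<in> carrier (res_module R F (Suc n))" for v
    proof -
      have c: "\<alpha> (Suc n) v \<in> carrier (res_module R G (Suc n))"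
        "s (res_diff F n v) \<in> carrier (res_module R G (Suc n))"
        using linear_mapD(1)[OF lin v] linear_mapD(1)[OF linear_map_comp[OF F(2) slin] v] by auto
      have "res_diff G n (?b v) = res_diff G n (\<alpha> (Suc n) v) \<ominus>\<^bsub>res_module R G n\<^esub> res_diff G n (s (res_diff F n v))"
        by (rule linear_map_minus[OF module_res_module module_res_module G(2) c])
      also have "\<dots> = \<zero>\<^bsub>res_module R G n\<^esub>"
        using com[OF v] s v linear_mapD(1)[OF lin linear_mapD(1)[OF F(2) v]]
        by (simp add: a_minus_def G0.r_neg)
      finally show ?thesis using G(5)[OF linear_mapD(1)[OF blin v]] by blast
    qed
    then obtain g where g: "linear_map R (res_module R F (Suc n)) (res_module R G (Suc (Suc n))) g"
      "\<And>v. v \<in> carrier (res_module R F (Suc n)) \<Longrightarrow> res_diff G (Suc n) (g v) = ?b v"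
      using res_module_lift[OF module_res_module module_res_module G(2) G2.carrier_is_submodule blin]
      by metis
    have Q: "?Q n s g"
    proof
      fix v assume v: "v \<in> carrier (res_module R F (Suc n))"
      show "\<alpha> (Suc n) v = res_diff G (Suc n) (g v) \<oplus>\<^bsub>res_module R G (Suc n)\<^esub> s (res_diff F n v)"
        unfolding g(2)[OF v]
        using linear_mapD(1)[OF lin v] linear_mapD(1)[OF linear_map_comp[OF F(2) slin] v]
        by (simp add: a_minus_def G1.a_assoc G1.l_neg)
    qed
    have "res_diff G (Suc n) (g (res_diff F (Suc n) v)) = \<alpha> (Suc n) (res_diff F (Suc n) v)"
      if v: "v \<in> carrier (res_module R F (Suc (Suc n)))" for v
    proof -
      have dv: "res_diff F (Suc n) v \<in> carrier (res_module R F (Suc n))"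
        using linear_mapD(1)[OF F(2) v] .
      have "\<alpha> (Suc n) (res_diff F (Suc n) v) =
          res_diff G (Suc n) (g (res_diff F (Suc n) v)) \<oplus>\<^bsub>res_module R G (Suc n)\<^esub> s (res_diff F n (res_diff F (Suc n) v))"
        using Q dv by blast
      also have "s (res_diff F n (res_diff F (Suc n) v)) = \<zero>\<^bsub>res_module R G (Suc n)\<^esub>"
        unfolding res_diff_diff[OF assms(3) v]
        by (rule linear_map_zero[OF module_res_module module_res_module slin])
      finally show ?thesis
        using linear_mapD(1)[OF G(2) linear_mapD(1)[OF g(1) dv]] by simp
    qed
    thus "\<exists>s'. ?P (Suc n) s' \<and> ?Q n s s'" using g(1) Q by (intro exI[of _ g]) auto
  qed
  then obtain s where *: "\<forall>n. ?P n (s n) \<and> ?Q n (s n) (s (Suc n))" by (rule exE)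
  have s: "?P n (s n)" "?Q n (s n) (s (Suc n))" for n
    by (rule conjunct1[OF spec[OF *]], rule conjunct2[OF spec[OF *]])
  show thesis by (rule that[of s]) (use s(1) s(1)[of 0] s(2) in blast)+
qed

section \<open>The inverse system of resolutions of the powers of an ideal\<close>

locale noetherian_ideal = noetherian_cring R for R :: "('a, 'm) ring_scheme" (structure) +
  fixes I :: "'a set"
  assumes ideal_I: "ideal I R"
begin

abbreviation "Ipow n \<equiv> I [^]\<^bsub>ideals_set R\<^esub> (n::nat)"
abbreviation "Q n \<equiv> ideal_power_quot R I n"
abbreviation "Res n \<equiv> free_resolution R (Q n)"
abbreviation "P n j \<equiv> res_module R (Res n) j"
abbreviation "d n j \<equiv> res_diff (Res n) j"
abbreviation "aug n \<equiv> res_aug (Res n)"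

text \<open>Literally the choice made inside \<open>Ext_map\<close>, named so that unfolding
  produces \<open>lift\<close>. The map goes from level m down to level n, for n \<le> m; cochains
  are pulled back the other way, from level n to level m.\<close>

definition lift :: "nat \<Rightarrow> nat \<Rightarrow> nat \<Rightarrow> (nat \<Rightarrow> 'a) \<Rightarrow> (nat \<Rightarrow> 'a)" where
  "lift m n = (SOME \<theta>. is_chain_lift R (Res m) (Res n) (ideal_power_proj R I m n) \<theta>)"

lemma ideal_pow: "ideal (Ipow n) R"
proof -
  interpret S: comm_monoid "ideals_set R" by (rule ideals_set_is_comm_monoid)
  have "Ipow n \<in> carrier (ideals_set R)"
    by (rule S.nat_pow_closed) (simp add: ideals_set_def ideal_I)
  thus ?thesis by (simp add: ideals_set_def)
qed

lemma Ipow_0: "Ipow 0 = carrier R"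
  by (simp add: nat_pow_def ideals_set_def)

lemma Ipow_add: "Ipow (m + n) = ideal_prod R (Ipow m) (Ipow n)"
proof -
  interpret S: comm_monoid "ideals_set R" by (rule ideals_set_is_comm_monoid)
  have "Ipow (m + n) = Ipow m \<otimes>\<^bsub>ideals_set R\<^esub> Ipow n"
    by (rule S.nat_pow_mult[symmetric]) (simp add: ideals_set_def ideal_I)
  thus ?thesis by (simp add: ideals_set_def)
qed

lemma Ipow_1: "Ipow (Suc 0) = I"
proof -
  interpret S: comm_monoid "ideals_set R" by (rule ideals_set_is_comm_monoid)
  show ?thesis using S.nat_pow_eone[of I] ideal_I by (simp add: ideals_set_def)
qed

lemma Ipow_antimono: "n \<le> m \<Longrightarrow> Ipow m \<subseteq> Ipow n"
  using Ipow_add[of n "m - n"] ideal_prod_inter[OF ideal_pow ideal_pow, of n "m - n"] by auto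

lemma pow_mem_Ipow: "x \<in> I \<Longrightarrow> x [^] n \<in> Ipow n"
proof (induction n)
  case 0
  have "\<one> \<in> Ipow 0" unfolding Ipow_0 by (rule one_closed)
  thus ?case by (simp del: nat_pow_0 add: nat_pow_def)
next
  case (Suc n)
  have "Ipow (n + Suc 0) = ideal_prod R (Ipow n) I" using Ipow_add[of n "Suc 0"] unfolding Ipow_1 .
  moreover have "x [^] n \<otimes> x \<in> ideal_prod R (Ipow n) I" using Suc by (intro ideal_prod.prod)
  ultimately show ?case by (simp del: nat_pow_Suc add: nat_pow_Suc[of x])
qed

lemma module_Q: "module R (Q n)" and fin_gen_Q: "fin_gen_module R (Q n)"
  unfolding ideal_power_quot_def by (rule ideal_quot[OF ideal_pow])+

lemma carrier_Q: "carrier (Q n) = (\<lambda>x. Ipow n +> x) ` carrier R"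
  unfolding ideal_power_quot_def by (rule ideal_quot[OF ideal_pow])

lemma linear_map_Q: "linear_map R (regular_module R) (Q n) (\<lambda>x. Ipow n +> x)"
  unfolding ideal_power_quot_def by (rule ideal_quot[OF ideal_pow])

lemma coset_Q_eq_zero: "x \<in> carrier R \<Longrightarrow> Ipow n +> x = \<zero>\<^bsub>Q n\<^esub> \<longleftrightarrow> x \<in> Ipow n"
  unfolding ideal_power_quot_def by (rule ideal_quot[OF ideal_pow])

lemma res: "is_free_resolution R (Q n) (Res n)"
  unfolding free_resolution_def
  by (rule someI_ex) (rule free_resolution_exists[OF module_Q fin_gen_Q])

lemma proj_coset:
  assumes "n \<le> m" "x \<in> carrier R"
  shows "ideal_power_proj R I m n (Ipow m +> x) = Ipow n +> x"
proof -
  interpret r: module R "regular_module R" by (rule module_regular_module)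
  have eq: "Ipow n +> y = Ipow n +> x" if "y \<in> Ipow m +> x" for y
  proof -
    have "y \<in> carrier R" "y \<ominus>\<^bsub>regular_module R\<^esub> x \<in> Ipow m"
      using r.mem_coset_iff[OF submodule_ideal[OF ideal_pow], of x y m] that assms(2) by auto
    thus ?thesis
      using r.coset_eq_iff[OF submodule_ideal[OF ideal_pow], of y x n] assms Ipow_antimono[OF assms(1)]
      by auto
  qed
  have self: "x \<in> Ipow m +> x"
    using r.mem_coset_iff[OF submodule_ideal[OF ideal_pow], of x x m] assms(2)
      submoduleD(2)[OF submodule_ideal[OF ideal_pow[of m]]] r.M.r_neg[of x]
    by (simp add: a_minus_def)
  have "(\<Union>y\<in>Ipow m +> x. Ipow n +> y) = Ipow n +> x"
    by (rule UN_constant_eq[OF self]) (intro ballI eq)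
  thus ?thesis using assms(2) by (auto simp: ideal_power_proj_def carrier_Q)
qed

lemma linear_map_proj_Q:
  assumes "n \<le> m"
  shows "linear_map R (Q m) (Q n) (ideal_power_proj R I m n)"
proof (rule linear_mapI)
  note lm = linear_mapD[OF linear_map_Q[of m], simplified]
  note ln = linear_mapD[OF linear_map_Q[of n], simplified]
  show "ideal_power_proj R I m n X \<in> carrier (Q n)" if "X \<in> carrier (Q m)" for X
    using that proj_coset[OF assms] unfolding carrier_Q by auto
  show "ideal_power_proj R I m n (X \<oplus>\<^bsub>Q m\<^esub> Y)
      = ideal_power_proj R I m n X \<oplus>\<^bsub>Q n\<^esub> ideal_power_proj R I m n Y"
    if XY: "X \<in> carrier (Q m)" "Y \<in> carrier (Q m)" for X Y
  proof -
    obtain x y where "X = Ipow m +> x" "x \<in> carrier R" "Y = Ipow m +> y" "y \<in> carrier R"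
      using XY unfolding carrier_Q by auto
    thus ?thesis using proj_coset[OF assms] lm(2)[of x y, symmetric] ln(2)[of x y] by simp
  qed
  show "ideal_power_proj R I m n (r \<odot>\<^bsub>Q m\<^esub> X) = r \<odot>\<^bsub>Q n\<^esub> ideal_power_proj R I m n X"
    if r: "r \<in> carrier R" and X: "X \<in> carrier (Q m)" for r X
  proof -
    obtain x where "X = Ipow m +> x" "x \<in> carrier R" using X unfolding carrier_Q by auto
    thus ?thesis using proj_coset[OF assms] lm(3)[of r x, symmetric] ln(3)[of r x] r by simp
  qed
qed

lemma lift_is_chain_lift:
  "n \<le> m \<Longrightarrow> is_chain_lift R (Res m) (Res n) (ideal_power_proj R I m n) (lift m n)"
  unfolding lift_def
  using someI_ex[OF chain_lift_exists[OF module_Q module_Q res res linear_map_proj_Q]] .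

lemma lift_linear: "n \<le> m \<Longrightarrow> linear_map R (P m j) (P n j) (lift m n j)"
  and lift_aug: "n \<le> m \<Longrightarrow> v \<in> carrier (P m 0) \<Longrightarrow>
        aug n (lift m n 0 v) = ideal_power_proj R I m n (aug m v)"
  and lift_diff: "n \<le> m \<Longrightarrow> v \<in> carrier (P m (Suc j)) \<Longrightarrow>
        d n j (lift m n (Suc j) v) = lift m n j (d m j v)"
  using lift_is_chain_lift[of n m] unfolding is_chain_lift_def module_homs_iff_linear_map by auto

lemmas P_module = module_res_module

lemmas d_linear = resolutionD(2)[OF res]
lemmas d_closed = linear_mapD(1)[OF resolutionD(2)[OF res]]
lemmas lift_closed = linear_mapD(1)[OF lift_linear]

section \<open>Cocycles, coboundaries and their pullbacks along the transition maps\<close>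

definition cocycle :: "nat \<Rightarrow> nat \<Rightarrow> ('a, 'b, 'k) module_scheme \<Rightarrow> ((nat \<Rightarrow> 'a) \<Rightarrow> 'b) \<Rightarrow> bool" where
  "cocycle n i M \<phi> \<longleftrightarrow>
     linear_map R (P n i) M \<phi> \<and> (\<forall>v\<in>carrier (P n (Suc i)). \<phi> (d n i v) = \<zero>\<^bsub>M\<^esub>)"

text \<open>Only values on the carrier count, so a cochain may be changed off the carrier by
  \<open>coboundary_cong\<close>. Degree 0 has no incoming differential, hence the case
  distinction.\<close>

definition coboundary :: "nat \<Rightarrow> nat \<Rightarrow> ('a, 'b, 'k) module_scheme \<Rightarrow> ((nat \<Rightarrow> 'a) \<Rightarrow> 'b) \<Rightarrow> bool" where
  "coboundary n i M \<phi> \<longleftrightarrow>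
     (case i of
        0 \<Rightarrow> \<forall>v\<in>carrier (P n 0). \<phi> v = \<zero>\<^bsub>M\<^esub>
      | Suc j \<Rightarrow> \<exists>\<psi>. linear_map R (P n j) M \<psi> \<and> (\<forall>v\<in>carrier (P n (Suc j)). \<phi> v = \<psi> (d n j v)))"

text \<open>The class of \<open>\<phi>\<close> becomes zero in the direct limit.\<close>

definition dies :: "nat \<Rightarrow> nat \<Rightarrow> ('a, 'b, 'k) module_scheme \<Rightarrow> ((nat \<Rightarrow> 'a) \<Rightarrow> 'b) \<Rightarrow> bool" where
  "dies n i M \<phi> \<longleftrightarrow> (\<exists>m\<ge>n. coboundary m i M (\<lambda>v. \<phi> (lift m n i v)))"

lemma coboundary_cong:
  assumes "coboundary n i M \<phi>" "\<And>v. v \<in> carrier (P n i) \<Longrightarrow> \<phi>' v = \<phi> v"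
  shows "coboundary n i M \<phi>'"
  using assms unfolding coboundary_def by (cases i) auto

lemma coboundary_zero:
  assumes "module R M" "\<And>v. v \<in> carrier (P n i) \<Longrightarrow> \<phi> v = \<zero>\<^bsub>M\<^esub>"
  shows "coboundary n i M \<phi>"
  using assms linear_map_const_zero[OF P_module assms(1)]
  unfolding coboundary_def by (cases i) force+

lemma coboundary_plus:
  assumes "module R M" "coboundary n i M \<phi>" "coboundary n i M \<psi>"
  shows "coboundary n i M (\<lambda>v. \<phi> v \<oplus>\<^bsub>M\<^esub> \<psi> v)"
proof -
  interpret M: module R M by fact
  show ?thesis
  proof (cases i)
    case 0 thus ?thesis using assms by (simp add: coboundary_def)
  next
    case (Suc j)
    obtain a b where "linear_map R (P n j) M a" "\<forall>v\<in>carrier (P n (Suc j)). \<phi> v = a (d n j v)"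
      "linear_map R (P n j) M b" "\<forall>v\<in>carrier (P n (Suc j)). \<psi> v = b (d n j v)"
      using assms(2,3) Suc by (auto simp: coboundary_def)
    thus ?thesis
      using linear_map_plus[OF P_module assms(1), of "Res n" j a b] Suc
      by (auto simp: coboundary_def intro!: exI[of _ "\<lambda>v. a v \<oplus>\<^bsub>M\<^esub> b v"])
  qed
qed

lemma coboundary_map:
  assumes "module R M" "module R N" "linear_map R M N f" "coboundary n i M \<phi>"
  shows "coboundary n i N (\<lambda>v. f (\<phi> v))"
proof (cases i)
  case 0 thus ?thesis using assms linear_map_zero[OF assms(1-3)] by (simp add: coboundary_def)
next
  case (Suc j)
  obtain a where "linear_map R (P n j) M a" "\<forall>v\<in>carrier (P n (Suc j)). \<phi> v = a (d n j v)"
    using assms(4) Suc by (auto simp: coboundary_def)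
  thus ?thesis using linear_map_comp[OF _ assms(3), of "P n j" a] Suc
    by (auto simp: coboundary_def intro!: exI[of _ "\<lambda>v. f (a v)"])
qed

lemma coboundary_minus:
  assumes "module R M" "coboundary n i M \<phi>" "coboundary n i M \<psi>"
    and "\<And>v. v \<in> carrier (P n i) \<Longrightarrow> \<psi> v \<in> carrier M"
  shows "coboundary n i M (\<lambda>v. \<phi> v \<ominus>\<^bsub>M\<^esub> \<psi> v)"
proof -
  interpret M: module R M by fact
  have "linear_map R M M (\<lambda>x. \<ominus>\<^bsub>M\<^esub> x)"
    by (rule linear_mapI) (auto simp: M.minus_add M.a_comm M.smult_r_minus)
  from coboundary_plus[OF assms(1,2) coboundary_map[OF assms(1,1) this assms(3)]]
  show ?thesis by (simp add: a_minus_def)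
qed

text \<open>The bounding cochain in N is lifted to M because its source is free, and the
  differential is applied afterwards; in degree 0 the zero map does.\<close>

lemma coboundary_surj_lift:
  assumes "module R M" "module R N" "linear_map R M N f" "f ` carrier M = carrier N"
    and "coboundary n i N \<phi>"
  obtains \<psi> where "linear_map R (P n i) M \<psi>" "coboundary n i M \<psi>"
    "\<And>v. v \<in> carrier (P n i) \<Longrightarrow> f (\<psi> v) = \<phi> v"
proof (cases i)
  case 0
  show thesis
    by (rule that[of "\<lambda>v. \<zero>\<^bsub>M\<^esub>"])
       (use 0 assms(5) linear_map_zero[OF assms(1-3)] coboundary_zero[OF assms(1)]
          linear_map_const_zero[OF P_module assms(1)] in \<open>auto simp: coboundary_def\<close>)
next
  case (Suc j)
  interpret M: module R M by fact
  obtain a where a: "linear_map R (P n j) N a" "\<forall>v\<in>carrier (P n (Suc j)). \<phi> v = a (d n j v)"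
    using assms(5) Suc by (auto simp: coboundary_def)
  obtain b where b: "linear_map R (P n j) M b" "\<And>v. v \<in> carrier (P n j) \<Longrightarrow> f (b v) = a v"
    using res_module_lift[OF assms(1-3) M.carrier_is_submodule a(1)] assms(4) linear_mapD(1)[OF a(1)]
    by metis
  show thesis
    by (rule that[of "\<lambda>v. b (d n j v)"])
       (use Suc a b linear_map_comp[OF d_linear b(1)] d_closed in \<open>auto simp: coboundary_def\<close>)
qed

lemma cocycle_of_coboundary:
  assumes "module R M" "linear_map R (P n i) M \<phi>" "coboundary n i M \<phi>"
  shows "cocycle n i M \<phi>"
proof -
  have "\<phi> (d n i v) = \<zero>\<^bsub>M\<^esub>" if v: "v \<in> carrier (P n (Suc i))" for v
  proof (cases i)
    case 0 thus ?thesis using assms(3) v d_closed[of v n i] by (simp add: coboundary_def)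
  next
    case (Suc j)
    obtain a where a: "linear_map R (P n j) M a" "\<forall>v\<in>carrier (P n (Suc j)). \<phi> v = a (d n j v)"
      using assms(3) Suc by (auto simp: coboundary_def)
    have "\<phi> (d n i v) = a (d n j (d n i v))" using a(2) v d_closed[of v n i] Suc by simp
    also have "\<dots> = \<zero>\<^bsub>M\<^esub>"
      using v linear_map_zero[OF P_module assms(1) a(1)] unfolding Suc res_diff_diff[OF res v[unfolded Suc]] by simp
    finally show ?thesis .
  qed
  thus ?thesis using assms(2) by (simp add: cocycle_def)
qed

lemma cocycle_diff:
  assumes "module R M" "cocycle n i M \<phi>" "cocycle n i M \<psi>"
  shows "cocycle n i M (\<lambda>v. \<phi> v \<ominus>\<^bsub>M\<^esub> \<psi> v)"
proof -
  interpret M: module R M by fact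
  show ?thesis
    using assms(2,3) linear_map_diff[OF P_module assms(1), of "Res n" i \<phi> \<psi>]
    by (auto simp: cocycle_def a_minus_def M.r_neg)
qed

lemma cocycle_map:
  assumes "module R M" "module R N" "linear_map R M N f" "cocycle n i M \<phi>"
  shows "cocycle n i N (\<lambda>v. f (\<phi> v))"
  using assms(4) linear_map_comp[OF _ assms(3), of "P n i" \<phi>] linear_map_zero[OF assms(1-3)]
  by (auto simp: cocycle_def)

lemma cocycle_lift:
  assumes "module R M" "cocycle n i M \<phi>" "n \<le> m"
  shows "cocycle m i M (\<lambda>v. \<phi> (lift m n i v))"
  using assms(2) linear_map_comp[OF lift_linear[OF assms(3)], of i M \<phi>]
    lift_diff[OF assms(3), symmetric] lift_closed[OF assms(3)]
  by (auto simp: cocycle_def)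

lemma coboundary_lift:
  assumes "module R M" "coboundary n i M \<phi>" "n \<le> m"
  shows "coboundary m i M (\<lambda>v. \<phi> (lift m n i v))"
proof (cases i)
  case 0 thus ?thesis using assms lift_closed[OF assms(3)] by (auto simp: coboundary_def)
next
  case (Suc j)
  obtain a where "linear_map R (P n j) M a" "\<forall>v\<in>carrier (P n (Suc j)). \<phi> v = a (d n j v)"
    using assms(2) Suc by (auto simp: coboundary_def)
  thus ?thesis using linear_map_comp[OF lift_linear[OF assms(3)], of j M a] Suc
      lift_diff[OF assms(3)] lift_closed[OF assms(3)]
    by (auto simp: coboundary_def intro!: exI[of _ "\<lambda>v. a (lift m n j v)"])
qed

text \<open>If s is a homotopy from \<alpha> to zero, the cocycle kills the summand d s, and what
  remains is \<open>(\<phi> s) d\<close>.\<close>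

lemma coboundary_null_homotopic:
  assumes "module R M" "cocycle n i M \<phi>"
    and lin: "\<And>j. linear_map R (P m j) (P n j) (\<alpha> j)"
    and com: "\<And>j v. v \<in> carrier (P m (Suc j)) \<Longrightarrow> d n j (\<alpha> (Suc j) v) = \<alpha> j (d m j v)"
    and aug: "\<And>v. v \<in> carrier (P m 0) \<Longrightarrow> aug n (\<alpha> 0 v) = \<zero>\<^bsub>Q n\<^esub>"
  shows "coboundary m i M (\<lambda>v. \<phi> (\<alpha> i v))"
proof -
  interpret M: module R M by fact
  have \<phi>: "linear_map R (P n i) M \<phi>" "\<And>v. v \<in> carrier (P n (Suc i)) \<Longrightarrow> \<phi> (d n i v) = \<zero>\<^bsub>M\<^esub>"
    using assms(2) by (auto simp: cocycle_def)
  obtain s where s: "\<And>j. linear_map R (P m j) (P n (Suc j)) (s j)"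
    "\<And>v. v \<in> carrier (P m 0) \<Longrightarrow> \<alpha> 0 v = d n 0 (s 0 v)"
    "\<And>j v. v \<in> carrier (P m (Suc j)) \<Longrightarrow>
           \<alpha> (Suc j) v = d n (Suc j) (s (Suc j) v) \<oplus>\<^bsub>P n (Suc j)\<^esub> s j (d m j v)"
    using chain_map_null_homotopic[OF module_Q module_Q res res lin com aug] by blast
  show ?thesis
  proof (cases i)
    case 0
    thus ?thesis using s(2) \<phi>(2) linear_mapD(1)[OF s(1)] by (simp add: coboundary_def)
  next
    case (Suc j)
    have "\<phi> (\<alpha> i v) = \<phi> (s j (d m j v))" if v: "v \<in> carrier (P m (Suc j))" for v
    proof -
      have sv: "s i v \<in> carrier (P n (Suc i))" "s j (d m j v) \<in> carrier (P n i)"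
        using linear_mapD(1)[OF s(1)] v d_closed[OF v] Suc by auto
      have "\<phi> (\<alpha> i v) = \<phi> (d n i (s i v)) \<oplus>\<^bsub>M\<^esub> \<phi> (s j (d m j v))"
        using s(3)[OF v] linear_mapD(2)[OF \<phi>(1) d_closed[OF sv(1)] sv(2)] Suc by simp
      thus ?thesis using \<phi>(2)[OF sv(1)] linear_mapD(1)[OF \<phi>(1) sv(2)] by simp
    qed
    moreover have "linear_map R (P m j) M (\<lambda>v. \<phi> (s j v))"
      using linear_map_comp[OF s(1)[of j]] \<phi>(1) Suc by simp
    ultimately show ?thesis using Suc by (auto simp: coboundary_def)
  qed
qed

text \<open>Comparison maps are arbitrary choices, so composing two of them need not give the one
  chosen for the composite projection. Both lift that projection, and their difference lifts
  zero.\<close>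

lemma coboundary_lift_lift:
  assumes "module R M" "cocycle n i M \<phi>" "n \<le> m" "m \<le> k"
  shows "coboundary k i M (\<lambda>v. \<phi> (lift m n i (lift k m i v)) \<ominus>\<^bsub>M\<^esub> \<phi> (lift k n i v))"
proof -
  let ?a = "\<lambda>j v. lift m n j (lift k m j v) \<ominus>\<^bsub>P n j\<^esub> lift k n j v"
  have nk: "n \<le> k" using assms by simp
  have c: "lift m n j (lift k m j v) \<in> carrier (P n j)" "lift k n j v \<in> carrier (P n j)"
    if "v \<in> carrier (P k j)" for j v
    using lift_closed[OF assms(3) lift_closed[OF assms(4) that]] lift_closed[OF nk that] by auto
  have "coboundary k i M (\<lambda>v. \<phi> (?a i v))"
  proof (rule coboundary_null_homotopic[OF assms(1,2)])
    show "linear_map R (P k j) (P n j) (?a j)" for j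
      by (rule linear_map_diff[OF P_module P_module linear_map_comp[OF lift_linear[OF assms(4)]
            lift_linear[OF assms(3)]] lift_linear[OF nk]])
    show "d n j (?a (Suc j) v) = ?a j (d k j v)" if v: "v \<in> carrier (P k (Suc j))" for j v
      unfolding linear_map_minus[OF P_module P_module d_linear c[OF v]]
      using lift_diff[OF assms(3) lift_closed[OF assms(4) v]] lift_diff[OF assms(4) v] lift_diff[OF nk v]
      by simp
    show "aug n (?a 0 v) = \<zero>\<^bsub>Q n\<^esub>" if v: "v \<in> carrier (P k 0)" for v
    proof -
      interpret Qn: module R "Q n" by (rule module_Q)
      have av: "aug k v \<in> carrier (Q k)" using linear_mapD(1)[OF resolutionD(1)[OF res] v] .
      have "ideal_power_proj R I m n (ideal_power_proj R I k m (aug k v)) = ideal_power_proj R I k n (aug k v)"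
        using av proj_coset[OF assms(3)] proj_coset[OF assms(4)] proj_coset[OF nk]
        unfolding carrier_Q by auto
      thus ?thesis
        unfolding linear_map_minus[OF P_module module_Q resolutionD(1)[OF res] c[OF v]]
        using lift_aug[OF assms(3) lift_closed[OF assms(4) v]] lift_aug[OF assms(4) v] lift_aug[OF nk v]
          linear_mapD(1)[OF linear_map_proj_Q[OF nk] av]
        by (simp add: a_minus_def Qn.r_neg)
    qed
  qed
  thus ?thesis
  proof (rule coboundary_cong)
    fix v assume v: "v \<in> carrier (P k i)"
    have "linear_map R (P n i) M \<phi>" using assms(2) by (simp add: cocycle_def)
    from linear_map_minus[OF P_module assms(1) this c[OF v]]
    show "\<phi> (lift m n i (lift k m i v)) \<ominus>\<^bsub>M\<^esub> \<phi> (lift k n i v) = \<phi> (?a i v)" by simp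
  qed
qed

text \<open>Subtracting the coboundary by which the two pullbacks differ passes from the composite
  to the chosen map. This is how arguments through two levels return to \<open>dies\<close>.\<close>

lemma coboundary_lift_trans:
  assumes "module R M" "cocycle n i M \<phi>" "n \<le> m" "m \<le> k"
    and "coboundary k i M (\<lambda>v. \<phi> (lift m n i (lift k m i v)))"
  shows "coboundary k i M (\<lambda>v. \<phi> (lift k n i v))"
proof -
  interpret M: module R M by fact
  have nk: "n \<le> k" using assms by simp
  have \<phi>: "linear_map R (P n i) M \<phi>" using assms(2) by (simp add: cocycle_def)
  have c: "\<phi> (lift m n i (lift k m i v)) \<in> carrier M" "\<phi> (lift k n i v) \<in> carrier M"
    if "v \<in> carrier (P k i)" for v
    using linear_mapD(1)[OF \<phi> lift_closed[OF assms(3) lift_closed[OF assms(4) that]]]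
      linear_mapD(1)[OF \<phi> lift_closed[OF nk that]] by auto
  have "coboundary k i M (\<lambda>v. \<phi> (lift m n i (lift k m i v)) \<ominus>\<^bsub>M\<^esub>
      (\<phi> (lift m n i (lift k m i v)) \<ominus>\<^bsub>M\<^esub> \<phi> (lift k n i v)))"
    by (rule coboundary_minus[OF assms(1,5) coboundary_lift_lift[OF assms(1-4)]]) (use c in auto)
  thus ?thesis
  proof (rule coboundary_cong)
    fix v assume "v \<in> carrier (P k i)"
    note c = c[OF this]
    show "\<phi> (lift k n i v) = \<phi> (lift m n i (lift k m i v)) \<ominus>\<^bsub>M\<^esub>
        (\<phi> (lift m n i (lift k m i v)) \<ominus>\<^bsub>M\<^esub> \<phi> (lift k n i v))"
      using c by (simp add: a_minus_def M.minus_add M.a_assoc[symmetric] M.r_neg)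
  qed
qed

lemma coboundary_lift_mono:
  assumes "module R M" "cocycle n i M \<phi>" "n \<le> m" "m \<le> k"
    and "coboundary m i M (\<lambda>v. \<phi> (lift m n i v))"
  shows "coboundary k i M (\<lambda>v. \<phi> (lift k n i v))"
  using coboundary_lift_trans[OF assms(1-4)] coboundary_lift[OF assms(1,5,4)] by simp

section \<open>Vanishing of local cohomology\<close>

text \<open>By \<open>local_cohomology_eq_zero_iff\<close> this is the vanishing of
  \<open>H^i(M)\<close>; after that equivalence the arguments work with cocycles. It is polymorphic
  in the type of M, as the inductions pass between modules with different carrier types.\<close>

definition vanishes :: "nat \<Rightarrow> ('a, 'b, 'k) module_scheme \<Rightarrow> bool" where
  "vanishes i M \<longleftrightarrow> (\<forall>n \<phi>. cocycle n i M \<phi> \<longrightarrow> dies n i M \<phi>)"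

lemma linear_map_restrict:
  assumes "linear_map R (P n i) M \<phi>"
  shows "linear_map R (P n i) M (restrict \<phi> (carrier (P n i)))"
  by (rule linear_map_cong[OF assms P_module]) (rule restrict_apply')

lemma mem_cocycles_iff:
  "\<phi> \<in> cocycles R (Res n) M i \<longleftrightarrow> cocycle n i M \<phi> \<and> \<phi> \<in> extensional (carrier (P n i))"
proof -
  have "hom_diff R (Res n) i \<phi> = (\<lambda>x\<in>carrier (P n (Suc i)). \<zero>\<^bsub>M\<^esub>) \<longleftrightarrow>
      (\<forall>v\<in>carrier (P n (Suc i)). \<phi> (d n i v) = \<zero>\<^bsub>M\<^esub>)"
    unfolding hom_diff_def compose_def by (auto simp: fun_eq_iff restrict_def)
  thus ?thesis
    by (auto simp: cocycles_def a_kernel_def' hom_module_def cocycle_def module_homs_iff_linear_map)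
qed

lemma mem_coboundaries_iff:
  assumes "module R M"
  shows "\<phi> \<in> coboundaries R (Res n) M i \<longleftrightarrow>
    linear_map R (P n i) M \<phi> \<and> coboundary n i M \<phi> \<and> \<phi> \<in> extensional (carrier (P n i))"
proof (cases i)
  case 0
  show ?thesis
  proof
    assume "\<phi> \<in> coboundaries R (Res n) M i"
    hence \<phi>: "\<phi> = restrict (\<lambda>v. \<zero>\<^bsub>M\<^esub>) (carrier (P n i))"
      using 0 by (simp add: coboundaries_def hom_module_def)
    show "linear_map R (P n i) M \<phi> \<and> coboundary n i M \<phi> \<and> \<phi> \<in> extensional (carrier (P n i))"
      unfolding \<phi> using linear_map_restrict[OF linear_map_const_zero[OF P_module assms]]
      by (auto intro: coboundary_zero[OF assms])
  next
    assume \<phi>: "linear_map R (P n i) M \<phi> \<and> coboundary n i M \<phi> \<and> \<phi> \<in> extensional (carrier (P n i))"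
    hence "\<phi> = restrict (\<lambda>v. \<zero>\<^bsub>M\<^esub>) (carrier (P n i))"
      using 0 by (intro extensionalityI[of \<phi> "carrier (P n i)"]) (auto simp: coboundary_def)
    thus "\<phi> \<in> coboundaries R (Res n) M i"
      using 0 by (simp add: coboundaries_def hom_module_def)
  qed
next
  case (Suc j)
  show ?thesis
  proof
    assume "\<phi> \<in> coboundaries R (Res n) M i"
    then obtain \<psi> where \<psi>: "linear_map R (P n j) M \<psi>"
      "\<phi> = restrict (\<lambda>v. \<psi> (d n j v)) (carrier (P n i))"
      using Suc by (auto simp: coboundaries_def hom_diff_def compose_def module_homs_iff_linear_map)
    show "linear_map R (P n i) M \<phi> \<and> coboundary n i M \<phi> \<and> \<phi> \<in> extensional (carrier (P n i))"
      using linear_map_restrict[of n i M "\<lambda>v. \<psi> (d n j v)"] linear_map_comp[OF d_linear \<psi>(1)] \<psi> Suc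
      by (auto simp: coboundary_def)
  next
    assume \<phi>: "linear_map R (P n i) M \<phi> \<and> coboundary n i M \<phi> \<and> \<phi> \<in> extensional (carrier (P n i))"
    then obtain \<psi> where \<psi>: "linear_map R (P n j) M \<psi>" "\<forall>v\<in>carrier (P n (Suc j)). \<phi> v = \<psi> (d n j v)"
      using Suc by (auto simp: coboundary_def)
    let ?\<psi> = "restrict \<psi> (carrier (P n j))"
    have "?\<psi> \<in> module_homs R (P n j) M"
      using linear_map_restrict[OF \<psi>(1)] by (simp add: module_homs_iff_linear_map)
    moreover have "\<phi> = hom_diff R (Res n) j ?\<psi>"
      unfolding hom_diff_def compose_def using \<phi> \<psi> Suc d_closed[of _ n j]
      by (intro extensionalityI[of \<phi> "carrier (P n i)"]) auto
    ultimately show "\<phi> \<in> coboundaries R (Res n) M i"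
      using Suc by (auto simp: coboundaries_def)
  qed
qed

section \<open>Zero in the direct limit of the Ext modules\<close>

context
  fixes M :: "('a, 'b, 'k) module_scheme" and i :: nat
  assumes M: "module R M"
begin

interpretation M: module R M by (rule M)

private abbreviation "Z n \<equiv> cocycles R (Res n) M i"
private abbreviation "B n \<equiv> coboundaries R (Res n) M i"
private abbreviation "H n \<equiv> hom_module R (P n i) M"
private abbreviation "E n \<equiv> Ext R i (Q n) M"
private abbreviation "tr n m \<equiv> Ext_map R i (Q m) (Q n) M (ideal_power_proj R I m n)"

lemma carrier_Ext: "carrier (E n) = (\<lambda>\<phi>. B n +>\<^bsub>H n\<^esub> \<phi>) ` Z n"
  by (auto simp: Ext_def Let_def quot_module_def A_RCOSETS_def' a_r_coset_def')

lemma zero_Ext: "\<zero>\<^bsub>E n\<^esub> = B n"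
  by (simp add: Ext_def Let_def quot_module_def)

lemma mem_coset_coboundaries_iff:
  "\<psi> \<in> B n +>\<^bsub>H n\<^esub> \<phi> \<longleftrightarrow> (\<exists>h\<in>B n. \<psi> = (\<lambda>x\<in>carrier (P n i). h x \<oplus>\<^bsub>M\<^esub> \<phi> x))"
  by (simp add: a_r_coset_def' hom_module_def)

lemma zero_in_coboundaries: "(\<lambda>x\<in>carrier (P n i). \<zero>\<^bsub>M\<^esub>) \<in> B n"
  unfolding mem_coboundaries_iff[OF M]
  using linear_map_restrict[OF linear_map_const_zero[OF P_module M]]
  by (auto intro: coboundary_zero[OF M])

lemma self_in_coset:
  assumes "\<phi> \<in> extensional (carrier (P n i))" "\<And>v. v \<in> carrier (P n i) \<Longrightarrow> \<phi> v \<in> carrier M"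
  shows "\<phi> \<in> B n +>\<^bsub>H n\<^esub> \<phi>"
  unfolding mem_coset_coboundaries_iff
  using assms by (intro bexI[OF _ zero_in_coboundaries] extensionalityI[of \<phi> "carrier (P n i)"]) auto

lemma coset_coboundary:
  assumes "b \<in> B n"
  shows "B n +>\<^bsub>H n\<^esub> b = B n"
proof
  have b: "linear_map R (P n i) M b" "coboundary n i M b" "b \<in> extensional (carrier (P n i))"
    using assms unfolding mem_coboundaries_iff[OF M] by auto
  show "B n +>\<^bsub>H n\<^esub> b \<subseteq> B n"
  proof
    fix y assume "y \<in> B n +>\<^bsub>H n\<^esub> b"
    then obtain h where h: "h \<in> B n" "y = (\<lambda>x\<in>carrier (P n i). h x \<oplus>\<^bsub>M\<^esub> b x)"
      unfolding mem_coset_coboundaries_iff by blast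
    have h': "linear_map R (P n i) M h" "coboundary n i M h"
      using h(1) unfolding mem_coboundaries_iff[OF M] by auto
    show "y \<in> B n" unfolding mem_coboundaries_iff[OF M] h(2)
      using linear_map_restrict[OF linear_map_plus[OF P_module M h'(1) b(1)]]
        coboundary_cong[OF coboundary_plus[OF M h'(2) b(2)]] by auto
  qed
  show "B n \<subseteq> B n +>\<^bsub>H n\<^esub> b"
  proof
    fix y assume "y \<in> B n"
    hence y: "linear_map R (P n i) M y" "coboundary n i M y" "y \<in> extensional (carrier (P n i))"
      unfolding mem_coboundaries_iff[OF M] by auto
    let ?h = "\<lambda>x\<in>carrier (P n i). y x \<ominus>\<^bsub>M\<^esub> b x"
    have "?h \<in> B n" unfolding mem_coboundaries_iff[OF M]
      using linear_map_restrict[OF linear_map_diff[OF P_module M y(1) b(1)]]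
        coboundary_cong[OF coboundary_minus[OF M y(2) b(2) linear_mapD(1)[OF b(1)]]] by auto
    moreover have "y = (\<lambda>x\<in>carrier (P n i). ?h x \<oplus>\<^bsub>M\<^esub> b x)"
    proof (rule extensionalityI[OF y(3)])
      fix x assume "x \<in> carrier (P n i)"
      thus "y x = (\<lambda>x\<in>carrier (P n i). ?h x \<oplus>\<^bsub>M\<^esub> b x) x"
        using linear_mapD(1)[OF y(1)] linear_mapD(1)[OF b(1)]
        by (simp add: a_minus_def M.a_assoc M.l_neg)
    qed simp
    ultimately show "y \<in> B n +>\<^bsub>H n\<^esub> b" unfolding mem_coset_coboundaries_iff by blast
  qed
qed

text \<open>\<open>Ext_map\<close> is a union over all representatives of a class. If one of them
  pulls back to a coboundary then all do, and every coset in the union is the zero class; conversely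
  the union contains the pullback of \<open>\<phi>\<close> itself.\<close>

lemma Ext_map_eq_zero_iff:
  assumes "n \<le> m" "\<phi> \<in> Z n"
  shows "tr n m (B n +>\<^bsub>H n\<^esub> \<phi>) = B m \<longleftrightarrow> coboundary m i M (\<lambda>v. \<phi> (lift m n i v))"
proof -
  let ?X = "B n +>\<^bsub>H n\<^esub> \<phi>"
  let ?c = "\<lambda>\<psi>. (\<lambda>v\<in>carrier (P m i). \<psi> (lift m n i v))"
  have \<phi>: "linear_map R (P n i) M \<phi>" "\<phi> \<in> extensional (carrier (P n i))"
    using assms(2) unfolding mem_cocycles_iff cocycle_def by auto
  have tr: "tr n m ?X = (\<Union>\<psi>\<in>?X. B m +>\<^bsub>H m\<^esub> ?c \<psi>)"
    by (simp add: Ext_map_def Let_def lift_def[symmetric] compose_def)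
  have self: "\<phi> \<in> ?X" by (rule self_in_coset) (use \<phi>(2) linear_mapD(1)[OF \<phi>(1)] in auto)
  show ?thesis
  proof
    assume "tr n m ?X = B m"
    moreover have "?c \<phi> \<in> B m +>\<^bsub>H m\<^esub> ?c \<phi>"
      by (rule self_in_coset) (use linear_mapD(1)[OF \<phi>(1)] lift_closed[OF assms(1)] in auto)
    ultimately have "?c \<phi> \<in> B m" using self unfolding tr by blast
    hence "coboundary m i M (?c \<phi>)" unfolding mem_coboundaries_iff[OF M] by blast
    thus "coboundary m i M (\<lambda>v. \<phi> (lift m n i v))" by (rule coboundary_cong) simp
  next
    assume cob: "coboundary m i M (\<lambda>v. \<phi> (lift m n i v))"
    have eq: "B m +>\<^bsub>H m\<^esub> ?c \<psi> = B m" if "\<psi> \<in> ?X" for \<psi>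
    proof (rule coset_coboundary)
      obtain h where h: "h \<in> B n" "\<psi> = (\<lambda>x\<in>carrier (P n i). h x \<oplus>\<^bsub>M\<^esub> \<phi> x)"
        using \<open>\<psi> \<in> ?X\<close> unfolding mem_coset_coboundaries_iff by blast
      have h': "linear_map R (P n i) M h" "coboundary n i M h"
        using h(1) unfolding mem_coboundaries_iff[OF M] by auto
      have "linear_map R (P m i) M (\<lambda>v. h (lift m n i v) \<oplus>\<^bsub>M\<^esub> \<phi> (lift m n i v))"
        by (intro linear_map_plus[OF P_module M] linear_map_comp[OF lift_linear[OF assms(1)]] h' \<phi>)
      moreover have "coboundary m i M (\<lambda>v. h (lift m n i v) \<oplus>\<^bsub>M\<^esub> \<phi> (lift m n i v))"
        by (rule coboundary_plus[OF M coboundary_lift[OF M h'(2) assms(1)] cob])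
      moreover have "?c \<psi> = restrict (\<lambda>v. h (lift m n i v) \<oplus>\<^bsub>M\<^esub> \<phi> (lift m n i v)) (carrier (P m i))"
        unfolding h(2) by (rule restrict_ext) (simp add: lift_closed[OF assms(1)])
      ultimately show "?c \<psi> \<in> B m"
        unfolding mem_coboundaries_iff[OF M] using linear_map_restrict
          coboundary_cong[of m i M _ "restrict (\<lambda>v. h (lift m n i v) \<oplus>\<^bsub>M\<^esub> \<phi> (lift m n i v)) (carrier (P m i))"]
        by auto
    qed
    show "tr n m ?X = B m" unfolding tr by (rule UN_constant_eq[OF self]) (intro ballI eq)
  qed
qed

lemma Ext_map_zero: "n \<le> m \<Longrightarrow> tr n m (B n) = B m"
proof -
  assume nm: "n \<le> m"
  let ?z = "\<lambda>x\<in>carrier (P n i). \<zero>\<^bsub>M\<^esub>"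
  have z: "?z \<in> B n" by (rule zero_in_coboundaries)
  have zZ: "?z \<in> Z n"
    using z cocycle_of_coboundary[OF M] unfolding mem_coboundaries_iff[OF M] mem_cocycles_iff by blast
  have "coboundary m i M (\<lambda>v. ?z (lift m n i v))"
    by (rule coboundary_zero[OF M]) (simp add: lift_closed[OF nm])
  thus ?thesis using Ext_map_eq_zero_iff[OF nm zZ] unfolding coset_coboundary[OF z] by blast
qed

lemma local_cohomology_eq_zero_iff:
  "carrier (local_cohomology R I i M) = {\<zero>\<^bsub>local_cohomology R I i M\<^esub>} \<longleftrightarrow> vanishes i M"
proof -
  let ?A = "SIGMA n:UNIV. carrier (E n)"
  let ?r = "dirlim_rel E tr"
  have car: "carrier (local_cohomology R I i M) = ?A // ?r"
    and zero: "\<zero>\<^bsub>local_cohomology R I i M\<^esub> = ?r `` {(0, B 0)}"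
    by (simp_all add: local_cohomology_def dirlim_def zero_Ext)
  have BE: "B n \<in> carrier (E n)" for n
    unfolding carrier_Ext using coset_coboundary[OF zero_in_coboundaries, of n]
      zero_in_coboundaries[of n] cocycle_of_coboundary[OF M]
    unfolding mem_coboundaries_iff[OF M] mem_cocycles_iff by (metis (mono_tags, lifting) image_eqI mem_Collect_eq mem_cocycles_iff)
  show ?thesis unfolding car zero
  proof
    assume eq: "?A // ?r = {?r `` {(0, B 0)}}"
    show "vanishes i M" unfolding vanishes_def
    proof (intro allI impI)
      fix n \<phi> assume \<phi>: "cocycle n i M \<phi>"
      let ?\<phi> = "restrict \<phi> (carrier (P n i))"
      have Z: "?\<phi> \<in> Z n"
        using \<phi> linear_map_restrict[of n i M \<phi>] d_closed[of _ n i]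
        by (auto simp: mem_cocycles_iff cocycle_def)
      let ?X = "B n +>\<^bsub>H n\<^esub> ?\<phi>"
      have X: "?X \<in> carrier (E n)" unfolding carrier_Ext using Z by blast
      hence "?r `` {(n, ?X)} \<in> ?A // ?r" by (intro quotientI) auto
      hence "?r `` {(n, ?X)} = ?r `` {(0, B 0)}" unfolding eq by (rule singletonD)
      moreover have "(n, ?X) \<in> ?r `` {(n, ?X)}" using X by (auto simp: dirlim_rel_def)
      ultimately have "((0, B 0), (n, ?X)) \<in> ?r" by (simp only: Image_singleton_iff)
      then obtain k where k: "n \<le> k" "tr 0 k (B 0) = tr n k ?X"
        by (auto simp: dirlim_rel_def)
      hence "tr n k ?X = B k" using Ext_map_zero[of 0 k] by simp
      hence "coboundary k i M (\<lambda>v. ?\<phi> (lift k n i v))" using Ext_map_eq_zero_iff[OF k(1) Z] by blast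
      hence "coboundary k i M (\<lambda>v. \<phi> (lift k n i v))"
        by (rule coboundary_cong) (simp add: lift_closed[OF k(1)])
      thus "dies n i M \<phi>" using k(1) by (auto simp: dies_def)
    qed
  next
    assume van: "vanishes i M"
    \<comment> \<open>Under vanishing every class maps to zero at some level, and it stays zero at
      all higher levels by \<open>coboundary_lift_mono\<close>. Hence any two elements become equal
      at a common level: the relation is total and has a single class.\<close>
    have ev: "\<exists>m\<ge>n. \<forall>k\<ge>m. tr n k X = B k" if X: "X \<in> carrier (E n)" for n X
    proof -
      obtain \<phi> where \<phi>: "\<phi> \<in> Z n" "X = B n +>\<^bsub>H n\<^esub> \<phi>" using X unfolding carrier_Ext by blast
      have coc: "cocycle n i M \<phi>" using \<phi>(1) unfolding mem_cocycles_iff by blast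
      then obtain m where m: "m \<ge> n" "coboundary m i M (\<lambda>v. \<phi> (lift m n i v))"
        using van unfolding vanishes_def dies_def by blast
      have "tr n k X = B k" if "k \<ge> m" for k
        using Ext_map_eq_zero_iff[of n k, OF _ \<phi>(1)] coboundary_lift_mono[OF M coc m(1) that m(2)]
          m(1) that unfolding \<phi>(2) by simp
      thus ?thesis using m(1) by blast
    qed
    have rel: "((n, X), (m, Y)) \<in> ?r" if X: "X \<in> carrier (E n)" and Y: "Y \<in> carrier (E m)" for n X m Y
    proof -
      obtain k l where "k \<ge> n" "\<forall>j\<ge>k. tr n j X = B j" "l \<ge> m" "\<forall>j\<ge>l. tr m j Y = B j"
        using ev[OF X] ev[OF Y] by blast
      thus ?thesis using X Y unfolding dirlim_rel_def
        by (auto intro!: exI[of _ "max k l"])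
    qed
    have "?r `` {p} = ?A" if "p \<in> ?A" for p
      using that rel by (auto simp: dirlim_rel_def)
    moreover have "(0, B 0) \<in> ?A" using BE by auto
    ultimately show "?A // ?r = {?r `` {(0, B 0)}}" unfolding quotient_def by blast
  qed
qed

end

section \<open>Exact sequences\<close>

lemma cocycle_submodule:
  assumes "cocycle n i M \<phi>" "\<And>v. v \<in> carrier (P n i) \<Longrightarrow> \<phi> v \<in> K"
  shows "cocycle n i (M\<lparr>carrier := K\<rparr>) \<phi>"
  using assms by (simp add: cocycle_def linear_map_def)

lemma linear_map_inclusion:
  assumes "module R M" "submodule K R M"
  shows "linear_map R (M\<lparr>carrier := K\<rparr>) M (\<lambda>x. x)"
  using submoduleD(1)[OF assms(2)] by (intro linear_mapI) auto

lemma linear_map_into_submodule: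
  assumes "module R M" "submodule K R M" "linear_map R A (M\<lparr>carrier := K\<rparr>) f"
  shows "linear_map R A M f"
  using linear_map_comp[OF assms(3) linear_map_inclusion[OF assms(1,2)]] .

lemma coboundary_from_submodule:
  assumes "module R M" "submodule K R M" "coboundary n i (M\<lparr>carrier := K\<rparr>) \<phi>"
  shows "coboundary n i M \<phi>"
  using coboundary_map[OF module.submodule_module[OF assms(1,2)] assms(1)
      linear_map_inclusion[OF assms(1,2)] assms(3)] .

text \<open>Exactness of H^i(K) -> H^i(M) -> H^i(N) in the middle, K being the kernel. Once
  \<open>f \<phi>\<close> is a coboundary, a lift of it to a coboundary in M is subtracted from
  \<open>\<phi>\<close>; the rest takes values in K and dies there.\<close>

lemma vanishes_extension:
  assumes "module R M" "module R N" "linear_map R M N f" "f ` carrier M = carrier N"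
    and "vanishes i (M\<lparr>carrier := {x \<in> carrier M. f x = \<zero>\<^bsub>N\<^esub>}\<rparr>)" "vanishes i N"
  shows "vanishes i M"
  unfolding vanishes_def
proof (intro allI impI)
  fix n \<phi> assume \<phi>: "cocycle n i M \<phi>"
  interpret M: module R M by fact
  interpret N: module R N by fact
  note K = submodule_kernel[OF assms(1-3)]
  let ?K = "{x \<in> carrier M. f x = \<zero>\<^bsub>N\<^esub>}"
  obtain m where m: "m \<ge> n" "coboundary m i N (\<lambda>v. f (\<phi> (lift m n i v)))"
    using cocycle_map[OF assms(1-3) \<phi>] assms(6) unfolding vanishes_def dies_def by blast
  obtain \<psi> where \<psi>: "linear_map R (P m i) M \<psi>" "coboundary m i M \<psi>"
    "\<And>v. v \<in> carrier (P m i) \<Longrightarrow> f (\<psi> v) = f (\<phi> (lift m n i v))"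
    using coboundary_surj_lift[OF assms(1-4) m(2)] by blast
  note \<phi>m = cocycle_lift[OF assms(1) \<phi> m(1)]
  let ?\<chi> = "\<lambda>v. \<phi> (lift m n i v) \<ominus>\<^bsub>M\<^esub> \<psi> v"
  have c: "\<phi> (lift m n i v) \<in> carrier M" "\<psi> v \<in> carrier M" if "v \<in> carrier (P m i)" for v
    using \<phi>m \<psi>(1) that by (auto simp: cocycle_def linear_map_def)
  have "cocycle m i M ?\<chi>"
    by (rule cocycle_diff[OF assms(1) \<phi>m cocycle_of_coboundary[OF assms(1) \<psi>(1,2)]])
  moreover have "?\<chi> v \<in> ?K" if v: "v \<in> carrier (P m i)" for v
  proof -
    have "f (?\<chi> v) = \<zero>\<^bsub>N\<^esub>"
      unfolding linear_map_minus[OF assms(1-3) c[OF v]] \<psi>(3)[OF v]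
      using linear_mapD(1)[OF assms(3) c(1)[OF v]] by (simp add: a_minus_def N.r_neg)
    thus ?thesis using c[OF v] by simp
  qed
  ultimately have "cocycle m i (M\<lparr>carrier := ?K\<rparr>) ?\<chi>" by (rule cocycle_submodule)
  then obtain k where k: "k \<ge> m" "coboundary k i (M\<lparr>carrier := ?K\<rparr>) (\<lambda>v. ?\<chi> (lift k m i v))"
    using assms(5) unfolding vanishes_def dies_def by blast
  have "coboundary k i M (\<lambda>v. ?\<chi> (lift k m i v) \<oplus>\<^bsub>M\<^esub> \<psi> (lift k m i v))"
    by (rule coboundary_plus[OF assms(1) coboundary_from_submodule[OF assms(1) K k(2)]
          coboundary_lift[OF assms(1) \<psi>(2) k(1)]])
  hence "coboundary k i M (\<lambda>v. \<phi> (lift m n i (lift k m i v)))"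
    by (rule coboundary_cong)
       (use c[OF lift_closed[OF k(1)]] in \<open>simp add: a_minus_def M.a_assoc M.l_neg\<close>)
  hence "coboundary k i M (\<lambda>v. \<phi> (lift k n i v))"
    by (rule coboundary_lift_trans[OF assms(1) \<phi> m(1) k(1)])
  thus "dies n i M \<phi>" using m(1) k(1) unfolding dies_def by (meson order_trans)
qed

text \<open>Exactness of H^i(M) -> H^i(N) -> H^(i+1)(K) in the middle, K being the kernel. The
  connecting class of \<open>\<phi>\<close> is \<open>g d\<close> for a linear lift \<open>g\<close>
  of \<open>\<phi>\<close> to M; once its pullback is \<open>\<chi> d\<close> with \<chi> valued in
  K, the pulled back \<open>g\<close> minus \<chi> is a cocycle in M lying over the pullback of
  \<open>\<phi>\<close>.\<close>

lemma vanishes_quotient: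
  assumes "module R M" "module R N" "linear_map R M N f" "f ` carrier M = carrier N"
    and "vanishes (Suc i) (M\<lparr>carrier := {x \<in> carrier M. f x = \<zero>\<^bsub>N\<^esub>}\<rparr>)" "vanishes i M"
  shows "vanishes i N"
  unfolding vanishes_def
proof (intro allI impI)
  fix n \<phi> assume \<phi>: "cocycle n i N \<phi>"
  interpret M: module R M by fact
  interpret N: module R N by fact
  note K = submodule_kernel[OF assms(1-3)]
  let ?K = "{x \<in> carrier M. f x = \<zero>\<^bsub>N\<^esub>}"
  have \<phi>lin: "linear_map R (P n i) N \<phi>" using \<phi> by (simp add: cocycle_def)
  obtain g where g: "linear_map R (P n i) M g" "\<And>v. v \<in> carrier (P n i) \<Longrightarrow> f (g v) = \<phi> v"
    using res_module_lift[OF assms(1-3) M.carrier_is_submodule \<phi>lin] assms(4) linear_mapD(1)[OF \<phi>lin]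
    by metis
  have "coboundary n (Suc i) M (\<lambda>v. g (d n i v))" using g(1) by (auto simp: coboundary_def)
  hence "cocycle n (Suc i) M (\<lambda>v. g (d n i v))"
    by (rule cocycle_of_coboundary[OF assms(1) linear_map_comp[OF d_linear g(1)]])
  \<comment> \<open>The values of \<open>g d\<close> are in the kernel since
    \<open>f g = \<phi>\<close> vanishes on boundaries. As a cocycle in the kernel it need not be a
    coboundary, because \<open>g\<close> itself does not take values there.\<close>
  hence "cocycle n (Suc i) (M\<lparr>carrier := ?K\<rparr>) (\<lambda>v. g (d n i v))"
    by (rule cocycle_submodule)
       (use g d_closed[of _ n i] \<phi> linear_mapD(1)[OF g(1)] in \<open>auto simp: cocycle_def\<close>)
  then obtain m where m: "m \<ge> n" "coboundary m (Suc i) (M\<lparr>carrier := ?K\<rparr>) (\<lambda>v. g (d n i (lift m n (Suc i) v)))"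
    using assms(5) unfolding vanishes_def dies_def by blast
  then obtain \<chi> where \<chi>: "linear_map R (P m i) (M\<lparr>carrier := ?K\<rparr>) \<chi>"
    "\<And>v. v \<in> carrier (P m (Suc i)) \<Longrightarrow> g (d n i (lift m n (Suc i) v)) = \<chi> (d m i v)"
    by (auto simp: coboundary_def)
  note \<chi>M = linear_map_into_submodule[OF assms(1) K \<chi>(1)]
  have \<chi>K: "f (\<chi> v) = \<zero>\<^bsub>N\<^esub>" if "v \<in> carrier (P m i)" for v
    using linear_mapD(1)[OF \<chi>(1) that] by simp
  have gl: "linear_map R (P m i) M (\<lambda>v. g (lift m n i v))"
    by (rule linear_map_comp[OF lift_linear[OF m(1)] g(1)])
  let ?\<omega> = "\<lambda>v. g (lift m n i v) \<ominus>\<^bsub>M\<^esub> \<chi> v"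
  have "?\<omega> (d m i v) = \<zero>\<^bsub>M\<^esub>" if v: "v \<in> carrier (P m (Suc i))" for v
    using \<chi>(2)[OF v] lift_diff[OF m(1) v] linear_mapD(1)[OF \<chi>M d_closed[OF v]]
    by (simp add: a_minus_def M.r_neg)
  hence "cocycle m i M ?\<omega>"
    using linear_map_diff[OF P_module assms(1) gl \<chi>M] by (simp add: cocycle_def)
  then obtain k where k: "k \<ge> m" "coboundary k i M (\<lambda>v. ?\<omega> (lift k m i v))"
    using assms(6) unfolding vanishes_def dies_def by blast
  have "coboundary k i N (\<lambda>v. f (?\<omega> (lift k m i v)))"
    by (rule coboundary_map[OF assms(1-3) k(2)])
  hence "coboundary k i N (\<lambda>v. \<phi> (lift m n i (lift k m i v)))"
  proof (rule coboundary_cong)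
    fix v assume "v \<in> carrier (P k i)"
    hence v: "lift k m i v \<in> carrier (P m i)" by (rule lift_closed[OF k(1)])
    have c: "\<phi> (lift m n i (lift k m i v)) \<in> carrier N"
      using linear_mapD(1)[OF \<phi>lin lift_closed[OF m(1) v]] .
    show "\<phi> (lift m n i (lift k m i v)) = f (?\<omega> (lift k m i v))"
      unfolding linear_map_minus[OF assms(1-3) linear_mapD(1)[OF gl v] linear_mapD(1)[OF \<chi>M v]]
        g(2)[OF lift_closed[OF m(1) v]] \<chi>K[OF v] using c N.minus_equality[of "\<zero>\<^bsub>N\<^esub>" "\<zero>\<^bsub>N\<^esub>"]
      by (simp add: a_minus_def)
  qed
  hence "coboundary k i N (\<lambda>v. \<phi> (lift k n i v))"
    by (rule coboundary_lift_trans[OF assms(2) \<phi> m(1) k(1)])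
  thus "dies n i N \<phi>" using m(1) k(1) unfolding dies_def by (meson order_trans)
qed

text \<open>Multiplication by \<open>r\<close> on the resolution of \<open>R/I\<^sup>n\<close> lifts zero, hence is null-homotopic.\<close>

lemma coboundary_scale_Ipow:
  assumes "module R M" "cocycle n i M \<phi>" "r \<in> Ipow n"
  shows "coboundary n i M (\<lambda>v. r \<odot>\<^bsub>M\<^esub> \<phi> v)"
proof -
  have r: "r \<in> carrier R" using assms(3) ideal.Icarr[OF ideal_pow] by blast
  interpret Qn: module R "Q n" by (rule module_Q)
  have id: "linear_map R (P n j) (P n j) (\<lambda>v. v)" for j
  proof -
    interpret Pj: module R "P n j" by (rule P_module)
    show ?thesis by (rule linear_mapI) auto
  qed
  have "coboundary n i M (\<lambda>v. \<phi> (r \<odot>\<^bsub>P n i\<^esub> v))"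
  proof (rule coboundary_null_homotopic[OF assms(1,2), of n "\<lambda>j v. r \<odot>\<^bsub>P n j\<^esub> v"])
    show "linear_map R (P n j) (P n j) (\<lambda>v. r \<odot>\<^bsub>P n j\<^esub> v)" for j
      by (rule linear_map_scale[OF P_module P_module id r])
    show "d n j (r \<odot>\<^bsub>P n (Suc j)\<^esub> v) = r \<odot>\<^bsub>P n j\<^esub> d n j v" if "v \<in> carrier (P n (Suc j))" for j v
      by (rule linear_mapD(3)[OF d_linear r that])
    show "aug n (r \<odot>\<^bsub>P n 0\<^esub> v) = \<zero>\<^bsub>Q n\<^esub>" if v: "v \<in> carrier (P n 0)" for v
    proof -
      obtain y where y: "y \<in> carrier R" "aug n v = Ipow n +> y"
        using linear_mapD(1)[OF resolutionD(1)[OF res] v] unfolding carrier_Q by auto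
      have "aug n (r \<odot>\<^bsub>P n 0\<^esub> v) = r \<odot>\<^bsub>Q n\<^esub> (Ipow n +> y)"
        unfolding linear_mapD(3)[OF resolutionD(1)[OF res] r v] y(2) ..
      also have "\<dots> = Ipow n +> (r \<otimes> y)"
        using linear_mapD(3)[OF linear_map_Q r, of y] y(1) by simp
      also have "\<dots> = \<zero>\<^bsub>Q n\<^esub>"
        using coset_Q_eq_zero[of "r \<otimes> y" n] r y(1) ideal.I_r_closed[OF ideal_pow assms(3) y(1)] by simp
      finally show ?thesis .
    qed
  qed
  thus ?thesis
    by (rule coboundary_cong) (use assms(2) r in \<open>auto simp: cocycle_def linear_mapD(3)\<close>)
qed

text \<open>Here N is M/xM, and H^i(N) -> H^(i+1)(M) -> H^(i+1)(M) is exact, the second map being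
  multiplication by x. So x can be cancelled from a class (\<open>step\<close>), hence also powers
  of x (\<open>pow\<close>), and at level n the power \<open>x^n\<close> lies in
  \<open>I^n\<close>.\<close>

lemma vanishes_of_regular:
  assumes "module R M" "module R N" "linear_map R M N f" "f ` carrier M = carrier N"
    and x: "x \<in> I" and inj: "\<And>y. y \<in> carrier M \<Longrightarrow> x \<odot>\<^bsub>M\<^esub> y = \<zero>\<^bsub>M\<^esub> \<Longrightarrow> y = \<zero>\<^bsub>M\<^esub>"
    and ker: "\<And>y. y \<in> carrier M \<Longrightarrow> f y = \<zero>\<^bsub>N\<^esub> \<longleftrightarrow> y \<in> (\<lambda>z. x \<odot>\<^bsub>M\<^esub> z) ` carrier M"
    and van: "vanishes i N"
  shows "vanishes (Suc i) M"
proof -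
  interpret M: module R M by fact
  interpret N: module R N by fact
  have xR: "x \<in> carrier R" using ideal.Icarr[OF ideal_I x] .
  have idM: "linear_map R M M (\<lambda>y. y)" by (rule linear_mapI) auto
  have xlin: "linear_map R M M (\<lambda>y. x \<odot>\<^bsub>M\<^esub> y)" by (rule linear_map_scale[OF assms(1,1) idM xR])
  have step: "dies n (Suc i) M \<phi>"
    if \<phi>: "cocycle n (Suc i) M \<phi>" and dies: "dies n (Suc i) M (\<lambda>v. x \<odot>\<^bsub>M\<^esub> \<phi> v)" for n \<phi>
  proof -
    have \<phi>lin: "linear_map R (P n (Suc i)) M \<phi>" using \<phi> by (simp add: cocycle_def)
    obtain m \<psi> where m: "m \<ge> n" and \<psi>: "linear_map R (P m i) M \<psi>"
      "\<And>v. v \<in> carrier (P m (Suc i)) \<Longrightarrow> x \<odot>\<^bsub>M\<^esub> \<phi> (lift m n (Suc i) v) = \<psi> (d m i v)"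
      using dies by (auto simp: dies_def coboundary_def)
    have "f (\<psi> (d m i v)) = \<zero>\<^bsub>N\<^esub>" if v: "v \<in> carrier (P m (Suc i))" for v
    proof -
      have "\<phi> (lift m n (Suc i) v) \<in> carrier M" using linear_mapD(1)[OF \<phi>lin lift_closed[OF m v]] .
      hence "f (x \<odot>\<^bsub>M\<^esub> \<phi> (lift m n (Suc i) v)) = \<zero>\<^bsub>N\<^esub>"
        using ker[of "x \<odot>\<^bsub>M\<^esub> \<phi> (lift m n (Suc i) v)"] xR by simp
      thus ?thesis unfolding \<psi>(2)[OF v] .
    qed
    \<comment> \<open>A cochain bounding the multiple of \<open>\<phi>\<close> by x takes multiples
      of x on boundaries, so it is a cocycle modulo x; this is where the vanishing for N
      enters.\<close>
    hence "cocycle m i N (\<lambda>v. f (\<psi> v))"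
      using linear_map_comp[OF \<psi>(1) assms(3)] by (simp add: cocycle_def)
    then obtain k where k: "k \<ge> m" "coboundary k i N (\<lambda>v. f (\<psi> (lift k m i v)))"
      using van unfolding vanishes_def dies_def by blast
    obtain \<chi> where \<chi>: "linear_map R (P k i) M \<chi>" "coboundary k i M \<chi>"
      "\<And>v. v \<in> carrier (P k i) \<Longrightarrow> f (\<chi> v) = f (\<psi> (lift k m i v))"
      using coboundary_surj_lift[OF assms(1-4) k(2)] by blast
    have \<chi>d: "\<chi> (d k i v) = \<zero>\<^bsub>M\<^esub>" if "v \<in> carrier (P k (Suc i))" for v
      using cocycle_of_coboundary[OF assms(1) \<chi>(1,2)] that by (simp add: cocycle_def)
    let ?\<rho> = "\<lambda>v. \<psi> (lift k m i v) \<ominus>\<^bsub>M\<^esub> \<chi> v"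
    have \<psi>l: "linear_map R (P k i) M (\<lambda>v. \<psi> (lift k m i v))"
      by (rule linear_map_comp[OF lift_linear[OF k(1)] \<psi>(1)])
    have \<rho>: "linear_map R (P k i) M ?\<rho>" by (rule linear_map_diff[OF P_module assms(1) \<psi>l \<chi>(1)])
    have "?\<rho> v \<in> (\<lambda>z. x \<odot>\<^bsub>M\<^esub> z) ` carrier M" if v: "v \<in> carrier (P k i)" for v
    proof -
      have "f (?\<rho> v) = \<zero>\<^bsub>N\<^esub>"
        unfolding linear_map_minus[OF assms(1-3) linear_mapD(1)[OF \<psi>l v] linear_mapD(1)[OF \<chi>(1) v]]
          \<chi>(3)[OF v]
        using linear_mapD(1)[OF assms(3) linear_mapD(1)[OF \<psi>l v]] by (simp add: a_minus_def N.r_neg)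
      thus ?thesis using ker[OF linear_mapD(1)[OF \<rho> v]] by blast
    qed
    \<comment> \<open>After correction by the cocycle \<chi> the bounding cochain is divisible by x,
      and x cancels because it is regular on M.\<close>
    then obtain \<omega> where \<omega>: "linear_map R (P k i) M \<omega>"
      "\<And>v. v \<in> carrier (P k i) \<Longrightarrow> x \<odot>\<^bsub>M\<^esub> \<omega> v = ?\<rho> v"
      using res_module_lift[OF assms(1,1) xlin M.carrier_is_submodule \<rho>] by metis
    have "\<phi> (lift m n (Suc i) (lift k m (Suc i) v)) = \<omega> (d k i v)" if v: "v \<in> carrier (P k (Suc i))" for v
    proof -
      note lv = lift_closed[OF k(1) v] and dv = d_closed[OF v]
      have c: "\<phi> (lift m n (Suc i) (lift k m (Suc i) v)) \<in> carrier M" "\<omega> (d k i v) \<in> carrier M"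
        "\<psi> (lift k m i (d k i v)) \<in> carrier M"
        using linear_mapD(1)[OF \<phi>lin lift_closed[OF m lv]] linear_mapD(1)[OF \<omega>(1) dv]
          linear_mapD(1)[OF \<psi>l dv] by auto
      have "x \<odot>\<^bsub>M\<^esub> \<phi> (lift m n (Suc i) (lift k m (Suc i) v)) = \<psi> (lift k m i (d k i v))"
        using \<psi>(2)[OF lv] lift_diff[OF k(1) v] by simp
      moreover have "x \<odot>\<^bsub>M\<^esub> \<omega> (d k i v) = \<psi> (lift k m i (d k i v))"
        using \<omega>(2)[OF dv] \<chi>d[OF v] c M.minus_equality[of "\<zero>\<^bsub>M\<^esub>" "\<zero>\<^bsub>M\<^esub>"] by (simp add: a_minus_def)
      ultimately have "x \<odot>\<^bsub>M\<^esub> (\<phi> (lift m n (Suc i) (lift k m (Suc i) v)) \<ominus>\<^bsub>M\<^esub> \<omega> (d k i v)) = \<zero>\<^bsub>M\<^esub>"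
        using linear_map_minus[OF assms(1,1) xlin c(1,2)] c by (simp add: a_minus_def M.r_neg)
      hence "\<phi> (lift m n (Suc i) (lift k m (Suc i) v)) \<ominus>\<^bsub>M\<^esub> \<omega> (d k i v) = \<zero>\<^bsub>M\<^esub>"
        using inj c by simp
      thus ?thesis using c by (metis M.minus_closed M.l_zero M.a_assoc M.l_neg M.r_zero M.a_inv_closed a_minus_def)
    qed
    hence "coboundary k (Suc i) M (\<lambda>v. \<phi> (lift m n (Suc i) (lift k m (Suc i) v)))"
      using \<omega>(1) by (auto simp: coboundary_def)
    hence "coboundary k (Suc i) M (\<lambda>v. \<phi> (lift k n (Suc i) v))"
      by (rule coboundary_lift_trans[OF assms(1) \<phi> m k(1)])
    thus ?thesis using m k(1) unfolding dies_def by (meson order_trans)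
  qed
  have pow: "dies n (Suc i) M \<phi>"
    if "cocycle n (Suc i) M \<phi>" "dies n (Suc i) M (\<lambda>v. x [^] (e::nat) \<odot>\<^bsub>M\<^esub> \<phi> v)" for n \<phi> e
    using that
  proof (induction e)
    case 0
    have \<phi>lin: "linear_map R (P n (Suc i)) M \<phi>" using 0 by (simp add: cocycle_def)
    obtain m where m: "m \<ge> n" "coboundary m (Suc i) M (\<lambda>v. x [^] (0::nat) \<odot>\<^bsub>M\<^esub> \<phi> (lift m n (Suc i) v))"
      using 0(2) unfolding dies_def by blast
    have "coboundary m (Suc i) M (\<lambda>v. \<phi> (lift m n (Suc i) v))"
      by (rule coboundary_cong[OF m(2)]) (simp add: linear_mapD(1)[OF \<phi>lin lift_closed[OF m(1)]])
    thus ?case using m(1) unfolding dies_def by blast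
  next
    case (Suc e)
    have \<phi>lin: "linear_map R (P n (Suc i)) M \<phi>" using Suc by (simp add: cocycle_def)
    let ?\<psi> = "\<lambda>v. x [^] e \<odot>\<^bsub>M\<^esub> \<phi> v"
    have elin: "linear_map R M M (\<lambda>y. x [^] e \<odot>\<^bsub>M\<^esub> y)"
      by (rule linear_map_scale[OF assms(1,1) idM]) (simp add: xR)
    obtain m where m: "m \<ge> n" "coboundary m (Suc i) M (\<lambda>v. x [^] Suc e \<odot>\<^bsub>M\<^esub> \<phi> (lift m n (Suc i) v))"
      using Suc.prems(2) unfolding dies_def by blast
    have "x \<odot>\<^bsub>M\<^esub> ?\<psi> (lift m n (Suc i) v) = x [^] Suc e \<odot>\<^bsub>M\<^esub> \<phi> (lift m n (Suc i) v)"
      if "v \<in> carrier (P m (Suc i))" for v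
      using linear_mapD(1)[OF \<phi>lin lift_closed[OF m(1) that]] xR
      by (simp add: M.smult_assoc1[symmetric] m_comm)
    hence "coboundary m (Suc i) M (\<lambda>v. x \<odot>\<^bsub>M\<^esub> ?\<psi> (lift m n (Suc i) v))"
      by (rule coboundary_cong[OF m(2)])
    hence "dies n (Suc i) M (\<lambda>v. x \<odot>\<^bsub>M\<^esub> ?\<psi> v)" using m(1) unfolding dies_def by blast
    hence "dies n (Suc i) M ?\<psi>" by (rule step[OF cocycle_map[OF assms(1,1) elin Suc.prems(1)]])
    thus ?case using Suc by blast
  qed
  show ?thesis unfolding vanishes_def
  proof (intro allI impI)
    fix n \<phi> assume \<phi>: "cocycle n (Suc i) M \<phi>"
    have "coboundary n (Suc i) M (\<lambda>v. x [^] n \<odot>\<^bsub>M\<^esub> \<phi> v)"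
      by (rule coboundary_scale_Ipow[OF assms(1) \<phi> pow_mem_Ipow[OF x]])
    \<comment> \<open>\<open>lift n n\<close> is a chosen map and not literally the identity, so
      even level n needs a pullback.\<close>
    from coboundary_lift[OF assms(1) this order_refl]
    have "dies n (Suc i) M (\<lambda>v. x [^] n \<odot>\<^bsub>M\<^esub> \<phi> v)" unfolding dies_def by blast
    thus "dies n (Suc i) M \<phi>" by (rule pow[OF \<phi>])
  qed
qed

section \<open>The Artin--Rees property\<close>

lemma ideal_of_submodule: "submodule J R (regular_module R) \<Longrightarrow> ideal J R"
  using submoduleD[of J R "regular_module R"]
  by (intro module.idealI'[OF module_regular_module]) auto

text \<open>A maximal counterexample D is not prime, as otherwise it would contain I, the first
  power. So uv lies in D for some u and v outside D; both D + Ru and D + Rv contain a power of I,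
  and the product of these powers lies in D. This replaces an expansion of powers in terms of
  generators of I.\<close>

lemma Ipow_subset_of_radical:
  assumes "ideal C R" "\<And>y. y \<in> I \<Longrightarrow> \<exists>j::nat. y [^] j \<in> C"
  shows "\<exists>k. Ipow k \<subseteq> C"
proof (rule ccontr)
  assume no: "\<nexists>k. Ipow k \<subseteq> C"
  let ?P = "\<lambda>C. (\<forall>y\<in>I. \<exists>j::nat. y [^] j \<in> C) \<and> (\<nexists>k. Ipow k \<subseteq> C)"
  obtain D where D: "ideal D R" "?P D" "\<And>J. ideal J R \<Longrightarrow> ?P J \<Longrightarrow> D \<subseteq> J \<Longrightarrow> J = D"
    using maximal_ideal_with[OF assms(1), of ?P] assms(2) no by blast
  interpret D: ideal D R by (rule D(1))
  interpret r: module R "regular_module R" by (rule module_regular_module)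
  have ne: "carrier R \<noteq> D"
  proof
    assume "carrier R = D"
    hence "Ipow 0 \<subseteq> D" unfolding Ipow_0 by blast
    thus False using D(2) by blast
  qed
  have "\<not> primeideal D R"
  proof
    assume "primeideal D R"
    then interpret pD: primeideal D R .
    have pow: "y \<in> D" if y: "y \<in> carrier R" "y [^] (j::nat) \<in> D" for y j
      using y(2)
    proof (induction j)
      case 0
      hence "\<one> \<in> D" by simp
      thus ?case using D.one_imp_carrier ne by simp
    next
      case (Suc j)
      thus ?case using y(1) pD.I_prime[of "y [^] j" y] by auto
    qed
    have "I \<subseteq> D" using D(2) pow ideal.Icarr[OF ideal_I] by blast
    thus False using D(2) Ipow_1 by metis
  qed
  then obtain u v where uv: "u \<in> carrier R" "v \<in> carrier R" "u \<otimes> v \<in> D" "u \<notin> D" "v \<notin> D"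
    using primeidealI[OF D(1) cring_axioms ne] by blast
  have step: "\<exists>k. Ipow k \<subseteq> adjoin R (regular_module R) D w" if w: "w \<in> carrier R" "w \<notin> D" for w
  proof (rule ccontr)
    assume no: "\<nexists>k. Ipow k \<subseteq> adjoin R (regular_module R) D w"
    have a: "D \<subseteq> adjoin R (regular_module R) D w" "w \<in> adjoin R (regular_module R) D w"
      using r.adjoin_incl[OF submodule_ideal[OF D(1)], of w] w by auto
    have "ideal (adjoin R (regular_module R) D w) R"
      using ideal_of_submodule r.submodule_adjoin[OF submodule_ideal[OF D(1)], of w] w by simp
    thus False using D(3)[of "adjoin R (regular_module R) D w"] a no D(2) w(2) by blast
  qed
  obtain k where k: "Ipow k \<subseteq> adjoin R (regular_module R) D u" using step[OF uv(1,4)] by (rule exE)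
  obtain l where l: "Ipow l \<subseteq> adjoin R (regular_module R) D v" using step[OF uv(2,5)] by (rule exE)
  have "z \<in> D" if "z \<in> ideal_prod R (Ipow k) (Ipow l)" for z
    using that
  proof (induction rule: ideal_prod.induct)
    case (prod i j)
    then obtain s r s' r' where *: "i = s \<oplus> r \<otimes> u" "s \<in> D" "r \<in> carrier R"
      "j = s' \<oplus> r' \<otimes> v" "s' \<in> D" "r' \<in> carrier R"
      using subsetD[OF k prod(1)] subsetD[OF l prod(2)] by (auto simp: adjoin_def)
    have car: "s \<in> carrier R" "s' \<in> carrier R" using * D.Icarr by auto
    have "i \<otimes> j = s \<otimes> j \<oplus> ((r \<otimes> u) \<otimes> s' \<oplus> (r \<otimes> r') \<otimes> (u \<otimes> v))"
      using * car uv by (simp add: l_distr r_distr m_ac)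
    moreover have "j \<in> carrier R" using * car uv by simp
    ultimately show ?case
      using * car uv D.I_r_closed[of s j] D.I_l_closed[of s' "r \<otimes> u"] D.I_l_closed[of "u \<otimes> v" "r \<otimes> r'"]
      by (simp add: D.a_closed)
  next
    case (sum s1 s2)
    thus ?case by (simp add: D.a_closed)
  qed
  hence "Ipow (k + l) \<subseteq> D" unfolding Ipow_add by blast
  thus False using D(2) by blast
qed

text \<open>The submodule \<open>I^k N\<close>; \<open>generated\<close> supplies the sums of
  products.\<close>

definition scaled :: "nat \<Rightarrow> ('a, 'b, 'k) module_scheme \<Rightarrow> 'b set \<Rightarrow> 'b set" where
  "scaled k M N = generated R M {r \<odot>\<^bsub>M\<^esub> x | r x. r \<in> Ipow k \<and> x \<in> N}"

lemma Ipow_carrier: "r \<in> Ipow k \<Longrightarrow> r \<in> carrier R"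
  by (rule ideal.Icarr[OF ideal_pow])

lemma scaled_submodule:
  assumes "module R M" "N \<subseteq> carrier M"
  shows "submodule (scaled k M N) R M"
proof -
  interpret M: module R M by fact
  show ?thesis unfolding scaled_def
    by (rule M.generated_submodule) (use assms(2) Ipow_carrier in auto)
qed

lemma scaled_mem: "module R M \<Longrightarrow> r \<in> Ipow k \<Longrightarrow> x \<in> N \<Longrightarrow> r \<odot>\<^bsub>M\<^esub> x \<in> scaled k M N"
  unfolding scaled_def by (rule subsetD[OF module.generated_incl]) blast+

lemma scaled_least:
  assumes "module R M" "submodule K R M" "\<And>r x. r \<in> Ipow k \<Longrightarrow> x \<in> N \<Longrightarrow> r \<odot>\<^bsub>M\<^esub> x \<in> K"
  shows "scaled k M N \<subseteq> K"
  unfolding scaled_def by (rule module.generated_least[OF assms(1,2)]) (use assms(3) in auto)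

text \<open>If \<open>U\<close> is maximal among the submodules that contain \<open>I\<^sup>NW\<close> and meet \<open>W\<close> inside it,
  then every element of \<open>I\<close> acts nilpotently on \<open>M/U\<close>.\<close>

lemma artin_rees:
  assumes "module R M" "fin_gen_module R M" "submodule W R M"
  shows "\<exists>k. scaled k M (carrier M) \<inter> W \<subseteq> scaled N M W"
proof -
  interpret M: module R M by fact
  note W = submoduleD[OF assms(3)]
  let ?V = "scaled N M W"
  note V = scaled_submodule[OF assms(1) W(1), of N]
  let ?P = "\<lambda>U. ?V \<subseteq> U \<and> U \<inter> W \<subseteq> ?V"
  have PV: "?P ?V" by blast
  obtain U where U0: "submodule U R M" "?P U"
    and U4: "\<And>U'. submodule U' R M \<Longrightarrow> ?P U' \<Longrightarrow> U \<subseteq> U' \<Longrightarrow> U' = U"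
    by (rule maximal_submodule[where P = ?P, OF assms(1,2) V PV]) (rule that)
  from U0 have U: "submodule U R M" "?V \<subseteq> U" "U \<inter> W \<subseteq> ?V" by auto
  note US = submoduleD[OF U(1)]
  have nil: "\<exists>j::nat. y [^] j \<in> colon R M U (carrier M)" if y: "y \<in> I" for y
  proof -
    have yR: "y [^] (j::nat) \<in> carrier R" for j using ideal.Icarr[OF ideal_I y] by simp
    have yR1: "y \<in> carrier R" using ideal.Icarr[OF ideal_I y] .
    \<comment> \<open>For fixed y these submodules ascend, so they are stationary from some j on.
      With this j, adjoining \<open>y^j e\<close> to U creates no element of W outside
      \<open>?V\<close>, and maximality of U forces \<open>y^j e\<close> into U.\<close>
    let ?K = "\<lambda>j::nat. {e \<in> carrier M. y [^] j \<odot>\<^bsub>M\<^esub> e \<in> U}"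
    have sub: "submodule (?K j) R M" for j
    proof (rule M.submoduleI')
      show "r \<odot>\<^bsub>M\<^esub> e \<in> ?K j" if "r \<in> carrier R" "e \<in> ?K j" for r e
      proof -
        have "y [^] j \<odot>\<^bsub>M\<^esub> (r \<odot>\<^bsub>M\<^esub> e) = r \<odot>\<^bsub>M\<^esub> (y [^] j \<odot>\<^bsub>M\<^esub> e)"
          using that yR by (simp add: M.smult_assoc1[symmetric] m_comm)
        thus ?thesis using that US(4) by simp
      qed
    qed (use US(2,3) yR in \<open>auto simp: M.smult_r_distr\<close>)
    have inc: "?K j \<subseteq> ?K (Suc j)" for j
    proof
      fix e assume e: "e \<in> ?K j"
      have "y [^] Suc j \<odot>\<^bsub>M\<^esub> e = y \<odot>\<^bsub>M\<^esub> (y [^] j \<odot>\<^bsub>M\<^esub> e)"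
        using e yR1 yR[of j] by (simp add: M.smult_assoc1[symmetric] m_comm)
      thus "e \<in> ?K (Suc j)" using e US(4)[OF yR1] by simp
    qed
    obtain j where j: "\<And>n. n \<ge> j \<Longrightarrow> ?K n = ?K j"
      using ascending_submodules_stabilize[where N = ?K, OF assms(1,2) sub inc] by blast
    have "y [^] j \<odot>\<^bsub>M\<^esub> e \<in> U" if e: "e \<in> carrier M" for e
    proof -
      let ?x = "y [^] j \<odot>\<^bsub>M\<^esub> e"
      have x: "?x \<in> carrier M" using e yR by simp
      have "adjoin R M U ?x \<inter> W \<subseteq> ?V"
      proof
        fix w assume w: "w \<in> adjoin R M U ?x \<inter> W"
        then obtain u r where ur: "w = u \<oplus>\<^bsub>M\<^esub> r \<odot>\<^bsub>M\<^esub> ?x" "u \<in> U" "r \<in> carrier R"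
          unfolding adjoin_def by blast
        have u: "u \<in> carrier M" using ur(2) US(1) by blast
        have rx: "r \<odot>\<^bsub>M\<^esub> ?x = y [^] j \<odot>\<^bsub>M\<^esub> (r \<odot>\<^bsub>M\<^esub> e)"
          using ur(3) e yR by (simp add: M.smult_assoc1[symmetric] m_comm)
        \<comment> \<open>Since w lies in W, multiplication by \<open>y^N\<close> brings it into
          \<open>I^N W\<close>, hence into U. Removing the part coming from u shows that
          \<open>y^(N + j)\<close> sends \<open>r e\<close> into U, and by the choice of j already
          \<open>y^j\<close> does.\<close>
        have "y [^] N \<odot>\<^bsub>M\<^esub> w \<in> U"
          using scaled_mem[OF assms(1) pow_mem_Ipow[OF y, of N], of w W] w U(2) by blast
        moreover have "y [^] N \<odot>\<^bsub>M\<^esub> u \<in> U" using US(4)[OF yR ur(2)] .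
        ultimately have "y [^] N \<odot>\<^bsub>M\<^esub> w \<ominus>\<^bsub>M\<^esub> y [^] N \<odot>\<^bsub>M\<^esub> u \<in> U" by (rule US(6))
        moreover have "y [^] N \<odot>\<^bsub>M\<^esub> w \<ominus>\<^bsub>M\<^esub> y [^] N \<odot>\<^bsub>M\<^esub> u = y [^] (N + j) \<odot>\<^bsub>M\<^esub> (r \<odot>\<^bsub>M\<^esub> e)"
        proof -
          have "y [^] N \<odot>\<^bsub>M\<^esub> w = y [^] N \<odot>\<^bsub>M\<^esub> u \<oplus>\<^bsub>M\<^esub> y [^] N \<odot>\<^bsub>M\<^esub> (y [^] j \<odot>\<^bsub>M\<^esub> (r \<odot>\<^bsub>M\<^esub> e))"
            unfolding ur(1) rx using u ur(3) e yR by (simp add: M.smult_r_distr)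
          moreover have "y [^] N \<odot>\<^bsub>M\<^esub> (y [^] j \<odot>\<^bsub>M\<^esub> (r \<odot>\<^bsub>M\<^esub> e)) = y [^] (N + j) \<odot>\<^bsub>M\<^esub> (r \<odot>\<^bsub>M\<^esub> e)"
            using M.smult_assoc1[OF yR[of N] yR[of j], of "r \<odot>\<^bsub>M\<^esub> e"] nat_pow_mult[OF yR1, of N j] ur(3) e by simp
          moreover have "(a \<oplus>\<^bsub>M\<^esub> b) \<ominus>\<^bsub>M\<^esub> a = b" if "a \<in> carrier M" "b \<in> carrier M" for a b
            using that by (simp add: a_minus_def M.a_comm[of a] M.a_assoc M.r_neg)
          ultimately show ?thesis using u ur(3) e yR[of N] yR[of "N + j"] by simp
        qed
        ultimately have "r \<odot>\<^bsub>M\<^esub> e \<in> ?K (N + j)" using ur(3) e by simp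
        hence "r \<odot>\<^bsub>M\<^esub> e \<in> ?K j" unfolding j[OF le_add2[of j N]] .
        hence "w \<in> U" using ur(2) US(3) unfolding ur(1) rx by simp
        thus "w \<in> ?V" using w U(3) by blast
      qed
      hence "adjoin R M U ?x = U"
        using U4[OF M.submodule_adjoin[OF U(1) x]] M.adjoin_incl[OF U(1) x] U(2) by blast
      thus ?thesis using M.adjoin_incl(2)[OF U(1) x] by simp
    qed
    thus ?thesis using yR unfolding colon_def by blast
  qed
  \<comment> \<open>Passing from powers of single elements to a power of I places
    \<open>I^k M\<close> inside U, whose intersection with W lies in \<open>?V\<close>.\<close>
  obtain k where k: "Ipow k \<subseteq> colon R M U (carrier M)"
    using Ipow_subset_of_radical[OF M.colon_ideal[OF U(1) order_refl] nil] by blast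
  have "scaled k M (carrier M) \<subseteq> U"
    by (rule scaled_least[OF assms(1) U(1)]) (use k in \<open>auto simp: colon_def\<close>)
  thus ?thesis using U(3) by blast
qed

section \<open>Vanishing for modules annihilated by the ideal\<close>

text \<open>In degree \<open>j\<close>, the transition map from \<open>R/I\<^sup>m\<close> to \<open>R/I\<^sup>n\<close> is homotopic to a map \<open>\<beta>\<close> that sends
  boundaries to boundaries of elements of \<open>I\<^sup>kP\<close>. By the Artin--Rees lemma, this property passes from
  one degree to the next at the cost of increasing \<open>k\<close>.\<close>

definition small_lift ::
    "nat \<Rightarrow> nat \<Rightarrow> nat \<Rightarrow> nat \<Rightarrow> ((nat \<Rightarrow> 'a) \<Rightarrow> (nat \<Rightarrow> 'a)) \<Rightarrow> ((nat \<Rightarrow> 'a) \<Rightarrow> (nat \<Rightarrow> 'a))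
      \<Rightarrow> ((nat \<Rightarrow> 'a) \<Rightarrow> (nat \<Rightarrow> 'a)) \<Rightarrow> bool" where
  "small_lift j n m k \<beta> s s' \<longleftrightarrow>
     linear_map R (P m j) (P n j) \<beta> \<and> linear_map R (P m j) (P n (Suc j)) s \<and>
     linear_map R (P m j) (P n j) s' \<and>
     (\<forall>v\<in>carrier (P m j). lift m n j v = \<beta> v \<oplus>\<^bsub>P n j\<^esub> (d n j (s v) \<oplus>\<^bsub>P n j\<^esub> s' v)) \<and>
     (\<forall>w\<in>carrier (P m (Suc j)). s' (d m j w) = \<zero>\<^bsub>P n j\<^esub> \<and>
        \<beta> (d m j w) \<in> d n j ` scaled k (P n (Suc j)) (carrier (P n (Suc j))))"

text \<open>Freeness lifts \<open>\<beta> d\<close> to a map \<open>\<beta>'\<close> valued in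
  \<open>I^k P\<close>. The difference of the transition map and \<open>\<beta>' + s d\<close> then
  takes cycles as values: its differential is \<open>s' d\<close>, which vanishes. Exactness gives
  t, the homotopy in the next degree.\<close>

lemma small_lift_step:
  assumes "n \<le> m" "small_lift j n m k \<beta> s s'"
  obtains \<beta>' t where "linear_map R (P m (Suc j)) (P n (Suc j)) \<beta>'"
    "linear_map R (P m (Suc j)) (P n (Suc (Suc j))) t"
    "\<And>v. v \<in> carrier (P m (Suc j)) \<Longrightarrow> \<beta>' v \<in> scaled k (P n (Suc j)) (carrier (P n (Suc j)))"
    "\<And>v. v \<in> carrier (P m (Suc j)) \<Longrightarrow> d n j (\<beta>' v) = \<beta> (d m j v)"
    "\<And>v. v \<in> carrier (P m (Suc j)) \<Longrightarrow> lift m n (Suc j) v =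
        \<beta>' v \<oplus>\<^bsub>P n (Suc j)\<^esub> (d n (Suc j) (t v) \<oplus>\<^bsub>P n (Suc j)\<^esub> s (d m j v))"
proof -
  interpret P0: module R "P n j" by (rule P_module)
  interpret P1: module R "P n (Suc j)" by (rule P_module)
  interpret P2: module R "P n (Suc (Suc j))" by (rule P_module)
  have \<beta>: "linear_map R (P m j) (P n j) \<beta>" and s: "linear_map R (P m j) (P n (Suc j)) s"
    and eq: "\<And>v. v \<in> carrier (P m j) \<Longrightarrow> lift m n j v = \<beta> v \<oplus>\<^bsub>P n j\<^esub> (d n j (s v) \<oplus>\<^bsub>P n j\<^esub> s' v)"
    and s'd: "\<And>w. w \<in> carrier (P m (Suc j)) \<Longrightarrow> s' (d m j w) = \<zero>\<^bsub>P n j\<^esub>"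
    and \<beta>d: "\<And>w. w \<in> carrier (P m (Suc j)) \<Longrightarrow>
        \<beta> (d m j w) \<in> d n j ` scaled k (P n (Suc j)) (carrier (P n (Suc j)))"
    using assms(2) unfolding small_lift_def by blast+
  obtain \<beta>' where \<beta>': "linear_map R (P m (Suc j)) (P n (Suc j)) \<beta>'"
    "\<And>v. v \<in> carrier (P m (Suc j)) \<Longrightarrow> \<beta>' v \<in> scaled k (P n (Suc j)) (carrier (P n (Suc j)))"
    "\<And>v. v \<in> carrier (P m (Suc j)) \<Longrightarrow> d n j (\<beta>' v) = \<beta> (d m j v)"
    using res_module_lift[OF P_module P_module d_linear scaled_submodule[OF P_module order_refl]
        linear_map_comp[OF d_linear \<beta>] \<beta>d] by metis
  have sd: "linear_map R (P m (Suc j)) (P n (Suc j)) (\<lambda>v. s (d m j v))"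
    by (rule linear_map_comp[OF d_linear s])
  let ?b = "\<lambda>v. \<beta>' v \<oplus>\<^bsub>P n (Suc j)\<^esub> s (d m j v)"
  have b: "linear_map R (P m (Suc j)) (P n (Suc j)) ?b"
    by (rule linear_map_plus[OF P_module P_module \<beta>'(1) sd])
  let ?\<delta> = "\<lambda>v. lift m n (Suc j) v \<ominus>\<^bsub>P n (Suc j)\<^esub> ?b v"
  have \<delta>: "linear_map R (P m (Suc j)) (P n (Suc j)) ?\<delta>"
    by (rule linear_map_diff[OF P_module P_module lift_linear[OF assms(1)] b])
  have "?\<delta> v \<in> d n (Suc j) ` carrier (P n (Suc (Suc j)))" if v: "v \<in> carrier (P m (Suc j))" for v
  proof -
    note dv = d_closed[OF v]
    note c = linear_mapD(1)[OF \<beta>'(1) v] linear_mapD(1)[OF sd v]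
    have db: "d n j (?b v) = \<beta> (d m j v) \<oplus>\<^bsub>P n j\<^esub> d n j (s (d m j v))"
      unfolding linear_mapD(2)[OF d_linear c] \<beta>'(3)[OF v] ..
    have "d n j (lift m n (Suc j) v) = \<beta> (d m j v) \<oplus>\<^bsub>P n j\<^esub> d n j (s (d m j v))"
      unfolding lift_diff[OF assms(1) v] eq[OF dv] s'd[OF v]
      using linear_mapD(1)[OF \<beta> dv] d_closed[OF linear_mapD(1)[OF s dv]] by simp
    hence "d n j (?\<delta> v) = \<zero>\<^bsub>P n j\<^esub>"
      unfolding linear_map_minus[OF P_module P_module d_linear lift_closed[OF assms(1) v] linear_mapD(1)[OF b v]]
      using db d_closed[OF linear_mapD(1)[OF b v]] by (simp add: a_minus_def P0.r_neg)
    thus ?thesis using resolutionD(5)[OF res linear_mapD(1)[OF \<delta> v]] by blast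
  qed
  then obtain t where t: "linear_map R (P m (Suc j)) (P n (Suc (Suc j))) t"
    "\<And>v. v \<in> carrier (P m (Suc j)) \<Longrightarrow> d n (Suc j) (t v) = ?\<delta> v"
    using res_module_lift[OF P_module P_module d_linear P2.carrier_is_submodule \<delta>] by metis
  have "lift m n (Suc j) v = \<beta>' v \<oplus>\<^bsub>P n (Suc j)\<^esub> (d n (Suc j) (t v) \<oplus>\<^bsub>P n (Suc j)\<^esub> s (d m j v))"
    if v: "v \<in> carrier (P m (Suc j))" for v
  proof -
    note c = linear_mapD(1)[OF \<beta>'(1) v] linear_mapD(1)[OF sd v] lift_closed[OF assms(1) v]
    define L where "L = lift m n (Suc j) v"
    define x where "x = \<beta>' v"
    define y where "y = s (d m j v)"
    have car: "L \<in> carrier (P n (Suc j))" "x \<in> carrier (P n (Suc j))" "y \<in> carrier (P n (Suc j))"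
      using c by (auto simp: L_def x_def y_def)
    have "x \<oplus>\<^bsub>P n (Suc j)\<^esub> ((L \<ominus>\<^bsub>P n (Suc j)\<^esub> (x \<oplus>\<^bsub>P n (Suc j)\<^esub> y)) \<oplus>\<^bsub>P n (Suc j)\<^esub> y)
        = (L \<ominus>\<^bsub>P n (Suc j)\<^esub> (x \<oplus>\<^bsub>P n (Suc j)\<^esub> y)) \<oplus>\<^bsub>P n (Suc j)\<^esub> (x \<oplus>\<^bsub>P n (Suc j)\<^esub> y)"
      using car by (simp add: P1.a_lcomm)
    also have "\<dots> = L" using car by (simp add: a_minus_def P1.a_assoc P1.l_neg)
    finally show ?thesis unfolding t(2)[OF v] L_def x_def y_def by simp
  qed
  thus thesis using that \<beta>' t(1) by blast
qed

text \<open>Take m = k + n, let e lie over 1 in \<open>R/I^n\<close> and let \<rho> lift the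
  augmentation at level m to R; \<beta> sends v to \<open>\<rho> v\<close> times e. On boundaries
  \<rho> takes values in \<open>I^k I^n\<close>, and \<open>I^n e\<close> consists of boundaries, so
  \<open>I^k I^n e\<close> lies in \<open>d (I^k P)\<close>.\<close>

lemma small_lift_0: "\<exists>m\<ge>n. \<exists>\<beta> s s'. small_lift 0 n m k \<beta> s s'"
proof -
  define m where "m = k + n"
  have nm: "n \<le> m" by (simp add: m_def)
  interpret r: module R "regular_module R" by (rule module_regular_module)
  interpret P0: module R "P n 0" by (rule P_module)
  interpret P1: module R "P n (Suc 0)" by (rule P_module)
  interpret Qn: module R "Q n" by (rule module_Q)
  note augn = resolutionD(1)[OF res[of n]] and augm = resolutionD(1)[OF res[of m]]
  have "Ipow n +> \<one> \<in> aug n ` carrier (P n 0)"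
    unfolding resolutionD(3)[OF res] carrier_Q by auto
  then obtain e where e: "e \<in> carrier (P n 0)" "aug n e = Ipow n +> \<one>" by auto
  have re: "aug n (z \<odot>\<^bsub>P n 0\<^esub> e) = Ipow n +> z" if z: "z \<in> carrier R" for z
    using linear_mapD(3)[OF augn z e(1)] linear_mapD(3)[OF linear_map_Q[of n] z, of \<one>] z e(2) by simp
  have "aug m v \<in> (\<lambda>x. Ipow m +> x) ` carrier (regular_module R)" if "v \<in> carrier (P m 0)" for v
    using linear_mapD(1)[OF augm that] unfolding carrier_Q by simp
  then obtain \<rho> where \<rho>: "linear_map R (P m 0) (regular_module R) \<rho>"
    "\<And>v. v \<in> carrier (P m 0) \<Longrightarrow> Ipow m +> \<rho> v = aug m v"
    using res_module_lift[OF module_regular_module module_Q linear_map_Q r.carrier_is_submodule augm]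
    by metis
  have \<rho>R: "\<rho> v \<in> carrier R" if "v \<in> carrier (P m 0)" for v using linear_mapD(1)[OF \<rho>(1) that] by simp
  let ?\<beta> = "\<lambda>v. \<rho> v \<odot>\<^bsub>P n 0\<^esub> e"
  have \<beta>: "linear_map R (P m 0) (P n 0) ?\<beta>"
    by (rule linear_mapI)
       (use \<rho>R e(1) linear_mapD(2,3)[OF \<rho>(1)] in \<open>auto simp: P0.smult_l_distr P0.smult_assoc1\<close>)
  let ?\<delta> = "\<lambda>v. lift m n 0 v \<ominus>\<^bsub>P n 0\<^esub> ?\<beta> v"
  have \<delta>: "linear_map R (P m 0) (P n 0) ?\<delta>"
    by (rule linear_map_diff[OF P_module P_module lift_linear[OF nm] \<beta>])
  have "?\<delta> v \<in> d n 0 ` carrier (P n (Suc 0))" if v: "v \<in> carrier (P m 0)" for v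
  proof -
    have "aug n (lift m n 0 v) = Ipow n +> \<rho> v"
      unfolding lift_aug[OF nm v] \<rho>(2)[OF v, symmetric] by (rule proj_coset[OF nm \<rho>R[OF v]])
    hence "aug n (?\<delta> v) = \<zero>\<^bsub>Q n\<^esub>"
      unfolding linear_map_minus[OF P_module module_Q augn lift_closed[OF nm v] linear_mapD(1)[OF \<beta> v]]
      using re[OF \<rho>R[OF v]] linear_mapD(1)[OF augn lift_closed[OF nm v]]
      by (simp add: a_minus_def Qn.r_neg)
    thus ?thesis using resolutionD(4)[OF res linear_mapD(1)[OF \<delta> v]] by blast
  qed
  then obtain s where s: "linear_map R (P m 0) (P n (Suc 0)) s"
    "\<And>v. v \<in> carrier (P m 0) \<Longrightarrow> d n 0 (s v) = ?\<delta> v"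
    using res_module_lift[OF P_module P_module d_linear P1.carrier_is_submodule \<delta>] by metis
  let ?S = "scaled k (P n (Suc 0)) (carrier (P n (Suc 0)))"
  note S = submodule_image[OF P_module P_module d_linear scaled_submodule[OF P_module order_refl], of n 0 k]
  have small: "z \<odot>\<^bsub>P n 0\<^esub> e \<in> d n 0 ` ?S" if "z \<in> ideal_prod R (Ipow k) (Ipow n)" for z
    using that
  proof (induction rule: ideal_prod.induct)
    case (prod i j)
    have ij: "i \<in> carrier R" "j \<in> carrier R" using prod Ipow_carrier by auto
    have "aug n (j \<odot>\<^bsub>P n 0\<^esub> e) = \<zero>\<^bsub>Q n\<^esub>"
      unfolding re[OF ij(2)] using coset_Q_eq_zero[OF ij(2)] prod(2) by blast
    then obtain u where u: "u \<in> carrier (P n (Suc 0))" "j \<odot>\<^bsub>P n 0\<^esub> e = d n 0 u"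
      using resolutionD(4)[OF res[of n], of "j \<odot>\<^bsub>P n 0\<^esub> e"] ij e(1) by auto
    have "(i \<otimes> j) \<odot>\<^bsub>P n 0\<^esub> e = d n 0 (i \<odot>\<^bsub>P n (Suc 0)\<^esub> u)"
      using ij e(1) u linear_mapD(3)[OF d_linear ij(1) u(1)] by (simp add: P0.smult_assoc1)
    thus ?case using scaled_mem[OF P_module prod(1) u(1)] by blast
  next
    case (sum s1 s2)
    have "s1 \<in> carrier R" "s2 \<in> carrier R"
      using sum(1,2) ideal_prod_in_carrier[OF ideal_pow ideal_pow] by blast+
    thus ?case using submoduleD(3)[OF S sum(3,4)] e(1) by (simp add: P0.smult_l_distr)
  qed
  have "small_lift 0 n m k ?\<beta> s (\<lambda>v. \<zero>\<^bsub>P n 0\<^esub>)"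
    unfolding small_lift_def
  proof (intro conjI ballI \<beta> s(1) linear_map_const_zero P_module refl)
    fix v assume v: "v \<in> carrier (P m 0)"
    note c = lift_closed[OF nm v] linear_mapD(1)[OF \<beta> v]
    show "lift m n 0 v = ?\<beta> v \<oplus>\<^bsub>P n 0\<^esub> (d n 0 (s v) \<oplus>\<^bsub>P n 0\<^esub> \<zero>\<^bsub>P n 0\<^esub>)"
    proof -
      define L x where "L = lift m n 0 v" and "x = ?\<beta> v"
      have "L \<in> carrier (P n 0)" "x \<in> carrier (P n 0)" using c by (auto simp: L_def x_def)
      hence "x \<oplus>\<^bsub>P n 0\<^esub> ((L \<ominus>\<^bsub>P n 0\<^esub> x) \<oplus>\<^bsub>P n 0\<^esub> \<zero>\<^bsub>P n 0\<^esub>) = L"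
        by (simp add: a_minus_def P0.a_lcomm[of x L] P0.r_neg)
      thus ?thesis unfolding s(2)[OF v] L_def x_def by simp
    qed
  next
    fix w assume w: "w \<in> carrier (P m (Suc 0))"
    have "Ipow m +> \<rho> (d m 0 w) = \<zero>\<^bsub>Q m\<^esub>"
      unfolding \<rho>(2)[OF d_closed[OF w]] by (rule res_aug_diff[OF res w])
    hence "\<rho> (d m 0 w) \<in> Ipow m" using coset_Q_eq_zero[OF \<rho>R[OF d_closed[OF w]]] by blast
    thus "?\<beta> (d m 0 w) \<in> d n 0 ` ?S" using small unfolding m_def Ipow_add by blast
  qed
  thus ?thesis using nm by blast
qed

lemma small_lift_exists: "\<exists>m\<ge>n. \<exists>\<beta> s s'. small_lift j n m k \<beta> s s'"
proof (induction j arbitrary: n k)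
  case 0 show ?case by (rule small_lift_0)
next
  case (Suc j)
  let ?W = "{x \<in> carrier (P n (Suc j)). d n j x = \<zero>\<^bsub>P n j\<^esub>}"
  note W = submodule_kernel[OF P_module P_module d_linear, of n j]
  have fg: "fin_gen_module R (P n (Suc j))" unfolding res_module_def by (rule fin_gen_free_module)
  \<comment> \<open>Artin--Rees for the cycles in degree j + 1: k' is such that every cycle in
    \<open>I^k' P\<close> lies in \<open>I^k W\<close>. The induction hypothesis is then used with
    k' in place of k, hence the generalization over k.\<close>
  obtain k' where k': "scaled k' (P n (Suc j)) (carrier (P n (Suc j))) \<inter> ?W \<subseteq> scaled k (P n (Suc j)) ?W"
    using artin_rees[OF P_module fg W] by blast
  let ?S = "scaled k (P n (Suc (Suc j))) (carrier (P n (Suc (Suc j))))"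
  note S = submodule_image[OF P_module P_module d_linear scaled_submodule[OF P_module order_refl], of n "Suc j" k]
  \<comment> \<open>Cycles are boundaries by exactness, so multiplying them by \<open>I^k\<close>
    gives boundaries of elements of \<open>I^k\<close> times the next module.\<close>
  have "scaled k (P n (Suc j)) ?W \<subseteq> d n (Suc j) ` ?S"
  proof (rule scaled_least[OF P_module S])
    fix r x assume r: "r \<in> Ipow k" and "x \<in> ?W"
    then obtain u where u: "u \<in> carrier (P n (Suc (Suc j)))" "x = d n (Suc j) u"
      using resolutionD(5)[OF res[of n], of x j] by auto
    have "r \<odot>\<^bsub>P n (Suc j)\<^esub> x = d n (Suc j) (r \<odot>\<^bsub>P n (Suc (Suc j))\<^esub> u)"
      unfolding u(2) using linear_mapD(3)[OF d_linear Ipow_carrier[OF r] u(1)] by simp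
    thus "r \<odot>\<^bsub>P n (Suc j)\<^esub> x \<in> d n (Suc j) ` ?S" using scaled_mem[OF P_module r u(1)] by blast
  qed
  note k' = subset_trans[OF k' this]
  obtain m \<beta> s s' where m: "m \<ge> n" and sl: "small_lift j n m k' \<beta> s s'" using Suc.IH by blast
  have \<beta>: "linear_map R (P m j) (P n j) \<beta>" and s: "linear_map R (P m j) (P n (Suc j)) s"
    using sl unfolding small_lift_def by blast+
  obtain \<beta>' t where \<beta>': "linear_map R (P m (Suc j)) (P n (Suc j)) \<beta>'"
    "linear_map R (P m (Suc j)) (P n (Suc (Suc j))) t"
    "\<And>v. v \<in> carrier (P m (Suc j)) \<Longrightarrow> \<beta>' v \<in> scaled k' (P n (Suc j)) (carrier (P n (Suc j)))"
    "\<And>v. v \<in> carrier (P m (Suc j)) \<Longrightarrow> d n j (\<beta>' v) = \<beta> (d m j v)"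
    "\<And>v. v \<in> carrier (P m (Suc j)) \<Longrightarrow> lift m n (Suc j) v =
        \<beta>' v \<oplus>\<^bsub>P n (Suc j)\<^esub> (d n (Suc j) (t v) \<oplus>\<^bsub>P n (Suc j)\<^esub> s (d m j v))"
    using small_lift_step[OF m sl] by metis
  \<comment> \<open>The former homotopy s reappears composed with d; it kills boundaries because d d
    = 0.\<close>
  have "small_lift (Suc j) n m k \<beta>' t (\<lambda>v. s (d m j v))"
    unfolding small_lift_def
  proof (intro conjI ballI \<beta>' linear_map_comp[OF d_linear s])
    fix w assume w: "w \<in> carrier (P m (Suc (Suc j)))"
    note dd = res_diff_diff[OF res w]
    show "s (d m j (d m (Suc j) w)) = \<zero>\<^bsub>P n (Suc j)\<^esub>"
      unfolding dd by (rule linear_map_zero[OF P_module P_module s])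
    have "d n j (\<beta>' (d m (Suc j) w)) = \<zero>\<^bsub>P n j\<^esub>"
      unfolding \<beta>'(4)[OF d_closed[OF w]] dd by (rule linear_map_zero[OF P_module P_module \<beta>])
    thus "\<beta>' (d m (Suc j) w) \<in> d n (Suc j) ` ?S"
      using k' \<beta>'(3)[OF d_closed[OF w]] linear_mapD(1)[OF \<beta>'(1) d_closed[OF w]] by blast
  qed
  thus ?case using m by blast
qed

text \<open>A linear map into M kills \<open>I P\<close>, since I kills M. With k = 1 in the
  homotopy, a cocycle sees only the part \<open>s d\<close> of the transition map, and that part
  gives a coboundary.\<close>

lemma vanishes_of_annihilated:
  assumes "module R M" "\<And>r x. r \<in> I \<Longrightarrow> x \<in> carrier M \<Longrightarrow> r \<odot>\<^bsub>M\<^esub> x = \<zero>\<^bsub>M\<^esub>"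
  shows "vanishes (Suc i) M"
  unfolding vanishes_def
proof (intro allI impI)
  fix n \<phi> assume \<phi>: "cocycle n (Suc i) M \<phi>"
  interpret M: module R M by fact
  interpret P1: module R "P n (Suc i)" by (rule P_module)
  have \<phi>lin: "linear_map R (P n (Suc i)) M \<phi>" using \<phi> by (simp add: cocycle_def)
  have "scaled (Suc 0) (P n (Suc i)) (carrier (P n (Suc i))) \<subseteq> {v \<in> carrier (P n (Suc i)). \<phi> v = \<zero>\<^bsub>M\<^esub>}"
  proof (rule scaled_least[OF P_module submodule_kernel[OF P_module assms(1) \<phi>lin]])
    fix r x assume "r \<in> Ipow (Suc 0)" "x \<in> carrier (P n (Suc i))"
    thus "r \<odot>\<^bsub>P n (Suc i)\<^esub> x \<in> {v \<in> carrier (P n (Suc i)). \<phi> v = \<zero>\<^bsub>M\<^esub>}"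
      using assms(2)[of r "\<phi> x"] linear_mapD(3)[OF \<phi>lin, of r x] linear_mapD(1)[OF \<phi>lin, of x]
        ideal.Icarr[OF ideal_I] unfolding Ipow_1 by auto
  qed
  hence kill: "\<phi> v = \<zero>\<^bsub>M\<^esub>" if "v \<in> scaled (Suc 0) (P n (Suc i)) (carrier (P n (Suc i)))" for v
    using that by blast
  obtain m \<beta> s s' where m: "m \<ge> n" and sl: "small_lift i n m (Suc 0) \<beta> s s'"
    using small_lift_exists by blast
  have s: "linear_map R (P m i) (P n (Suc i)) s" using sl unfolding small_lift_def by blast
  obtain \<beta>' t where \<beta>': "linear_map R (P m (Suc i)) (P n (Suc i)) \<beta>'"
    "linear_map R (P m (Suc i)) (P n (Suc (Suc i))) t"
    "\<And>v. v \<in> carrier (P m (Suc i)) \<Longrightarrow> \<beta>' v \<in> scaled (Suc 0) (P n (Suc i)) (carrier (P n (Suc i)))"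
    "\<And>v. v \<in> carrier (P m (Suc i)) \<Longrightarrow> lift m n (Suc i) v =
        \<beta>' v \<oplus>\<^bsub>P n (Suc i)\<^esub> (d n (Suc i) (t v) \<oplus>\<^bsub>P n (Suc i)\<^esub> s (d m i v))"
    using small_lift_step[OF m sl] by metis
  have "\<phi> (lift m n (Suc i) v) = \<phi> (s (d m i v))" if v: "v \<in> carrier (P m (Suc i))" for v
  proof -
    note c = linear_mapD(1)[OF \<beta>'(1) v] d_closed[OF linear_mapD(1)[OF \<beta>'(2) v]]
      linear_mapD(1)[OF s d_closed[OF v]]
    have "\<phi> (lift m n (Suc i) v) = \<phi> (\<beta>' v) \<oplus>\<^bsub>M\<^esub> (\<phi> (d n (Suc i) (t v)) \<oplus>\<^bsub>M\<^esub> \<phi> (s (d m i v)))"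
      unfolding \<beta>'(4)[OF v] linear_mapD(2)[OF \<phi>lin c(1) P1.a_closed[OF c(2,3)]]
        linear_mapD(2)[OF \<phi>lin c(2,3)] ..
    moreover have "\<phi> (d n (Suc i) (t v)) = \<zero>\<^bsub>M\<^esub>"
      using \<phi> linear_mapD(1)[OF \<beta>'(2) v] by (simp add: cocycle_def)
    ultimately show ?thesis using kill[OF \<beta>'(3)[OF v]] linear_mapD(1)[OF \<phi>lin c(3)] by simp
  qed
  hence "coboundary m (Suc i) M (\<lambda>v. \<phi> (lift m n (Suc i) v))"
    using linear_map_comp[OF s \<phi>lin] by (auto simp: coboundary_def)
  thus "dies n (Suc i) M \<phi>" using m unfolding dies_def by blast
qed

end

section \<open>Associated primes and devissage\<close>

context module
begin

lemma submodule_scale_preimage: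
  assumes "submodule N R M" "t \<in> carrier R"
  shows "submodule {y \<in> carrier M. t \<odot>\<^bsub>M\<^esub> y \<in> N} R M"
proof (rule submoduleI')
  note N = submoduleD[OF assms(1)]
  show "r \<odot>\<^bsub>M\<^esub> y \<in> {y \<in> carrier M. t \<odot>\<^bsub>M\<^esub> y \<in> N}"
    if "r \<in> carrier R" "y \<in> {y \<in> carrier M. t \<odot>\<^bsub>M\<^esub> y \<in> N}" for r y
  proof -
    have "t \<odot>\<^bsub>M\<^esub> (r \<odot>\<^bsub>M\<^esub> y) = r \<odot>\<^bsub>M\<^esub> (t \<odot>\<^bsub>M\<^esub> y)"
      using that assms(2) by (simp add: smult_assoc1[symmetric] R.m_comm)
    thus ?thesis using that N(4) by simp
  qed
qed (use submoduleD(2,3)[OF assms(1)] assms(2) in \<open>auto simp: smult_r_distr\<close>)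

lemma smult_diff: "r \<in> carrier R \<Longrightarrow> s \<in> carrier R \<Longrightarrow> x \<in> carrier M \<Longrightarrow>
    (r \<ominus> s) \<odot>\<^bsub>M\<^esub> x = r \<odot>\<^bsub>M\<^esub> x \<ominus>\<^bsub>M\<^esub> s \<odot>\<^bsub>M\<^esub> x"
  by (simp add: a_minus_def smult_l_distr smult_l_minus)

lemma submodule_add_mem_iff:
  assumes "submodule N R M" "s \<in> N" "y \<in> carrier M"
  shows "s \<oplus>\<^bsub>M\<^esub> y \<in> N \<longleftrightarrow> y \<in> N"
proof
  note N = submoduleD[OF assms(1)]
  have s: "s \<in> carrier M" using assms(2) N(1) by blast
  assume "s \<oplus>\<^bsub>M\<^esub> y \<in> N"
  hence "\<ominus>\<^bsub>M\<^esub> s \<oplus>\<^bsub>M\<^esub> (s \<oplus>\<^bsub>M\<^esub> y) \<in> N" using N(3,5) assms(2) by blast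
  thus "y \<in> N" using s assms(3) by (simp add: M.r_neg1)
qed (use submoduleD(3)[OF assms(1)] assms(2) in blast)

lemma colon_antimono: "N \<subseteq> N' \<Longrightarrow> L' \<subseteq> L \<Longrightarrow> colon R M N L \<subseteq> colon R M N' L'"
  unfolding colon_def by blast

end

context noetherian_ideal
begin

abbreviation "RQ p \<equiv> quot_module (regular_module R) p"

lemma mem_ideal_coset_iff:
  assumes "ideal p R" "r \<in> carrier R"
  shows "t \<in> p +> r \<longleftrightarrow> t \<in> carrier R \<and> t \<ominus> r \<in> p"
proof -
  interpret r: module R "regular_module R" by (rule module_regular_module)
  have "\<ominus>\<^bsub>regular_module R\<^esub> r = \<ominus> r"
    using r.M.minus_equality[of "\<ominus> r" r] assms(2) by (simp add: l_neg)
  thus ?thesis using r.mem_coset_iff[OF submodule_ideal[OF assms(1)], of r t] assms(2)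
    by (simp add: a_minus_def)
qed

text \<open>The isomorphism of (N + Rx)/N with R/(N : x). An element y is sent to the set of all t
  with y - tx in N: this set already is the coset, so no coefficient of x has to be chosen.\<close>

lemma adjoin_quotient_map:
  assumes "module R M" "submodule N R M" "x \<in> carrier M"
  obtains f where "linear_map R (M\<lparr>carrier := adjoin R M N x\<rparr>) (RQ (colon R M N {x})) f"
    "f ` adjoin R M N x = carrier (RQ (colon R M N {x}))"
    "\<And>y. y \<in> adjoin R M N x \<Longrightarrow> f y = \<zero>\<^bsub>RQ (colon R M N {x})\<^esub> \<longleftrightarrow> y \<in> N"
    "\<And>r. r \<in> carrier R \<Longrightarrow> f (r \<odot>\<^bsub>M\<^esub> x) = colon R M N {x} +> r"
proof -
  interpret M: module R M by fact
  note N = submoduleD[OF assms(2)]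
  let ?p = "colon R M N {x}"
  have p: "ideal ?p R" by (rule M.colon_ideal[OF assms(2)]) (use assms(3) in simp)
  note q = ideal_quot[OF p]
  let ?f = "\<lambda>y. {t \<in> carrier R. y \<ominus>\<^bsub>M\<^esub> t \<odot>\<^bsub>M\<^esub> x \<in> N}"
  have fval: "?f (s \<oplus>\<^bsub>M\<^esub> r \<odot>\<^bsub>M\<^esub> x) = ?p +> r" if s: "s \<in> N" and r: "r \<in> carrier R" for s r
  proof (rule Set.set_eqI)
    fix t
    have sM: "s \<in> carrier M" using s N(1) by blast
    have "(s \<oplus>\<^bsub>M\<^esub> r \<odot>\<^bsub>M\<^esub> x) \<ominus>\<^bsub>M\<^esub> t \<odot>\<^bsub>M\<^esub> x \<in> N \<longleftrightarrow> t \<ominus> r \<in> ?p" if t: "t \<in> carrier R"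
    proof -
      have "(s \<oplus>\<^bsub>M\<^esub> r \<odot>\<^bsub>M\<^esub> x) \<ominus>\<^bsub>M\<^esub> t \<odot>\<^bsub>M\<^esub> x = s \<oplus>\<^bsub>M\<^esub> (r \<odot>\<^bsub>M\<^esub> x \<ominus>\<^bsub>M\<^esub> t \<odot>\<^bsub>M\<^esub> x)"
        using sM r t assms(3) by (simp add: a_minus_def M.a_assoc)
      also have "\<dots> = s \<oplus>\<^bsub>M\<^esub> (r \<ominus> t) \<odot>\<^bsub>M\<^esub> x" using M.smult_diff[OF r t assms(3)] by simp
      also have "\<dots> \<in> N \<longleftrightarrow> (r \<ominus> t) \<odot>\<^bsub>M\<^esub> x \<in> N"
        by (rule M.submodule_add_mem_iff[OF assms(2) s]) (use r t assms(3) in simp)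
      also have "\<dots> \<longleftrightarrow> r \<ominus> t \<in> ?p" using r t by (simp add: colon_def)
      also have "\<dots> \<longleftrightarrow> t \<ominus> r \<in> ?p"
      proof -
        have inv: "\<ominus> (a \<ominus> b) = b \<ominus> a" if "a \<in> carrier R" "b \<in> carrier R" for a b
          using that by (simp add: a_minus_def minus_add a_comm)
        show ?thesis
          using additive_subgroup.a_inv_closed[OF ideal.axioms(1)[OF p]] inv[OF r t] inv[OF t r] by metis
      qed
      finally show ?thesis .
    qed
    thus "t \<in> ?f (s \<oplus>\<^bsub>M\<^esub> r \<odot>\<^bsub>M\<^esub> x) \<longleftrightarrow> t \<in> ?p +> r" using mem_ideal_coset_iff[OF p r] by auto
  qed
  let ?A = "adjoin R M N x"
  have Aelim: "\<exists>s\<in>N. \<exists>r\<in>carrier R. y = s \<oplus>\<^bsub>M\<^esub> r \<odot>\<^bsub>M\<^esub> x" if "y \<in> ?A" for y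
    using that unfolding adjoin_def by blast
  have Aintro: "s \<oplus>\<^bsub>M\<^esub> r \<odot>\<^bsub>M\<^esub> x \<in> ?A" if "s \<in> N" "r \<in> carrier R" for s r
    using that unfolding adjoin_def by blast
  have lin: "linear_map R (M\<lparr>carrier := ?A\<rparr>) (RQ ?p) ?f"
  proof (rule linear_mapI)
    fix y assume "y \<in> carrier (M\<lparr>carrier := ?A\<rparr>)"
    hence "y \<in> ?A" by simp
    from Aelim[OF this] obtain s r where y: "s \<in> N" "r \<in> carrier R" "y = s \<oplus>\<^bsub>M\<^esub> r \<odot>\<^bsub>M\<^esub> x" by blast
    have sM: "s \<in> carrier M" using y(1) N(1) by blast
    show "?f y \<in> carrier (RQ ?p)" unfolding y(3) fval[OF y(1,2)] q(3) using y(2) by blast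
    show "?f (t \<odot>\<^bsub>M\<lparr>carrier := ?A\<rparr>\<^esub> y) = t \<odot>\<^bsub>RQ ?p\<^esub> ?f y" if t: "t \<in> carrier R" for t
    proof -
      have "t \<odot>\<^bsub>M\<^esub> y = t \<odot>\<^bsub>M\<^esub> s \<oplus>\<^bsub>M\<^esub> (t \<otimes> r) \<odot>\<^bsub>M\<^esub> x"
        unfolding y(3) using sM y(2) t assms(3) by (simp add: M.smult_r_distr M.smult_assoc1)
      hence "?f (t \<odot>\<^bsub>M\<^esub> y) = ?p +> (t \<otimes> r)" using fval[OF N(4)[OF t y(1)]] t y(2) by simp
      also have "\<dots> = t \<odot>\<^bsub>RQ ?p\<^esub> (?p +> r)" using linear_mapD(3)[OF q(6) t, of r] y(2) by simp
      finally show ?thesis unfolding y(3) fval[OF y(1,2)] by simp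
    qed
    fix y' assume "y' \<in> carrier (M\<lparr>carrier := ?A\<rparr>)"
    hence "y' \<in> ?A" by simp
    from Aelim[OF this] obtain s' r' where y': "s' \<in> N" "r' \<in> carrier R" "y' = s' \<oplus>\<^bsub>M\<^esub> r' \<odot>\<^bsub>M\<^esub> x"
      by blast
    have sM': "s' \<in> carrier M" using y'(1) N(1) by blast
    have "y \<oplus>\<^bsub>M\<^esub> y' = (s \<oplus>\<^bsub>M\<^esub> s') \<oplus>\<^bsub>M\<^esub> (r \<oplus> r') \<odot>\<^bsub>M\<^esub> x"
      unfolding y(3) y'(3) using sM sM' y(2) y'(2) assms(3) by (simp add: M.smult_l_distr M.a_ac)
    hence "?f (y \<oplus>\<^bsub>M\<^esub> y') = ?p +> (r \<oplus> r')" using fval[OF N(3)[OF y(1) y'(1)]] y(2) y'(2) by simp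
    also have "\<dots> = (?p +> r) \<oplus>\<^bsub>RQ ?p\<^esub> (?p +> r')"
      using linear_mapD(2)[OF q(6), of r r'] y(2) y'(2) by simp
    finally show "?f (y \<oplus>\<^bsub>M\<lparr>carrier := ?A\<rparr>\<^esub> y') = ?f y \<oplus>\<^bsub>RQ ?p\<^esub> ?f y'"
      unfolding y(3) y'(3) fval[OF y(1,2)] fval[OF y'(1,2)] by simp
  qed
  have surj: "?f ` ?A = carrier (RQ ?p)"
  proof
    show "?f ` ?A \<subseteq> carrier (RQ ?p)"
      using linear_mapD(1)[OF lin] by auto
    show "carrier (RQ ?p) \<subseteq> ?f ` ?A"
      unfolding q(3)
    proof (rule image_subsetI)
      fix r assume r: "r \<in> carrier R"
      show "?p +> r \<in> ?f ` ?A" unfolding fval[OF N(2) r, symmetric] by (rule imageI[OF Aintro[OF N(2) r]])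
    qed
  qed
  have ker: "?f y = \<zero>\<^bsub>RQ ?p\<^esub> \<longleftrightarrow> y \<in> N" if yA: "y \<in> ?A" for y
  proof -
    obtain s r where y: "s \<in> N" "r \<in> carrier R" "y = s \<oplus>\<^bsub>M\<^esub> r \<odot>\<^bsub>M\<^esub> x" using Aelim[OF yA] by blast
    have "?f y = \<zero>\<^bsub>RQ ?p\<^esub> \<longleftrightarrow> r \<in> ?p" unfolding y(3) fval[OF y(1,2)] by (rule q(5)[OF y(2)])
    also have "\<dots> \<longleftrightarrow> r \<odot>\<^bsub>M\<^esub> x \<in> N" using y(2) by (simp add: colon_def)
    also have "\<dots> \<longleftrightarrow> y \<in> N"
      unfolding y(3) using M.submodule_add_mem_iff[OF assms(2) y(1)] y(2) assms(3) by simp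
    finally show ?thesis .
  qed
  have val: "?f (r \<odot>\<^bsub>M\<^esub> x) = ?p +> r" if "r \<in> carrier R" for r
    using fval[OF N(2) that] that assms(3) by simp
  show thesis by (rule that[of ?f, OF lin surj ker val])
qed

lemma vanishes_adjoin:
  assumes "module R M" "submodule N R M" "x \<in> carrier M"
    and "vanishes j (M\<lparr>carrier := N\<rparr>)" "vanishes j (RQ (colon R M N {x}))"
  shows "vanishes j (M\<lparr>carrier := adjoin R M N x\<rparr>)"
proof -
  interpret M: module R M by fact
  have p: "ideal (colon R M N {x}) R" by (rule M.colon_ideal[OF assms(2)]) (use assms(3) in simp)
  obtain f where f: "linear_map R (M\<lparr>carrier := adjoin R M N x\<rparr>) (RQ (colon R M N {x})) f"
    "f ` adjoin R M N x = carrier (RQ (colon R M N {x}))"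
    "\<And>y. y \<in> adjoin R M N x \<Longrightarrow> f y = \<zero>\<^bsub>RQ (colon R M N {x})\<^esub> \<longleftrightarrow> y \<in> N"
    using adjoin_quotient_map[OF assms(1-3)] by metis
  have "{y \<in> adjoin R M N x. f y = \<zero>\<^bsub>RQ (colon R M N {x})\<^esub>} = N"
    using f(3) M.adjoin_incl(1)[OF assms(2,3)] by blast
  hence van: "vanishes j ((M\<lparr>carrier := adjoin R M N x\<rparr>)\<lparr>carrier :=
      {y \<in> carrier (M\<lparr>carrier := adjoin R M N x\<rparr>). f y = \<zero>\<^bsub>RQ (colon R M N {x})\<^esub>}\<rparr>)"
    using assms(4) by simp
  show ?thesis
    by (rule vanishes_extension[OF M.submodule_module[OF M.submodule_adjoin[OF assms(2,3)]]
          ideal_quot(1)[OF p] f(1) _ van assms(5)]) (simp add: f(2))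
qed

text \<open>Among the ideals (N : x) with x in L that avoid the multiplicative set S, a maximal one
  is prime. S = {1} yields an associated prime of L/N, and S = R - p one that is contained in
  p.\<close>

lemma exists_prime_colon:
  assumes "module R M" "submodule N R M" "submodule L R M" "x0 \<in> L"
    and S: "S \<subseteq> carrier R" "\<one> \<in> S" "\<And>s t. s \<in> S \<Longrightarrow> t \<in> S \<Longrightarrow> s \<otimes> t \<in> S"
    and "colon R M N {x0} \<inter> S = {}"
  obtains x where "x \<in> L" "primeideal (colon R M N {x}) R" "colon R M N {x} \<inter> S = {}"
proof -
  interpret M: module R M by fact
  have LM: "x \<in> carrier M" if "x \<in> L" for x using submoduleD(1)[OF assms(3)] that by blast
  have id: "ideal (colon R M N {x}) R" if "x \<in> L" for x
    by (rule M.colon_ideal[OF assms(2)]) (use LM[OF that] in simp)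
  let ?P = "\<lambda>J. \<exists>x\<in>L. J = colon R M N {x} \<and> J \<inter> S = {}"
  obtain J where J: "ideal J R" "?P J" and max: "\<And>K. ideal K R \<Longrightarrow> ?P K \<Longrightarrow> J \<subseteq> K \<Longrightarrow> K = J"
    using maximal_ideal_with[OF id[OF assms(4)], of ?P] assms(4,8) by blast
  obtain x where x: "x \<in> L" "J = colon R M N {x}" "J \<inter> S = {}" using J(2) by blast
  have memJ: "r \<in> J \<longleftrightarrow> r \<in> carrier R \<and> r \<odot>\<^bsub>M\<^esub> x \<in> N" for r
    unfolding x(2) colon_def by simp
  have larger: "colon R M N {t \<odot>\<^bsub>M\<^esub> x} = J"
    if t: "t \<in> carrier R" and disj: "colon R M N {t \<odot>\<^bsub>M\<^esub> x} \<inter> S = {}" for t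
  proof (rule max)
    have tx: "t \<odot>\<^bsub>M\<^esub> x \<in> L" using submoduleD(4)[OF assms(3) t x(1)] .
    show "ideal (colon R M N {t \<odot>\<^bsub>M\<^esub> x}) R" by (rule id[OF tx])
    show "?P (colon R M N {t \<odot>\<^bsub>M\<^esub> x})" using tx disj by blast
    show "J \<subseteq> colon R M N {t \<odot>\<^bsub>M\<^esub> x}"
    proof
      fix r assume r: "r \<in> J"
      have "r \<odot>\<^bsub>M\<^esub> (t \<odot>\<^bsub>M\<^esub> x) = t \<odot>\<^bsub>M\<^esub> (r \<odot>\<^bsub>M\<^esub> x)"
        using r t LM[OF x(1)] memJ by (simp add: M.smult_assoc1[symmetric] m_comm)
      thus "r \<in> colon R M N {t \<odot>\<^bsub>M\<^esub> x}" using r memJ submoduleD(4)[OF assms(2) t] by (simp add: colon_def)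
    qed
  qed
  have memc: "r \<in> colon R M N {t \<odot>\<^bsub>M\<^esub> x} \<longleftrightarrow> r \<in> carrier R \<and> r \<otimes> t \<in> J" if "t \<in> carrier R" for r t
    using that LM[OF x(1)] memJ[of "r \<otimes> t"] M.smult_assoc1[of r t x] by (auto simp: colon_def)
  have "primeideal J R"
  proof (rule primeidealI[OF J(1) cring_axioms])
    show "carrier R \<noteq> J" using S x(3) by blast
    fix u v assume uv: "u \<in> carrier R" "v \<in> carrier R" "u \<otimes> v \<in> J"
    show "u \<in> J \<or> v \<in> J"
    proof (cases "colon R M N {u \<odot>\<^bsub>M\<^esub> x} \<inter> S = {}")
      case True
      hence "v \<in> J" using larger[OF uv(1)] memc[OF uv(1), of v] uv by (simp add: m_comm)
      thus ?thesis ..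
    next
      case False
      \<comment> \<open>If (N : ux) meets S, some t in S carries u into J. Since S is
        multiplicative, (N : tx) still avoids S, so it equals J by maximality, and it contains
        u.\<close>
      then obtain t where t: "t \<in> S" "t \<in> carrier R" "t \<otimes> u \<in> J" using memc[OF uv(1)] by blast
      have "colon R M N {t \<odot>\<^bsub>M\<^esub> x} \<inter> S = {}"
      proof (rule ccontr)
        assume "colon R M N {t \<odot>\<^bsub>M\<^esub> x} \<inter> S \<noteq> {}"
        then obtain r where "r \<in> S" "r \<otimes> t \<in> J" using memc[OF t(2)] by blast
        thus False using S(3)[OF _ t(1)] x(3) by blast
      qed
      hence "u \<in> J" using larger[OF t(2)] memc[OF t(2), of u] uv t by (simp add: m_comm)
      thus ?thesis ..
    qed
  qed
  thus thesis using that x by blast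
qed

text \<open>If every generator of L had a multiplier outside p taking it into N, the product of
  these multipliers would lie outside p and take all of L into N. So some (N : x0) lies inside p,
  and the maximal choice avoiding R - p is prime.\<close>

lemma exists_prime_colon_below:
  assumes "module R M" "fin_gen_module R M" "submodule N R M" "submodule L R M"
    and p: "primeideal p R" "colon R M N L \<subseteq> p"
  obtains x where "x \<in> L" "primeideal (colon R M N {x}) R" "colon R M N {x} \<subseteq> p"
proof -
  interpret M: module R M by fact
  interpret p: primeideal p R by fact
  obtain T where T: "finite T" "T \<subseteq> L" "generated R M T = L"
    using finitely_generated_submodule[OF assms(1,2,4)] by blast
  have LM: "x \<in> carrier M" if "x \<in> L" for x using submoduleD(1)[OF assms(4)] that by blast
  have one: "\<one> \<notin> p" using p.one_imp_carrier p.I_notcarr by blast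
  have "\<exists>x0\<in>L. colon R M N {x0} \<subseteq> p"
  proof (rule ccontr)
    assume no: "\<not> (\<exists>x0\<in>L. colon R M N {x0} \<subseteq> p)"
    have "\<exists>t. t \<in> carrier R \<and> t \<notin> p \<and> (\<forall>y\<in>T. t \<odot>\<^bsub>M\<^esub> y \<in> N)"
      using T(1,2)
    proof (induction T rule: finite_induct)
      case empty
      thus ?case using one by auto
    next
      case (insert y T)
      then obtain t where t: "t \<in> carrier R" "t \<notin> p" "\<forall>y\<in>T. t \<odot>\<^bsub>M\<^esub> y \<in> N" by auto
      obtain u where u: "u \<in> carrier R" "u \<notin> p" "u \<odot>\<^bsub>M\<^esub> y \<in> N"
        using no insert.prems by (auto simp: colon_def)
      have "(t \<otimes> u) \<odot>\<^bsub>M\<^esub> z \<in> N" if "z \<in> insert y T" for z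
      proof -
        have z: "z \<in> carrier M" using that insert.prems LM by blast
        have "(t \<otimes> u) \<odot>\<^bsub>M\<^esub> z = t \<odot>\<^bsub>M\<^esub> (u \<odot>\<^bsub>M\<^esub> z)" "(t \<otimes> u) \<odot>\<^bsub>M\<^esub> z = u \<odot>\<^bsub>M\<^esub> (t \<odot>\<^bsub>M\<^esub> z)"
          using z t u by (simp_all add: M.smult_assoc1[symmetric] m_comm)
        note eq = this
        show ?thesis
        proof (cases "z = y")
          case True
          thus ?thesis using eq(1) submoduleD(4)[OF assms(3) t(1) u(3)] by simp
        next
          case False
          hence "t \<odot>\<^bsub>M\<^esub> z \<in> N" using that t(3) by blast
          thus ?thesis unfolding eq(2) by (rule submoduleD(4)[OF assms(3) u(1)])
        qed
      qed
      moreover have "t \<otimes> u \<notin> p" using p.I_prime t u by blast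
      ultimately show ?case using t(1) u(1) by blast
    qed
    then obtain t where t: "t \<in> carrier R" "t \<notin> p" "\<forall>y\<in>T. t \<odot>\<^bsub>M\<^esub> y \<in> N" by blast
    have "L \<subseteq> {y \<in> carrier M. t \<odot>\<^bsub>M\<^esub> y \<in> N}"
      unfolding T(3)[symmetric]
      by (rule M.generated_least[OF M.submodule_scale_preimage[OF assms(3) t(1)]])
         (use t(3) T(2) LM in auto)
    hence "t \<in> colon R M N L" using t(1) by (auto simp: colon_def)
    thus False using p(2) t(2) by blast
  qed
  then obtain x0 where x0: "x0 \<in> L" "colon R M N {x0} \<subseteq> p" by blast
  obtain x where x: "x \<in> L" "primeideal (colon R M N {x}) R" "colon R M N {x} \<inter> (carrier R - p) = {}"
  proof (rule exists_prime_colon[OF assms(1,3,4) x0(1), of "carrier R - p"])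
    show "s \<otimes> t \<in> carrier R - p" if "s \<in> carrier R - p" "t \<in> carrier R - p" for s t
      using that p.I_prime by blast
  qed (use one x0(2) that in auto)
  have "colon R M N {x} \<subseteq> p" using x(3) unfolding colon_def by blast
  thus thesis using that x by blast
qed

text \<open>A submodule K that is maximal among those containing N with vanishing cohomology must be
  M: otherwise an associated prime (K : x) of M/K allows K + Rx as well. Starting from N instead of
  0 restricts the primes to those over the annihilator of M/N.\<close>

lemma vanishes_devissage:
  assumes "module R M" "fin_gen_module R M" "submodule N R M" "vanishes j (M\<lparr>carrier := N\<rparr>)"
    and "\<And>p. primeideal p R \<Longrightarrow> colon R M N (carrier M) \<subseteq> p \<Longrightarrow> vanishes j (RQ p)"
  shows "vanishes j M"
proof -
  interpret M: module R M by fact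
  let ?P = "\<lambda>K. N \<subseteq> K \<and> vanishes j (M\<lparr>carrier := K\<rparr>)"
  have PN: "?P N" using assms(4) by blast
  obtain K where K: "submodule K R M" "?P K"
    and max: "\<And>K'. submodule K' R M \<Longrightarrow> ?P K' \<Longrightarrow> K \<subseteq> K' \<Longrightarrow> K' = K"
    by (rule maximal_submodule[where P = ?P, OF assms(1,2,3) PN]) (rule that)
  have "carrier M \<subseteq> K"
  proof (rule ccontr)
    assume "\<not> carrier M \<subseteq> K"
    then obtain x0 where x0: "x0 \<in> carrier M" "x0 \<notin> K" by blast
    have disj: "colon R M K {x0} \<inter> {\<one>} = {}" using x0 by (simp add: colon_def)
    obtain x where x: "x \<in> carrier M" "primeideal (colon R M K {x}) R" "colon R M K {x} \<inter> {\<one>} = {}"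
      by (rule exists_prime_colon[OF assms(1) K(1) M.carrier_is_submodule x0(1), of "{\<one>}"])
         (use disj that in auto)
    have xK: "x \<notin> K" using x(1,3) by (auto simp: colon_def)
    have "colon R M N (carrier M) \<subseteq> colon R M K {x}"
      by (rule M.colon_antimono) (use K(2) x(1) in auto)
    hence "vanishes j (RQ (colon R M K {x}))" by (rule assms(5)[OF x(2)])
    hence "vanishes j (M\<lparr>carrier := adjoin R M K x\<rparr>)"
      using vanishes_adjoin[OF assms(1) K(1) x(1)] K(2) by blast
    hence "adjoin R M K x = K"
      using max[OF M.submodule_adjoin[OF K(1) x(1)]] M.adjoin_incl[OF K(1) x(1)] K(2) by blast
    thus False using M.adjoin_incl(2)[OF K(1) x(1)] xK by blast
  qed
  hence "K = carrier M" using submoduleD(1)[OF K(1)] by blast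
  thus ?thesis using K(2) by simp
qed

lemma vanishes_zero_submodule:
  assumes "module R M"
  shows "vanishes j (M\<lparr>carrier := {\<zero>\<^bsub>M\<^esub>}\<rparr>)"
proof -
  interpret M: module R M by fact
  note Z = M.submodule_module[OF M.zero_submodule]
  show ?thesis unfolding vanishes_def dies_def
  proof (intro allI impI exI conjI)
    fix n \<phi> assume "cocycle n j (M\<lparr>carrier := {\<zero>\<^bsub>M\<^esub>}\<rparr>) \<phi>"
    hence "\<phi> v = \<zero>\<^bsub>M\<^esub>" if "v \<in> carrier (P n j)" for v
      using that by (auto simp: cocycle_def linear_map_def)
    thus "coboundary n j (M\<lparr>carrier := {\<zero>\<^bsub>M\<^esub>}\<rparr>) (\<lambda>v. \<phi> (lift n n j v))"
      by (intro coboundary_zero[OF Z]) (simp add: lift_closed[OF order_refl])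
  qed simp
qed

lemma vanishes_of_primes:
  assumes "module R M" "fin_gen_module R M"
    and "\<And>p. primeideal p R \<Longrightarrow> colon R M {\<zero>\<^bsub>M\<^esub>} (carrier M) \<subseteq> p \<Longrightarrow> vanishes j (RQ p)"
  shows "vanishes j M"
  by (rule vanishes_devissage[OF assms(1,2) module.zero_submodule[OF assms(1)]
        vanishes_zero_submodule[OF assms(1)] assms(3)])

section \<open>Cohomological dimension and supports\<close>

text \<open>Induction on the number of generators of \<open>I\<close> outside \<open>p\<close>, each of which is regular on \<open>R/p\<close>.\<close>

lemma vanishes_prime_quotient_aux:
  assumes G: "I = Idl G" "G \<subseteq> carrier R" and "finite A" "A \<subseteq> G"
    and "primeideal p R" "G - A \<subseteq> p" "card A < j"
  shows "vanishes j (RQ p)"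
  using assms(3-)
proof (induction A arbitrary: p j rule: finite_induct)
  case empty
  interpret p: primeideal p R by fact
  note q = ideal_quot[OF p.ideal_axioms]
  \<comment> \<open>With no generator left outside p, the ideal I is contained in p and annihilates
    R/p; the bound makes j positive.\<close>
  have Ip: "I \<subseteq> p" unfolding G(1) by (rule genideal_minimal[OF p.ideal_axioms]) (use empty in simp)
  obtain i where j: "j = Suc i" using empty by (cases j) auto
  show ?case unfolding j
  proof (rule vanishes_of_annihilated[OF q(1)])
    fix r X assume r: "r \<in> I" and X: "X \<in> carrier (RQ p)"
    have rR: "r \<in> carrier R" using ideal.Icarr[OF ideal_I r] .
    obtain x where x: "x \<in> carrier R" "X = p +> x" using X unfolding q(3) by auto
    have "r \<odot>\<^bsub>RQ p\<^esub> X = p +> (r \<otimes> x)" using linear_mapD(3)[OF q(6) rR, of x] x by simp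
    also have "\<dots> = \<zero>\<^bsub>RQ p\<^esub>" using q(5)[of "r \<otimes> x"] rR x(1) p.I_r_closed[of r x] r Ip by auto
    finally show "r \<odot>\<^bsub>RQ p\<^esub> X = \<zero>\<^bsub>RQ p\<^esub>" .
  qed
next
  case (insert x A)
  interpret p: primeideal p R by fact
  note q = ideal_quot[OF p.ideal_axioms]
  have A: "A \<subseteq> G" and xG: "x \<in> G" using insert by auto
  have xI: "x \<in> I" using genideal_self[OF G(2)] xG unfolding G(1) by blast
  have xR: "x \<in> carrier R" using xG G(2) by blast
  have card: "card (insert x A) = Suc (card A)" using insert by simp
  show ?case
  proof (cases "x \<in> p")
    case True
    hence "G - A \<subseteq> p" using insert.prems(3) by blast
    thus ?thesis by (rule insert.IH[OF A insert.prems(2)]) (use insert.prems(4) card in simp)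
  next
    case False
    interpret Q: module R "RQ p" by (rule q(1))
    obtain i where j: "j = Suc i" "card A < i" using insert.prems(4) card by (cases j) auto
    have xcos: "x \<odot>\<^bsub>RQ p\<^esub> (p +> r) = p +> (x \<otimes> r)" if "r \<in> carrier R" for r
      using linear_mapD(3)[OF q(6) xR, of r] that by simp
    have id: "linear_map R (RQ p) (RQ p) (\<lambda>y. y)" by (rule linear_mapI) auto
    \<comment> \<open>The quotient of R/p by x(R/p) is a module of cosets of cosets. It is never
      identified with R/(p + xR): the primes over its annihilator contain p and x, and the induction
      hypothesis for A applies to each of them.\<close>
    let ?N = "(\<lambda>y. x \<odot>\<^bsub>RQ p\<^esub> y) ` carrier (RQ p)"
    have N: "submodule ?N R (RQ p)"
      by (rule submodule_image[OF q(1) q(1) linear_map_scale[OF q(1) q(1) id xR] Q.carrier_is_submodule])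
    let ?Q = "quot_module (RQ p) ?N"
    let ?\<pi> = "\<lambda>y. ?N +>\<^bsub>RQ p\<^esub> y"
    note Q = Q.module_quot_module[OF N]
    note \<pi> = Q.linear_map_proj[OF N]
    have surj: "?\<pi> ` carrier (RQ p) = carrier ?Q" using Q.quot_module_simps(1)[OF N] by simp
    have fgQ: "fin_gen_module R ?Q" by (rule fin_gen_linear_image[OF q(1) Q \<pi> q(2) surj])
    have "vanishes i ?Q"
    proof (rule vanishes_of_primes[OF Q fgQ])
      fix P assume P: "primeideal P R" "colon R ?Q {\<zero>\<^bsub>?Q\<^esub>} (carrier ?Q) \<subseteq> P"
      \<comment> \<open>An element mapping R/p into x(R/p) annihilates the quotient, hence lies in
        P; this puts both x and p inside P.\<close>
      have kill: "r \<in> P" if r: "r \<in> carrier R" and "\<And>y. y \<in> carrier (RQ p) \<Longrightarrow> r \<odot>\<^bsub>RQ p\<^esub> y \<in> ?N" for r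
      proof -
        have "r \<odot>\<^bsub>?Q\<^esub> ?\<pi> y = \<zero>\<^bsub>?Q\<^esub>" if y: "y \<in> carrier (RQ p)" for y
          using Q.quot_module_simps(4)[OF N r y] Q.proj_eq_zero_iff[OF N, of "r \<odot>\<^bsub>RQ p\<^esub> y"] r y
            \<open>\<And>y. y \<in> carrier (RQ p) \<Longrightarrow> r \<odot>\<^bsub>RQ p\<^esub> y \<in> ?N\<close>[OF y] by simp
        hence "r \<in> colon R ?Q {\<zero>\<^bsub>?Q\<^esub>} (carrier ?Q)" unfolding surj[symmetric] colon_def using r by simp
        thus ?thesis using P(2) by blast
      qed
      have "x \<in> P" by (rule kill[OF xR]) blast
      moreover have "p \<subseteq> P"
      proof
        fix r assume r: "r \<in> p"
        have rR: "r \<in> carrier R" using p.Icarr[OF r] .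
        show "r \<in> P"
        proof (rule kill[OF rR])
          fix y assume "y \<in> carrier (RQ p)"
          then obtain z where z: "z \<in> carrier R" "y = p +> z" unfolding q(3) by auto
          have "r \<odot>\<^bsub>RQ p\<^esub> y = \<zero>\<^bsub>RQ p\<^esub>"
            using linear_mapD(3)[OF q(6) rR, of z] q(5)[of "r \<otimes> z"] z rR p.I_r_closed[OF r z(1)] by simp
          thus "r \<odot>\<^bsub>RQ p\<^esub> y \<in> ?N" using submoduleD(2)[OF N] by simp
        qed
      qed
      ultimately have "G - A \<subseteq> P" using insert.prems(3) by blast
      thus "vanishes i (RQ P)" by (rule insert.IH[OF A P(1) _ j(2)])
    qed
    thus ?thesis unfolding j(1)
    proof (rule vanishes_of_regular[OF q(1) Q \<pi> surj xI, rotated 2])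
      fix y assume y: "y \<in> carrier (RQ p)"
      show "?\<pi> y = \<zero>\<^bsub>?Q\<^esub> \<longleftrightarrow> y \<in> ?N" by (rule Q.proj_eq_zero_iff[OF N y])
      assume xy: "x \<odot>\<^bsub>RQ p\<^esub> y = \<zero>\<^bsub>RQ p\<^esub>"
      obtain z where z: "z \<in> carrier R" "y = p +> z" using y unfolding q(3) by auto
      have "x \<otimes> z \<in> p" using xy xcos[OF z(1)] q(5)[of "x \<otimes> z"] z xR by simp
      hence "z \<in> p" using p.I_prime[OF xR z(1)] False by blast
      thus "y = \<zero>\<^bsub>RQ p\<^esub>" using q(5)[OF z(1)] z(2) by blast
    qed
  qed
qed

text \<open>The bound is the number of generators of I. Its uniformity in p is what gives the
  descending induction a common starting degree.\<close>

lemma vanishes_bounded: "\<exists>b. \<forall>p j. primeideal p R \<longrightarrow> b < j \<longrightarrow> vanishes j (RQ p)"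
proof -
  obtain G where G: "G \<subseteq> carrier R" "finite G" "I = Idl G" using finetely_gen[OF ideal_I] by blast
  show ?thesis
    using vanishes_prime_quotient_aux[OF G(3,1,2) order_refl] by (intro exI[of _ "card G"]) blast
qed

lemma vanishes_submodule:
  assumes "module R M" "fin_gen_module R M" "submodule N R M"
    and "\<And>p. primeideal p R \<Longrightarrow> colon R M {\<zero>\<^bsub>M\<^esub>} (carrier M) \<subseteq> p \<Longrightarrow> vanishes j (RQ p)"
  shows "vanishes j (M\<lparr>carrier := N\<rparr>)"
proof -
  interpret M: module R M by fact
  have "colon R M {\<zero>\<^bsub>M\<^esub>} (carrier M) \<subseteq> colon R (M\<lparr>carrier := N\<rparr>) {\<zero>\<^bsub>M\<lparr>carrier := N\<rparr>\<^esub>} (carrier (M\<lparr>carrier := N\<rparr>))"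
    using submoduleD(1)[OF assms(3)] by (auto simp: colon_def)
  note sub = this
  show ?thesis
    by (rule vanishes_of_primes[OF M.submodule_module[OF assms(3)] fin_gen_submodule[OF assms(1-3)]])
       (rule assms(4), assumption, rule subset_trans[OF sub])
qed

text \<open>Let \<open>p\<close> be a maximal counterexample and let \<open>N\<close> be maximal with \<open>(N : M) \<subseteq> p\<close>. Then \<open>M/N\<close> is
  isomorphic to a nonzero ideal of \<open>R/p\<close>, and the quotient of \<open>R/p\<close> by this ideal is supported on
  primes strictly larger than \<open>p\<close>.\<close>

lemma vanishes_prime_descend:
  assumes "module R M" "fin_gen_module R M" "vanishes j M"
    and up: "\<And>p. primeideal p R \<Longrightarrow> colon R M {\<zero>\<^bsub>M\<^esub>} (carrier M) \<subseteq> p \<Longrightarrow> vanishes (Suc j) (RQ p)"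
    and "primeideal p0 R" "colon R M {\<zero>\<^bsub>M\<^esub>} (carrier M) \<subseteq> p0"
  shows "vanishes j (RQ p0)"
proof (rule ccontr)
  assume bad0: "\<not> vanishes j (RQ p0)"
  interpret M: module R M by fact
  let ?P = "\<lambda>p. primeideal p R \<and> colon R M {\<zero>\<^bsub>M\<^esub>} (carrier M) \<subseteq> p \<and> \<not> vanishes j (RQ p)"
  have P0: "?P p0" using assms(5,6) bad0 by blast
  obtain p where p0: "ideal p R" "?P p"
    and pmax: "\<And>J. ideal J R \<Longrightarrow> ?P J \<Longrightarrow> p \<subseteq> J \<Longrightarrow> J = p"
    by (rule maximal_ideal_with[where P = ?P, OF primeideal.axioms(1)[OF assms(5)] P0]) (rule that)
  from p0(2) have p: "primeideal p R" "colon R M {\<zero>\<^bsub>M\<^esub>} (carrier M) \<subseteq> p" "\<not> vanishes j (RQ p)"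
    by blast+
  interpret p: primeideal p R by fact
  note q = ideal_quot[OF p.ideal_axioms]
  let ?C = "\<lambda>N. colon R M N (carrier M) \<subseteq> p"
  obtain N where N: "submodule N R M" "?C N"
    and Nmax: "\<And>N'. submodule N' R M \<Longrightarrow> ?C N' \<Longrightarrow> N \<subseteq> N' \<Longrightarrow> N' = N"
    by (rule maximal_submodule[where P = ?C, OF assms(1,2) M.zero_submodule p(2)]) (rule that)
  note NS = submoduleD[OF N(1)]
  \<comment> \<open>Maximality of N: any nonzero element of M/N generates everything up to one
    multiplier s outside p, uniformly over M.\<close>
  have big: "\<exists>s. s \<in> carrier R \<and> s \<notin> p \<and> (\<forall>y\<in>carrier M. s \<odot>\<^bsub>M\<^esub> y \<in> adjoin R M N z)"
    if z: "z \<in> carrier M" "z \<notin> N" for z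
  proof (rule ccontr)
    assume "\<not> ?thesis"
    hence "?C (adjoin R M N z)" unfolding colon_def by blast
    hence "adjoin R M N z = N"
      using Nmax[OF M.submodule_adjoin[OF N(1) z(1)]] M.adjoin_incl(1)[OF N(1) z(1)] by blast
    thus False using M.adjoin_incl(2)[OF N(1) z(1)] z(2) by blast
  qed
  obtain x where x: "x \<in> carrier M" "primeideal (colon R M N {x}) R" "colon R M N {x} \<subseteq> p"
    using exists_prime_colon_below[OF assms(1,2) N(1) M.carrier_is_submodule p(1) N(2)] by metis
  have memx: "r \<in> colon R M N {x} \<longleftrightarrow> r \<in> carrier R \<and> r \<odot>\<^bsub>M\<^esub> x \<in> N" for r
    by (simp add: colon_def)
  \<comment> \<open>For r in p with rx outside N, \<open>big\<close> gives s outside p with sx in N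
    + Rrx. Then s - tr lies in (N : x), hence in p, and s would lie in p as well.\<close>
  have px: "colon R M N {x} = p"
  proof (rule ccontr)
    assume "colon R M N {x} \<noteq> p"
    then obtain r where r: "r \<in> p" "r \<notin> colon R M N {x}" using x(3) by blast
    have rR: "r \<in> carrier R" using p.Icarr[OF r(1)] .
    hence "r \<odot>\<^bsub>M\<^esub> x \<notin> N" using r(2) memx by blast
    then obtain s where s: "s \<in> carrier R" "s \<notin> p" "s \<odot>\<^bsub>M\<^esub> x \<in> adjoin R M N (r \<odot>\<^bsub>M\<^esub> x)"
      using big[of "r \<odot>\<^bsub>M\<^esub> x"] rR x(1) by auto
    then obtain n t where nt: "n \<in> N" "t \<in> carrier R" "s \<odot>\<^bsub>M\<^esub> x = n \<oplus>\<^bsub>M\<^esub> t \<odot>\<^bsub>M\<^esub> (r \<odot>\<^bsub>M\<^esub> x)"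
      unfolding adjoin_def by blast
    have n: "n \<in> carrier M" using nt(1) NS(1) by blast
    have "(s \<ominus> t \<otimes> r) \<odot>\<^bsub>M\<^esub> x = n"
      using M.smult_diff[OF s(1) m_closed[OF nt(2) rR] x(1)] nt n rR x(1)
      by (simp add: a_minus_def M.smult_assoc1 M.a_assoc M.r_neg)
    hence "s \<ominus> t \<otimes> r \<in> p" using memx[of "s \<ominus> t \<otimes> r"] x(3) s(1) nt(1,2) rR by auto
    moreover have "t \<otimes> r \<in> p" using p.I_l_closed[OF r(1) nt(2)] .
    ultimately have "(s \<ominus> t \<otimes> r) \<oplus> t \<otimes> r \<in> p" by (rule p.a_closed)
    thus False using s nt(2) rR by (simp add: a_minus_def a_assoc l_neg)
  qed
  have xN: "x \<notin> N" using px p.one_imp_carrier p.I_notcarr memx[of \<one>] x(1) by auto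
  obtain s where s: "s \<in> carrier R" "s \<notin> p" "\<And>y. y \<in> carrier M \<Longrightarrow> s \<odot>\<^bsub>M\<^esub> y \<in> adjoin R M N x"
    using big[OF x(1) xN] by blast
  \<comment> \<open>Multiplication by s is injective on M/N: if sy is in N but y is not,
    \<open>big\<close> for y gives t outside p with tx in N + Ry, and st would lie in (N : x) =
    p.\<close>
  have sinj: "y \<in> N" if y: "y \<in> carrier M" "s \<odot>\<^bsub>M\<^esub> y \<in> N" for y
  proof (rule ccontr)
    assume "y \<notin> N"
    then obtain t where t: "t \<in> carrier R" "t \<notin> p" "t \<odot>\<^bsub>M\<^esub> x \<in> adjoin R M N y"
      using big[OF y(1)] x(1) by blast
    then obtain n r where nr: "n \<in> N" "r \<in> carrier R" "t \<odot>\<^bsub>M\<^esub> x = n \<oplus>\<^bsub>M\<^esub> r \<odot>\<^bsub>M\<^esub> y"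
      unfolding adjoin_def by blast
    have n: "n \<in> carrier M" using nr(1) NS(1) by blast
    have "(s \<otimes> t) \<odot>\<^bsub>M\<^esub> x = s \<odot>\<^bsub>M\<^esub> n \<oplus>\<^bsub>M\<^esub> r \<odot>\<^bsub>M\<^esub> (s \<odot>\<^bsub>M\<^esub> y)"
      using s(1) t(1) nr n x(1) y(1)
      by (simp add: M.smult_assoc1 M.smult_r_distr) (simp add: M.smult_assoc1[symmetric] m_comm)
    also have "\<dots> \<in> N" using NS(3,4) s(1) nr y(2) by blast
    finally have "s \<otimes> t \<in> p" using memx[of "s \<otimes> t"] s(1) t(1) px by simp
    thus False using p.I_prime s t by blast
  qed
  obtain f where f: "linear_map R (M\<lparr>carrier := adjoin R M N x\<rparr>) (RQ p) f"
    "\<And>y. y \<in> adjoin R M N x \<Longrightarrow> f y = \<zero>\<^bsub>RQ p\<^esub> \<longleftrightarrow> y \<in> N"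
    "\<And>r. r \<in> carrier R \<Longrightarrow> f (r \<odot>\<^bsub>M\<^esub> x) = p +> r"
    using adjoin_quotient_map[OF assms(1) N(1) x(1)] unfolding px by metis
  have "linear_map R M M (\<lambda>y. y)" by (rule linear_mapI) auto
  hence "linear_map R M M (\<lambda>y. s \<odot>\<^bsub>M\<^esub> y)" by (rule linear_map_scale[OF assms(1,1) _ s(1)])
  hence "linear_map R M (M\<lparr>carrier := adjoin R M N x\<rparr>) (\<lambda>y. s \<odot>\<^bsub>M\<^esub> y)"
    using s(3) by (simp add: linear_map_def)
  \<comment> \<open>Multiplication by s maps M into N + Rx, and (N + Rx)/N is R/p. The composite has
    kernel exactly N, so M/N becomes the ideal \<open>?G\<close> of R/p.\<close>
  hence g: "linear_map R M (RQ p) (\<lambda>y. f (s \<odot>\<^bsub>M\<^esub> y))" using f(1) by (rule linear_map_comp)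
  let ?g = "\<lambda>y. f (s \<odot>\<^bsub>M\<^esub> y)"
  let ?G = "?g ` carrier M"
  note G = submodule_image[OF assms(1) q(1) g M.carrier_is_submodule]
  interpret Q: module R "RQ p" by (rule q(1))
  have ker: "{y \<in> carrier M. ?g y = \<zero>\<^bsub>RQ p\<^esub>} = N"
    using f(2)[OF s(3)] sinj NS(1) NS(4)[OF s(1)] by blast
  have "linear_map R M ((RQ p)\<lparr>carrier := ?G\<rparr>) ?g" using g by (simp add: linear_map_def)
  \<comment> \<open>The assumption in degree j + 1 covers the submodule N, whose annihilator
    contains that of M; this is the term receiving the connecting map.\<close>
  moreover have "vanishes (Suc j) (M\<lparr>carrier := {y \<in> carrier M. ?g y = \<zero>\<^bsub>(RQ p)\<lparr>carrier := ?G\<rparr>\<^esub>}\<rparr>)"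
    using vanishes_submodule[OF assms(1,2) N(1) up] ker by simp
  ultimately have vG: "vanishes j ((RQ p)\<lparr>carrier := ?G\<rparr>)"
    using vanishes_quotient[OF assms(1) Q.submodule_module[OF G], of ?g j] assms(3) by simp
  \<comment> \<open>The quotient of R/p by \<open>?G\<close> is annihilated by p and by s, which is
    outside p. Every prime over its annihilator is strictly larger than p, hence not a
    counterexample.\<close>
  have "vanishes j (RQ p)"
  proof (rule vanishes_devissage[OF q(1,2) G vG])
    fix P assume P: "primeideal P R" "colon R (RQ p) ?G (carrier (RQ p)) \<subseteq> P"
    have smult: "r \<odot>\<^bsub>RQ p\<^esub> (p +> z) = p +> (r \<otimes> z)" if "r \<in> carrier R" "z \<in> carrier R" for r z
      using linear_mapD(3)[OF q(6) that(1), of z] that by simp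
    have pP: "p \<subseteq> P"
    proof
      fix r assume r: "r \<in> p"
      have rR: "r \<in> carrier R" using p.Icarr[OF r] .
      have "r \<odot>\<^bsub>RQ p\<^esub> y \<in> ?G" if "y \<in> carrier (RQ p)" for y
      proof -
        obtain z where z: "z \<in> carrier R" "y = p +> z" using \<open>y \<in> carrier (RQ p)\<close> unfolding q(3) by auto
        have "r \<odot>\<^bsub>RQ p\<^esub> y = \<zero>\<^bsub>RQ p\<^esub>"
          using smult[OF rR z(1)] q(5)[of "r \<otimes> z"] z rR p.I_r_closed[OF r z(1)] by simp
        thus ?thesis using submoduleD(2)[OF G] by simp
      qed
      thus "r \<in> P" using P(2) rR unfolding colon_def by blast
    qed
    have "s \<odot>\<^bsub>RQ p\<^esub> y \<in> ?G" if "y \<in> carrier (RQ p)" for y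
    proof -
      obtain z where z: "z \<in> carrier R" "y = p +> z" using \<open>y \<in> carrier (RQ p)\<close> unfolding q(3) by auto
      have "s \<odot>\<^bsub>RQ p\<^esub> y = ?g (z \<odot>\<^bsub>M\<^esub> x)"
        using smult[OF s(1) z(1)] f(3)[of "s \<otimes> z"] z s(1) x(1) by (simp add: M.smult_assoc1)
      thus ?thesis using z(1) x(1) by blast
    qed
    hence "s \<in> P" using P(2) s(1) unfolding colon_def by blast
    hence "P \<noteq> p" using s(2) by blast
    hence "\<not> ?P P" using pmax[OF primeideal.axioms(1)[OF P(1)] _ pP] by blast
    thus "vanishes j (RQ P)" using P(1) pP p(2) by blast
  qed
  thus False using p(3) by blast
qed

text \<open>The bound cd(M) \<le> c for a natural number c, which also admits cd(M) =
  -\<infinity>.\<close>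

definition cd_at_most :: "nat \<Rightarrow> ('a, 'b, 'k) module_scheme \<Rightarrow> bool" where
  "cd_at_most c M \<longleftrightarrow> (\<forall>j>c. vanishes j M)"

lemma cd_at_most_mono: "cd_at_most i M \<Longrightarrow> i \<le> j \<Longrightarrow> cd_at_most j M"
  unfolding cd_at_most_def by auto

lemma cd_at_most_prime:
  assumes "module R M" "fin_gen_module R M" "cd_at_most c M"
    and "primeideal p R" "colon R M {\<zero>\<^bsub>M\<^esub>} (carrier M) \<subseteq> p"
  shows "cd_at_most c (RQ p)"
proof -
  obtain b where b: "\<forall>p j. primeideal p R \<longrightarrow> b < j \<longrightarrow> vanishes j (RQ p)" using vanishes_bounded by (rule exE)
  have "vanishes j (RQ p)" if "c < j" "primeideal p R" "colon R M {\<zero>\<^bsub>M\<^esub>} (carrier M) \<subseteq> p" for j p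
    using that
  \<comment> \<open>Downwards in j: the measure is 0 exactly above the uniform bound b, where the
    cohomology of every R/p vanishes.\<close>
  proof (induction "Suc b - j" arbitrary: j p)
    case 0
    hence "b < j" by simp
    thus ?case using b 0(3) by blast
  next
    case (Suc e)
    have "vanishes (Suc j) (RQ P)" if "primeideal P R" "colon R M {\<zero>\<^bsub>M\<^esub>} (carrier M) \<subseteq> P" for P
      using Suc.hyps(1)[of "Suc j" P] Suc.hyps(2) Suc.prems(1) that by simp
    moreover have "vanishes j M" using assms(3) Suc.prems(1) unfolding cd_at_most_def by blast
    ultimately show ?case using vanishes_prime_descend[OF assms(1,2)] Suc.prems by blast
  qed
  thus ?thesis using assms(4,5) unfolding cd_at_most_def by blast
qed

text \<open>The annihilator of R/p is p, so q lies over it and \<open>cd_at_most_prime\<close>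
  applies to the module R/p.\<close>

lemma cd_at_most_prime_mono:
  assumes "primeideal p R" "primeideal q R" "p \<subseteq> q" "cd_at_most c (RQ p)"
  shows "cd_at_most c (RQ q)"
proof -
  interpret p: primeideal p R by fact
  note m = ideal_quot[OF p.ideal_axioms]
  have "colon R (RQ p) {\<zero>\<^bsub>RQ p\<^esub>} (carrier (RQ p)) \<subseteq> p"
  proof
    fix r assume r: "r \<in> colon R (RQ p) {\<zero>\<^bsub>RQ p\<^esub>} (carrier (RQ p))"
    hence rR: "r \<in> carrier R" by (simp add: colon_def)
    have "p +> \<one> \<in> carrier (RQ p)" unfolding m(3) by blast
    hence "r \<odot>\<^bsub>RQ p\<^esub> (p +> \<one>) = \<zero>\<^bsub>RQ p\<^esub>" using r by (simp add: colon_def)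
    thus "r \<in> p" using linear_mapD(3)[OF m(6) rR, of \<one>] m(5)[OF rR] rR by simp
  qed
  thus ?thesis using cd_at_most_prime[OF m(1,2) assms(4,2)] assms(3) by blast
qed

lemma cd_at_most_submodule_prime:
  assumes "module R M" "fin_gen_module R M" "submodule T R M" "cd_at_most c (M\<lparr>carrier := T\<rparr>)"
    and "primeideal p R" "colon R M {\<zero>\<^bsub>M\<^esub>} T \<subseteq> p"
  shows "cd_at_most c (RQ p)"
  using cd_at_most_prime[OF module.submodule_module[OF assms(1,3)] fin_gen_submodule[OF assms(1-3)]
      assms(4,5)] assms(6) by (simp add: colon_def)

lemma cd_at_most_adjoin:
  assumes "module R M" "submodule N R M" "x \<in> carrier M"
    and "cd_at_most c (M\<lparr>carrier := N\<rparr>)" "cd_at_most c (RQ (colon R M N {x}))"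
  shows "cd_at_most c (M\<lparr>carrier := adjoin R M N x\<rparr>)"
  using vanishes_adjoin[OF assms(1-3)] assms(4,5) unfolding cd_at_most_def by blast

lemma cd_le_iff:
  assumes "module R M"
  shows "cd R I M \<le> ereal (real c) \<longleftrightarrow> cd_at_most c M"
  unfolding cd_def cd_at_most_def Sup_le_iff local_cohomology_eq_zero_iff[OF assms]
  by (auto simp: not_less[symmetric])

text \<open>A bound by c + 1 that fails at c means that degree c + 1 itself does not vanish. The
  value 0 would need a separate condition, because a bound by 0 does not exclude -\<infinity>; the
  comparison of associated primes only involves i \<ge> 1.\<close>

lemma cd_eq_Suc_iff:
  assumes "module R M"
  shows "cd R I M = ereal (real (Suc c)) \<longleftrightarrow> cd_at_most (Suc c) M \<and> \<not> cd_at_most c M"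
proof
  assume "cd R I M = ereal (real (Suc c))"
  thus "cd_at_most (Suc c) M \<and> \<not> cd_at_most c M"
    using cd_le_iff[OF assms, of "Suc c"] cd_le_iff[OF assms, of c] by simp
next
  assume *: "cd_at_most (Suc c) M \<and> \<not> cd_at_most c M"
  then obtain j where "j > c" "\<not> vanishes j M" unfolding cd_at_most_def by blast
  moreover from this have "j \<le> Suc c" using * unfolding cd_at_most_def by (meson not_le)
  ultimately have nv: "\<not> vanishes (Suc c) M" by (metis Suc_leI le_antisym)
  have "ereal (real (Suc c)) \<le> cd R I M"
    unfolding cd_def local_cohomology_eq_zero_iff[OF assms] by (rule Sup_upper) (use nv in blast)
  thus "cd R I M = ereal (real (Suc c))" using * cd_le_iff[OF assms, of "Suc c"] by (intro antisym) auto
qed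

section \<open>The filtration\<close>

lemma Ass_eq: "Ass R M = {p. primeideal p R \<and> (\<exists>x\<in>carrier M. p = colon R M {\<zero>\<^bsub>M\<^esub>} {x})}"
  by (simp add: Ass_def colon_def)

text \<open>The annihilator of the class of x in L/N is (N : x), so later arguments take place
  inside M and cosets disappear.\<close>

lemma Ass_quot_eq:
  assumes "module R M" "submodule L R M" "submodule N R M" "N \<subseteq> L"
  shows "Ass R (quot_module (M\<lparr>carrier := L\<rparr>) N) = {p. primeideal p R \<and> (\<exists>x\<in>L. p = colon R M N {x})}"
proof -
  interpret M: module R M by fact
  interpret L: module R "M\<lparr>carrier := L\<rparr>" by (rule M.submodule_module[OF assms(2)])
  have N: "submodule N R (M\<lparr>carrier := L\<rparr>)"
    using M.submodule_submodule_iff[OF assms(2)] assms(3,4) by blast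
  let ?Q = "quot_module (M\<lparr>carrier := L\<rparr>) N"
  let ?\<pi> = "\<lambda>x. N +>\<^bsub>M\<lparr>carrier := L\<rparr>\<^esub> x"
  have "{r \<in> carrier R. r \<odot>\<^bsub>?Q\<^esub> ?\<pi> x = \<zero>\<^bsub>?Q\<^esub>} = colon R M N {x}" if x: "x \<in> L" for x
  proof -
    have "r \<odot>\<^bsub>?Q\<^esub> ?\<pi> x = \<zero>\<^bsub>?Q\<^esub> \<longleftrightarrow> r \<odot>\<^bsub>M\<^esub> x \<in> N" if r: "r \<in> carrier R" for r
      using L.quot_module_simps(4)[OF N r, of x] L.proj_eq_zero_iff[OF N, of "r \<odot>\<^bsub>M\<^esub> x"] x
        submoduleD(4)[OF assms(2) r x] by simp
    thus ?thesis by (auto simp: colon_def)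
  qed
  moreover have "carrier ?Q = ?\<pi> ` L" using L.quot_module_simps(1)[OF N] by simp
  ultimately show ?thesis unfolding Ass_def by auto
qed

lemma Ass_cd_Suc_iff:
  "p \<in> Ass_cd R I (Suc i) M \<longleftrightarrow> p \<in> Ass R M \<and> cd_at_most (Suc i) (RQ p) \<and> \<not> cd_at_most i (RQ p)"
proof (cases "p \<in> Ass R M")
  case True
  hence "ideal p R" by (simp add: Ass_def primeideal.axioms(1))
  thus ?thesis using True cd_eq_Suc_iff[OF ideal_quot(1)] by (simp add: Ass_cd_def)
qed (simp add: Ass_cd_def)

lemma is_cd_filtration_iff:
  assumes "module R M" "cd R I M = ereal (real c)" "\<And>i. i \<le> c \<Longrightarrow> submodule (Mf i) R M"
  shows "is_cd_filtration R I M c Mf \<longleftrightarrow>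
    (\<forall>i\<le>c. cd_at_most i (M\<lparr>carrier := Mf i\<rparr>) \<and>
       (\<forall>N. submodule N R M \<and> cd_at_most i (M\<lparr>carrier := N\<rparr>) \<longrightarrow> N \<subseteq> Mf i))"
proof -
  have "cd R I (M\<lparr>carrier := N\<rparr>) \<le> ereal (real i) \<longleftrightarrow> cd_at_most i (M\<lparr>carrier := N\<rparr>)"
    if "submodule N R M" for N i
    by (rule cd_le_iff[OF module.submodule_module[OF assms(1) that]])
  thus ?thesis using assms(2,3) unfolding is_cd_filtration_def by (auto cong: conj_cong)
qed

text \<open>Both inclusions compare (N : x) with annihilators in M for a prime p with cd(R/p) > i.
  Such a p does not contain the annihilator of N, because N has the bound i. Hence some s outside p
  kills N, and p = (N : x) becomes (0 : sx); conversely, if p = (0 : x), no multiple rx with r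
  outside p lies in N.\<close>

lemma Ass_quotient_of_cd_filtration:
  assumes "module R M" "fin_gen_module R M"
    and sub: "submodule L R M" "submodule N R M" "N \<subseteq> L"
    and L: "cd_at_most (Suc i) (M\<lparr>carrier := L\<rparr>)"
      "\<And>K. submodule K R M \<Longrightarrow> cd_at_most (Suc i) (M\<lparr>carrier := K\<rparr>) \<Longrightarrow> K \<subseteq> L"
    and N: "cd_at_most i (M\<lparr>carrier := N\<rparr>)"
      "\<And>K. submodule K R M \<Longrightarrow> cd_at_most i (M\<lparr>carrier := K\<rparr>) \<Longrightarrow> K \<subseteq> N"
  shows "Ass R (quot_module (M\<lparr>carrier := L\<rparr>) N) = Ass_cd R I (Suc i) M"
proof (rule Set.set_eqI, rule iffI)
  interpret M: module R M by fact
  note LS = submoduleD[OF sub(1)] and NS = submoduleD[OF sub(2)]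
  fix p
  {
    assume "p \<in> Ass R (quot_module (M\<lparr>carrier := L\<rparr>) N)"
    then obtain x where p: "primeideal p R" and x: "x \<in> L" "p = colon R M N {x}"
      unfolding Ass_quot_eq[OF assms(1) sub] by blast
    interpret p: primeideal p R by (rule p)
    have xM: "x \<in> carrier M" using x(1) LS(1) by blast
    have memp: "r \<in> p \<longleftrightarrow> r \<in> carrier R \<and> r \<odot>\<^bsub>M\<^esub> x \<in> N" for r
      unfolding x(2) by (simp add: colon_def)
    have "colon R M {\<zero>\<^bsub>M\<^esub>} L \<subseteq> p"
      unfolding x(2) by (rule M.colon_antimono) (use x(1) NS(2) in auto)
    hence good: "cd_at_most (Suc i) (RQ p)"
      by (rule cd_at_most_submodule_prime[OF assms(1,2) sub(1) L(1) p])
    \<comment> \<open>If R/p had the bound i, so would N + Rx, whose quotient by N is R/p; being the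
      largest such submodule, N would contain x.\<close>
    have bad: "\<not> cd_at_most i (RQ p)"
    proof
      assume "cd_at_most i (RQ p)"
      hence "adjoin R M N x \<subseteq> N"
        using N(2)[OF M.submodule_adjoin[OF sub(2) xM]] cd_at_most_adjoin[OF assms(1) sub(2) xM N(1)] x(2)
        by blast
      hence "\<one> \<in> p" using memp[of \<one>] M.adjoin_incl(2)[OF sub(2) xM] xM by auto
      thus False using p.one_imp_carrier p.I_notcarr by blast
    qed
    have "\<not> colon R M {\<zero>\<^bsub>M\<^esub>} N \<subseteq> p"
      using cd_at_most_submodule_prime[OF assms(1,2) sub(2) N(1) p] bad by blast
    then obtain s where s: "s \<in> carrier R" "s \<notin> p" "\<And>y. y \<in> N \<Longrightarrow> s \<odot>\<^bsub>M\<^esub> y = \<zero>\<^bsub>M\<^esub>"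
      by (auto simp: colon_def)
    have "colon R M {\<zero>\<^bsub>M\<^esub>} {s \<odot>\<^bsub>M\<^esub> x} = p"
    proof (rule Set.set_eqI, rule iffI)
      fix r assume "r \<in> colon R M {\<zero>\<^bsub>M\<^esub>} {s \<odot>\<^bsub>M\<^esub> x}"
      hence r: "r \<in> carrier R" "(r \<otimes> s) \<odot>\<^bsub>M\<^esub> x = \<zero>\<^bsub>M\<^esub>"
        using s(1) xM by (auto simp: colon_def M.smult_assoc1)
      hence "r \<otimes> s \<in> p" using memp[of "r \<otimes> s"] NS(2) s(1) by simp
      thus "r \<in> p" using p.I_prime[OF r(1) s(1)] s(2) by blast
    next
      fix r assume "r \<in> p"
      hence r: "r \<in> carrier R" "r \<odot>\<^bsub>M\<^esub> x \<in> N" using memp by auto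
      have "r \<odot>\<^bsub>M\<^esub> (s \<odot>\<^bsub>M\<^esub> x) = s \<odot>\<^bsub>M\<^esub> (r \<odot>\<^bsub>M\<^esub> x)"
        using r(1) s(1) xM by (simp add: M.smult_assoc1[symmetric] m_comm)
      thus "r \<in> colon R M {\<zero>\<^bsub>M\<^esub>} {s \<odot>\<^bsub>M\<^esub> x}" using r s(3) by (simp add: colon_def)
    qed
    moreover have "s \<odot>\<^bsub>M\<^esub> x \<in> carrier M" using s(1) xM by simp
    ultimately have "p \<in> Ass R M" unfolding Ass_eq using p by blast
    thus "p \<in> Ass_cd R I (Suc i) M" unfolding Ass_cd_Suc_iff using good bad by blast
  next
    assume "p \<in> Ass_cd R I (Suc i) M"
    hence good: "cd_at_most (Suc i) (RQ p)" and bad: "\<not> cd_at_most i (RQ p)" and "p \<in> Ass R M"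
      unfolding Ass_cd_Suc_iff by auto
    then obtain x where p: "primeideal p R" and x: "x \<in> carrier M" "p = colon R M {\<zero>\<^bsub>M\<^esub>} {x}"
      unfolding Ass_eq by blast
    interpret p: primeideal p R by (rule p)
    have memp: "r \<in> p \<longleftrightarrow> r \<in> carrier R \<and> r \<odot>\<^bsub>M\<^esub> x = \<zero>\<^bsub>M\<^esub>" for r
      unfolding x(2) by (simp add: colon_def)
    \<comment> \<open>Rx arises by adjoining x to 0 and is a copy of R/p; the largest submodule with
      bound i + 1 contains it.\<close>
    have "cd_at_most (Suc i) (M\<lparr>carrier := adjoin R M {\<zero>\<^bsub>M\<^esub>} x\<rparr>)"
      by (rule cd_at_most_adjoin[OF assms(1) M.zero_submodule x(1)])
         (use vanishes_zero_submodule[OF assms(1)] good x(2) in \<open>auto simp: cd_at_most_def\<close>)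
    hence xL: "x \<in> L"
      using L(2)[OF M.submodule_adjoin[OF M.zero_submodule x(1)]] M.adjoin_incl(2)[OF M.zero_submodule x(1)]
      by blast
    have "colon R M N {x} = p"
    proof (rule Set.set_eqI, rule iffI)
      fix r assume "r \<in> p"
      thus "r \<in> colon R M N {x}" using memp NS(2) by (simp add: colon_def)
    next
      fix r assume "r \<in> colon R M N {x}"
      hence r: "r \<in> carrier R" "r \<odot>\<^bsub>M\<^esub> x \<in> N" by (auto simp: colon_def)
      show "r \<in> p"
      proof (rule ccontr)
        assume "r \<notin> p"
        have "colon R M {\<zero>\<^bsub>M\<^esub>} N \<subseteq> p"
        proof
          fix t assume "t \<in> colon R M {\<zero>\<^bsub>M\<^esub>} N"
          hence t: "t \<in> carrier R" "t \<odot>\<^bsub>M\<^esub> (r \<odot>\<^bsub>M\<^esub> x) = \<zero>\<^bsub>M\<^esub>" using r(2) by (auto simp: colon_def)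
          hence "t \<otimes> r \<in> p" using memp[of "t \<otimes> r"] r(1) x(1) by (simp add: M.smult_assoc1)
          thus "t \<in> p" using p.I_prime[OF t(1) r(1)] \<open>r \<notin> p\<close> by blast
        qed
        thus False using cd_at_most_submodule_prime[OF assms(1,2) sub(2) N(1) p] bad by blast
      qed
    qed
    thus "p \<in> Ass R (quot_module (M\<lparr>carrier := L\<rparr>) N)"
      unfolding Ass_quot_eq[OF assms(1) sub] using p xL by blast
  }
qed

text \<open>A prime over the annihilator of L/N contains an associated prime of L/N. The latter has
  the bound i + 1 by assumption, and the bound passes to larger primes.\<close>

lemma cd_at_most_of_Ass_quotient:
  assumes "module R M" "fin_gen_module R M"
    and sub: "submodule L R M" "submodule N R M" "N \<subseteq> L"
    and N: "cd_at_most i (M\<lparr>carrier := N\<rparr>)"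
    and ass: "Ass R (quot_module (M\<lparr>carrier := L\<rparr>) N) = Ass_cd R I (Suc i) M"
  shows "cd_at_most (Suc i) (M\<lparr>carrier := L\<rparr>)"
  unfolding cd_at_most_def
proof (intro allI impI)
  fix j assume j: "Suc i < j"
  interpret M: module R M by fact
  have NL: "submodule N R (M\<lparr>carrier := L\<rparr>)"
    using M.submodule_submodule_iff[OF sub(1)] sub(2,3) by blast
  show "vanishes j (M\<lparr>carrier := L\<rparr>)"
  proof (rule vanishes_devissage[OF M.submodule_module[OF sub(1)] fin_gen_submodule[OF assms(1,2) sub(1)] NL])
    show "vanishes j ((M\<lparr>carrier := L\<rparr>)\<lparr>carrier := N\<rparr>)" using N j unfolding cd_at_most_def by simp
    fix p assume p: "primeideal p R"
      "colon R (M\<lparr>carrier := L\<rparr>) N (carrier (M\<lparr>carrier := L\<rparr>)) \<subseteq> p"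
    hence "colon R M N L \<subseteq> p" by (simp add: colon_def)
    then obtain x where x: "x \<in> L" "primeideal (colon R M N {x}) R" "colon R M N {x} \<subseteq> p"
      using exists_prime_colon_below[OF assms(1,2) sub(2,1) p(1)] by metis
    hence "colon R M N {x} \<in> Ass_cd R I (Suc i) M"
      unfolding ass[symmetric] Ass_quot_eq[OF assms(1) sub] by blast
    hence "cd_at_most (Suc i) (RQ (colon R M N {x}))" unfolding Ass_cd_Suc_iff by blast
    hence "cd_at_most (Suc i) (RQ p)" by (rule cd_at_most_prime_mono[OF x(2) p(1) x(3)])
    thus "vanishes j (RQ p)" using j unfolding cd_at_most_def by blast
  qed
qed

text \<open>If T were not inside N, some prime (N : x) with x in T would be associated to L/N, so
  its quotient would violate the bound i; yet this prime contains the annihilator of T, and T has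
  the bound i.\<close>

lemma subset_of_Ass_quotient:
  assumes "module R M" "fin_gen_module R M"
    and sub: "submodule L R M" "submodule N R M" "N \<subseteq> L"
    and T: "submodule T R M" "cd_at_most i (M\<lparr>carrier := T\<rparr>)" "T \<subseteq> L"
    and ass: "Ass R (quot_module (M\<lparr>carrier := L\<rparr>) N) = Ass_cd R I (Suc i) M"
  shows "T \<subseteq> N"
proof (rule ccontr)
  assume "\<not> T \<subseteq> N"
  then obtain x0 where x0: "x0 \<in> T" "x0 \<notin> N" by blast
  interpret M: module R M by fact
  have disj: "colon R M N {x0} \<inter> {\<one>} = {}"
    using x0 submoduleD(1)[OF T(1)] by (auto simp: colon_def)
  obtain x where x: "x \<in> T" "primeideal (colon R M N {x}) R"
    by (rule exists_prime_colon[OF assms(1) sub(2) T(1) x0(1), of "{\<one>}"]) (use disj that in auto)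
  hence "colon R M N {x} \<in> Ass_cd R I (Suc i) M"
    unfolding ass[symmetric] Ass_quot_eq[OF assms(1) sub] using T(3) by blast
  hence bad: "\<not> cd_at_most i (RQ (colon R M N {x}))" unfolding Ass_cd_Suc_iff by blast
  have "colon R M {\<zero>\<^bsub>M\<^esub>} T \<subseteq> colon R M N {x}"
    by (rule M.colon_antimono) (use x(1) submoduleD(2)[OF sub(2)] in auto)
  thus False using cd_at_most_submodule_prime[OF assms(1,2) T(1,2) x(2)] bad by blast
qed

end

theorem theorem1p4:
  fixes R :: "('a, 'm) ring_scheme"
    and \<aa> :: "'a set"
    and M :: "('a, 'b, 'n) module_scheme"
    and c :: nat
    and Mf :: "nat \<Rightarrow> 'b set"
  assumes "cring R" and "noetherian_ring R"
    and "ideal \<aa> R" and "\<aa> \<noteq> carrier R"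
    and "module R M" and "fin_gen_module R M"
    and "cd R \<aa> M = ereal (real c)"
    and "\<And>i. i \<le> c \<Longrightarrow> submodule (Mf i) R M"
    and "\<And>i. i < c \<Longrightarrow> Mf i \<subseteq> Mf (Suc i)"
    and "Mf c = carrier M"
    and "cd R \<aa> (M\<lparr>carrier := Mf 0\<rparr>) = 0"
  shows "(\<forall>i. 1 \<le> i \<and> i \<le> c \<longrightarrow>
             Ass R (quot_module (M\<lparr>carrier := Mf i\<rparr>) (Mf (i - 1))) = Ass_cd R \<aa> i M)
         \<longleftrightarrow> is_cd_filtration R \<aa> M c Mf"
proof -
  interpret noetherian_ideal R \<aa>
    by (intro noetherian_ideal.intro noetherian_cring.intro noetherian_ideal_axioms.intro assms)
  note sub = assms(8) and inc = assms(9)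
  have iff: "is_cd_filtration R \<aa> M c Mf \<longleftrightarrow>
    (\<forall>i\<le>c. cd_at_most i (M\<lparr>carrier := Mf i\<rparr>) \<and>
       (\<forall>N. submodule N R M \<and> cd_at_most i (M\<lparr>carrier := N\<rparr>) \<longrightarrow> N \<subseteq> Mf i))"
    by (rule is_cd_filtration_iff[OF assms(5,7) sub])
  show ?thesis unfolding iff
  proof
    assume "\<forall>i. 1 \<le> i \<and> i \<le> c \<longrightarrow>
        Ass R (quot_module (M\<lparr>carrier := Mf i\<rparr>) (Mf (i - 1))) = Ass_cd R \<aa> i M"
    hence ass: "Ass R (quot_module (M\<lparr>carrier := Mf (Suc i)\<rparr>) (Mf i)) = Ass_cd R \<aa> (Suc i) M"
      if "i < c" for i using that by (metis Suc_leI diff_Suc_1 le_add1 plus_1_eq_Suc)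
    \<comment> \<open>Upwards from the assumption on \<open>Mf 0\<close>; each step adds the factor
      \<open>Mf (Suc i) / Mf i\<close>.\<close>
    have good: "cd_at_most i (M\<lparr>carrier := Mf i\<rparr>)" if "i \<le> c" for i
      using that
    proof (induction i)
      case 0
      show ?case
        using cd_le_iff[OF module.submodule_module[OF assms(5) sub[of 0]], of 0] assms(11) by simp
    next
      case (Suc i)
      show ?case
        by (rule cd_at_most_of_Ass_quotient[OF assms(5,6) sub sub inc])
           (use Suc ass in auto)
    qed
    \<comment> \<open>Downwards from \<open>Mf c\<close>, which is all of M: a submodule with bound
      i has the bound k for every k \<ge> i, so it is pushed from \<open>Mf (Suc k)\<close> into
      \<open>Mf k\<close>.\<close>
    have large: "N \<subseteq> Mf i" if N: "submodule N R M" "cd_at_most i (M\<lparr>carrier := N\<rparr>)" and i: "i \<le> c" for i N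
      using i
    proof (induction rule: inc_induct)
      case base
      show ?case unfolding assms(10) by (rule submoduleD(1)[OF N(1)])
    next
      case (step k)
      show ?case
        by (rule subset_of_Ass_quotient[OF assms(5,6) sub sub inc N(1) _ step.IH ass])
           (use step.hyps cd_at_most_mono[OF N(2)] in auto)
    qed
    show "\<forall>i\<le>c. cd_at_most i (M\<lparr>carrier := Mf i\<rparr>) \<and>
        (\<forall>N. submodule N R M \<and> cd_at_most i (M\<lparr>carrier := N\<rparr>) \<longrightarrow> N \<subseteq> Mf i)"
      using good large by blast
  next
    assume filt: "\<forall>i\<le>c. cd_at_most i (M\<lparr>carrier := Mf i\<rparr>) \<and>
        (\<forall>N. submodule N R M \<and> cd_at_most i (M\<lparr>carrier := N\<rparr>) \<longrightarrow> N \<subseteq> Mf i)"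
    show "\<forall>i. 1 \<le> i \<and> i \<le> c \<longrightarrow>
        Ass R (quot_module (M\<lparr>carrier := Mf i\<rparr>) (Mf (i - 1))) = Ass_cd R \<aa> i M"
    proof (intro allI impI)
      fix i assume i: "1 \<le> i \<and> i \<le> c"
      then obtain k where k: "i = Suc k" by (cases i) auto
      have "Ass R (quot_module (M\<lparr>carrier := Mf (Suc k)\<rparr>) (Mf k)) = Ass_cd R \<aa> (Suc k) M"
        by (rule Ass_quotient_of_cd_filtration[OF assms(5,6) sub sub inc]) (use filt i k in auto)
      thus "Ass R (quot_module (M\<lparr>carrier := Mf i\<rparr>) (Mf (i - 1))) = Ass_cd R \<aa> i M"
        unfolding k by simp
    qed
  qed
qed

end
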